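(* Assigning to each graph $E$ its graph C*-algebra $C^*(E)$, and to each regular extended path homomorphism $\varphi\colon S(E)\to S(F)$ the unique $*$-homomorphism $\widetilde{\varphi_*}\colon C^*(E)\to C^*(F)$ extending the induced $*$-homomorphism $\varphi_*\colon L_{\mathbb C}(E)\to L_{\mathbb C}(F)$, $S_{t}\mapsto S_{\varphi(t)}$ for $t\in S(E)$, defines a covariant functor from $\mathsf{REG}$ to the category $\mathsf{C^*}\text{-}\mathsf{Alg}$ of C*-algebras and $*$-homomorphisms.
   Context: A graph $E=(E^0,E^1,s_E,t_E)$ consists of arbitrary sets $E^0$ (vertices), $E^1$ (edges) and maps $s_E,t_E\colon E^1\to E^0$. A vertex $v$ is regular if $s_E^{-1}(v)$ is finite and nonempty; $\mathrm{reg}(E)$ is the set of regular vertices. $\mathrm{FP}(E)$ is the set of finite paths: vertices (length $0$) and sequences $e_1\ldots e_n$ of edges with $t_E(e_i)=s_E(e_{i+1})$; vertices act as units for concatenation. The graph inverse semigroup is $S(E)=\{(\alpha,\beta)\in \mathrm{FP}(E)^2\mid t_E(\alpha)=t_E(\beta)\}\cup\{0\}$ with $(\alpha,\beta)(\gamma,\delta)=(\alpha\gamma',\delta)$ if $\gamma=\beta\gamma'$, $=(\alpha,\delta\beta')$ if $\beta=\gamma\beta'$, and $=0$ otherwise; $0$ is a zero element. It is an inverse semigroup with $(\alpha,\beta)^*=(\beta,\alpha)$ and natural order $s\le t\iff ss^*t=s$. An extended path homomorphism from $E$ to $F$ is a semigroup homomorphism $\varphi\colon S(E)\to S(F)$ with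 $\varphi(0)=0$; it is regular if whenever $u\in\mathrm{reg}(E)$, $0\ne t\in S(F)$ and $t\le\varphi(u,u)$, there exists $e\in s_E^{-1}(u)$ with $t\varphi(e,e)\neq0$. $\mathsf{REG}$ is the category of graphs and regular extended path homomorphisms, with composition of maps. The Leavitt path algebra $L_{\mathbb C}(E)$ is the quotient of the contracted semigroup algebra of $S(E)$ over $\mathbb C$ (basis $S(E)\setminus\{0\}$, zero of $S(E)$ identified with $0$) by the ideal generated by $\{S_u-\sum_{e\in s_E^{-1}(u)}S_eS_e^*\mid u\in\mathrm{reg}(E)\}$, where $S_t$ denotes the class of $t\in S(E)$, $S_0=0$, $S_u=S_{(u,u)}$, $S_e=S_{(e,t_E(e))}$, $S_e^*=S_{(t_E(e),e)}$. It is a complex $*$-algebra with $S_t^*=S_{t^*}$. The graph C*-algebra $C^*(E)$ is the universal enveloping C*-algebra of $L_{\mathbb C}(E)$. *)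

theory Defs
  imports "HOL-Analysis.Analysis" "HOL-Library.FuncSet" "HOL-Library.Sublist"
    "Graph_Theory.Arc_Walk"
begin

section \<open>Categories and functors\<close>

text \<open>
  Hom-sets are indexed by pairs of objects and need not be disjoint; \<open>Comp C X Y Z g f\<close> is the
  composite of \<open>f\<close> from \<open>X\<close> to \<open>Y\<close> followed by \<open>g\<close> from \<open>Y\<close> to \<open>Z\<close>.
\<close>

record ('o, 'm) category =
  Obj :: "'o set"
  Hom :: "'o \<Rightarrow> 'o \<Rightarrow> 'm set"
  Id :: "'o \<Rightarrow> 'm"
  Comp :: "'o \<Rightarrow> 'o \<Rightarrow> 'o \<Rightarrow> 'm \<Rightarrow> 'm \<Rightarrow> 'm"

definition is_category :: "('o, 'm) category \<Rightarrow> bool" where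
  "is_category C \<longleftrightarrow>
    (\<forall>X\<in>Obj C. Id C X \<in> Hom C X X) \<and>
    (\<forall>X\<in>Obj C. \<forall>Y\<in>Obj C. \<forall>Z\<in>Obj C. \<forall>f\<in>Hom C X Y. \<forall>g\<in>Hom C Y Z. Comp C X Y Z g f \<in> Hom C X Z) \<and>
    (\<forall>X\<in>Obj C. \<forall>Y\<in>Obj C. \<forall>f\<in>Hom C X Y. Comp C X X Y f (Id C X) = f \<and> Comp C X Y Y (Id C Y) f = f) \<and>
    (\<forall>W\<in>Obj C. \<forall>X\<in>Obj C. \<forall>Y\<in>Obj C. \<forall>Z\<in>Obj C.
      \<forall>f\<in>Hom C W X. \<forall>g\<in>Hom C X Y. \<forall>h\<in>Hom C Y Z.
        Comp C W Y Z h (Comp C W X Y g f) = Comp C W X Z (Comp C X Y Z h g) f)"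

definition is_functor ::
  "('o, 'm) category \<Rightarrow> ('p, 'n) category \<Rightarrow> ('o \<Rightarrow> 'p) \<Rightarrow> ('o \<Rightarrow> 'o \<Rightarrow> 'm \<Rightarrow> 'n) \<Rightarrow> bool" where
  "is_functor C D Fo Fm \<longleftrightarrow>
    is_category C \<and> is_category D \<and>
    (\<forall>X\<in>Obj C. Fo X \<in> Obj D) \<and>
    (\<forall>X\<in>Obj C. \<forall>Y\<in>Obj C. \<forall>f\<in>Hom C X Y. Fm X Y f \<in> Hom D (Fo X) (Fo Y)) \<and>
    (\<forall>X\<in>Obj C. Fm X X (Id C X) = Id D (Fo X)) \<and>
    (\<forall>X\<in>Obj C. \<forall>Y\<in>Obj C. \<forall>Z\<in>Obj C. \<forall>f\<in>Hom C X Y. \<forall>g\<in>Hom C Y Z.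
      Fm X Z (Comp C X Y Z g f) = Comp D (Fo X) (Fo Y) (Fo Z) (Fm Y Z g) (Fm X Y f))"


section \<open>Graph inverse semigroups\<close>

text \<open>
  A graph is a \<open>pre_digraph\<close> satisfying \<open>wf_digraph\<close>; \<open>tail\<close> is the source map and \<open>head\<close> the
  target map.  A finite path is encoded as the pair of its source and its list of edges, so that
  \<open>(v, [])\<close> is the vertex \<open>v\<close> as a path of length 0.
\<close>

type_synonym ('v, 'e) path = "'v \<times> 'e list"

definition reg_verts :: "('v, 'e) pre_digraph \<Rightarrow> 'v set" where
  "reg_verts E = {v \<in> verts E. finite (out_arcs E v) \<and> out_arcs E v \<noteq> {}}"

definition fin_paths :: "('v, 'e) pre_digraph \<Rightarrow> ('v, 'e) path set" where
  "fin_paths E = {(u, p). \<exists>v. pre_digraph.awalk E u p v}"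

definition path_target :: "('v, 'e) pre_digraph \<Rightarrow> ('v, 'e) path \<Rightarrow> 'v" where
  "path_target E = (\<lambda>(u, p). last (pre_digraph.awalk_verts E u p))"

definition vertex_path :: "'v \<Rightarrow> ('v, 'e) path" where
  "vertex_path v = (v, [])"

definition edge_path :: "('v, 'e) pre_digraph \<Rightarrow> 'e \<Rightarrow> ('v, 'e) path" where
  "edge_path E e = (tail E e, [e])"

datatype ('v, 'e) gis_elem = Zero | Pr "('v, 'e) path" "('v, 'e) path"

definition gis :: "('v, 'e) pre_digraph \<Rightarrow> ('v, 'e) gis_elem set" where
  "gis E = insert Zero
    {Pr \<alpha> \<beta> | \<alpha> \<beta>. \<alpha> \<in> fin_paths E \<and> \<beta> \<in> fin_paths E \<and> path_target E \<alpha> = path_target E \<beta>}"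

text \<open>
  For paths of the same graph, \<open>\<gamma> = \<beta>\<gamma>'\<close> for some path \<open>\<gamma>'\<close> iff \<open>\<beta>\<close> and \<open>\<gamma>\<close> have the same source
  and the edge list of \<open>\<beta>\<close> is a prefix of that of \<open>\<gamma>\<close>; then \<open>\<gamma>'\<close> has the remaining edges, and
  \<open>extend_by \<alpha> \<beta> \<gamma>\<close> is \<open>\<alpha>\<gamma>'\<close>.
\<close>

definition path_prefix :: "('v, 'e) path \<Rightarrow> ('v, 'e) path \<Rightarrow> bool" where
  "path_prefix \<beta> \<gamma> \<longleftrightarrow> fst \<beta> = fst \<gamma> \<and> prefix (snd \<beta>) (snd \<gamma>)"

definition extend_by :: "('v, 'e) path \<Rightarrow> ('v, 'e) path \<Rightarrow> ('v, 'e) path \<Rightarrow> ('v, 'e) path" where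
  "extend_by \<alpha> \<beta> \<gamma> = (fst \<alpha>, snd \<alpha> @ drop (length (snd \<beta>)) (snd \<gamma>))"

fun gis_mult :: "('v, 'e) gis_elem \<Rightarrow> ('v, 'e) gis_elem \<Rightarrow> ('v, 'e) gis_elem" where
  "gis_mult (Pr \<alpha> \<beta>) (Pr \<gamma> \<delta>) =
    (if path_prefix \<beta> \<gamma> then Pr (extend_by \<alpha> \<beta> \<gamma>) \<delta>
     else if path_prefix \<gamma> \<beta> then Pr \<alpha> (extend_by \<delta> \<gamma> \<beta>)
     else Zero)"
| "gis_mult _ _ = Zero"

fun gis_star :: "('v, 'e) gis_elem \<Rightarrow> ('v, 'e) gis_elem" where
  "gis_star Zero = Zero"
| "gis_star (Pr \<alpha> \<beta>) = Pr \<beta> \<alpha>"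

definition gis_le :: "('v, 'e) gis_elem \<Rightarrow> ('v, 'e) gis_elem \<Rightarrow> bool" where
  "gis_le s t \<longleftrightarrow> gis_mult (gis_mult s (gis_star s)) t = s"

text \<open>
  All morphisms below are extensional functions on the carrier of their domain, so that equality of
  morphisms is equality of functions.
\<close>

definition ext_path_hom ::
  "('v, 'e) pre_digraph \<Rightarrow> ('w, 'f) pre_digraph \<Rightarrow> (('v, 'e) gis_elem \<Rightarrow> ('w, 'f) gis_elem) set" where
  "ext_path_hom E F = {\<phi> \<in> gis E \<rightarrow>\<^sub>E gis F.
    \<phi> Zero = Zero \<and> (\<forall>s\<in>gis E. \<forall>t\<in>gis E. \<phi> (gis_mult s t) = gis_mult (\<phi> s) (\<phi> t))}"

definition reg_hom ::
  "('v, 'e) pre_digraph \<Rightarrow> ('w, 'f) pre_digraph \<Rightarrow> (('v, 'e) gis_elem \<Rightarrow> ('w, 'f) gis_elem) set" where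
  "reg_hom E F = {\<phi> \<in> ext_path_hom E F.
    \<forall>u\<in>reg_verts E. \<forall>t\<in>gis F.
      t \<noteq> Zero \<and> gis_le t (\<phi> (Pr (vertex_path u) (vertex_path u))) \<longrightarrow>
      (\<exists>e\<in>out_arcs E u. gis_mult t (\<phi> (Pr (edge_path E e) (edge_path E e))) \<noteq> Zero)}"

definition REG ::
  "(('v, 'e) pre_digraph, ('v, 'e) gis_elem \<Rightarrow> ('v, 'e) gis_elem) category" where
  "REG = \<lparr>Obj = {E. wf_digraph E}, Hom = reg_hom, Id = (\<lambda>E. restrict id (gis E)),
    Comp = (\<lambda>E F G \<psi> \<phi>. compose (gis E) \<psi> \<phi>)\<rparr>"


section \<open>Complex *-algebras and C*-algebras\<close>

text \<open>Algebras are not required to be unital, nor homomorphisms to preserve a unit.\<close>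

record 'a star_alg =
  carr :: "'a set"
  zeroA :: 'a
  addA :: "'a \<Rightarrow> 'a \<Rightarrow> 'a"
  scaleA :: "complex \<Rightarrow> 'a \<Rightarrow> 'a"
  multA :: "'a \<Rightarrow> 'a \<Rightarrow> 'a"
  starA :: "'a \<Rightarrow> 'a"

record 'a normed_star_alg = "'a star_alg" +
  normA :: "'a \<Rightarrow> real"

definition diffA :: "('a, 'z) star_alg_scheme \<Rightarrow> 'a \<Rightarrow> 'a \<Rightarrow> 'a" where
  "diffA A x y = addA A x (scaleA A (-1) y)"

definition star_algebra :: "('a, 'z) star_alg_scheme \<Rightarrow> bool" where
  "star_algebra A \<longleftrightarrow>
    zeroA A \<in> carr A \<and>
    (\<forall>x\<in>carr A. \<forall>y\<in>carr A. addA A x y \<in> carr A \<and> multA A x y \<in> carr A) \<and>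
    (\<forall>c. \<forall>x\<in>carr A. scaleA A c x \<in> carr A) \<and>
    (\<forall>x\<in>carr A. starA A x \<in> carr A) \<and>
    (\<forall>x\<in>carr A. \<forall>y\<in>carr A. \<forall>z\<in>carr A.
      addA A (addA A x y) z = addA A x (addA A y z) \<and>
      multA A (multA A x y) z = multA A x (multA A y z) \<and>
      multA A (addA A x y) z = addA A (multA A x z) (multA A y z) \<and>
      multA A x (addA A y z) = addA A (multA A x y) (multA A x z)) \<and>
    (\<forall>x\<in>carr A. \<forall>y\<in>carr A. addA A x y = addA A y x) \<and>
    (\<forall>x\<in>carr A. addA A x (zeroA A) = x \<and> diffA A x x = zeroA A) \<and>
    (\<forall>x\<in>carr A. scaleA A 1 x = x) \<and>
    (\<forall>c d. \<forall>x\<in>carr A. scaleA A c (scaleA A d x) = scaleA A (c * d) x \<and>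
      scaleA A (c + d) x = addA A (scaleA A c x) (scaleA A d x)) \<and>
    (\<forall>c. \<forall>x\<in>carr A. \<forall>y\<in>carr A.
      scaleA A c (addA A x y) = addA A (scaleA A c x) (scaleA A c y) \<and>
      multA A (scaleA A c x) y = scaleA A c (multA A x y) \<and>
      multA A x (scaleA A c y) = scaleA A c (multA A x y)) \<and>
    (\<forall>x\<in>carr A. starA A (starA A x) = x) \<and>
    (\<forall>c. \<forall>x\<in>carr A. starA A (scaleA A c x) = scaleA A (cnj c) (starA A x)) \<and>
    (\<forall>x\<in>carr A. \<forall>y\<in>carr A.
      starA A (addA A x y) = addA A (starA A x) (starA A y) \<and>
      starA A (multA A x y) = multA A (starA A y) (starA A x))"

definition cstar_seminorm :: "('a, 'z) star_alg_scheme \<Rightarrow> ('a \<Rightarrow> real) \<Rightarrow> bool" where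
  "cstar_seminorm A p \<longleftrightarrow>
    (\<forall>x\<in>carr A. 0 \<le> p x) \<and>
    (\<forall>c. \<forall>x\<in>carr A. p (scaleA A c x) = cmod c * p x) \<and>
    (\<forall>x\<in>carr A. \<forall>y\<in>carr A. p (addA A x y) \<le> p x + p y \<and> p (multA A x y) \<le> p x * p y) \<and>
    (\<forall>x\<in>carr A. p (multA A (starA A x) x) = (p x)\<^sup>2)"

definition cauchy_seqs :: "('a, 'z) star_alg_scheme \<Rightarrow> ('a \<Rightarrow> real) \<Rightarrow> (nat \<Rightarrow> 'a) set" where
  "cauchy_seqs A p = {x. (\<forall>n. x n \<in> carr A) \<and>
    (\<forall>\<epsilon>>0. \<exists>N. \<forall>m\<ge>N. \<forall>n\<ge>N. p (diffA A (x m) (x n)) < \<epsilon>)}"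

definition cstar_algebra :: "'a normed_star_alg \<Rightarrow> bool" where
  "cstar_algebra A \<longleftrightarrow>
    star_algebra A \<and> cstar_seminorm A (normA A) \<and>
    (\<forall>x\<in>carr A. normA A x = 0 \<longrightarrow> x = zeroA A) \<and>
    (\<forall>x\<in>cauchy_seqs A (normA A). \<exists>l\<in>carr A. (\<lambda>n. normA A (diffA A (x n) l)) \<longlonglongrightarrow> 0)"

definition star_hom :: "('a, 'y) star_alg_scheme \<Rightarrow> ('b, 'z) star_alg_scheme \<Rightarrow> ('a \<Rightarrow> 'b) set" where
  "star_hom A B = {f \<in> carr A \<rightarrow>\<^sub>E carr B.
    (\<forall>x\<in>carr A. \<forall>y\<in>carr A. f (addA A x y) = addA B (f x) (f y) \<and>
      f (multA A x y) = multA B (f x) (f y)) \<and>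
    (\<forall>c. \<forall>x\<in>carr A. f (scaleA A c x) = scaleA B c (f x)) \<and>
    (\<forall>x\<in>carr A. f (starA A x) = starA B (f x))}"

definition CSTAR_ALG :: "('a normed_star_alg, 'a \<Rightarrow> 'a) category" where
  "CSTAR_ALG = \<lparr>Obj = {A. cstar_algebra A}, Hom = star_hom, Id = (\<lambda>A. restrict id (carr A)),
    Comp = (\<lambda>A B C g f. compose (carr A) g f)\<rparr>"


section \<open>Quotients and Leavitt path algebras\<close>

definition two_sided_ideal :: "('a, 'z) star_alg_scheme \<Rightarrow> 'a set \<Rightarrow> bool" where
  "two_sided_ideal A I \<longleftrightarrow>
    I \<subseteq> carr A \<and> zeroA A \<in> I \<and>
    (\<forall>x\<in>I. \<forall>y\<in>I. addA A x y \<in> I) \<and> (\<forall>c. \<forall>x\<in>I. scaleA A c x \<in> I) \<and>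
    (\<forall>a\<in>carr A. \<forall>x\<in>I. multA A a x \<in> I \<and> multA A x a \<in> I)"

definition ideal_gen :: "('a, 'z) star_alg_scheme \<Rightarrow> 'a set \<Rightarrow> 'a set" where
  "ideal_gen A R = \<Inter>{I. two_sided_ideal A I \<and> R \<subseteq> I}"

definition coset :: "('a, 'z) star_alg_scheme \<Rightarrow> 'a set \<Rightarrow> 'a \<Rightarrow> 'a set" where
  "coset A I x = {addA A x i | i. i \<in> I}"

definition rep :: "'a set \<Rightarrow> 'a" where
  "rep X = (SOME x. x \<in> X)"

text \<open>
  The operations on the quotient are defined through representatives.  The involution is
  well-defined when \<open>I\<close> is closed under it; this holds for the ideal used below, whose generators
  are self-adjoint.
\<close>

definition quotient_alg :: "('a, 'z) star_alg_scheme \<Rightarrow> 'a set \<Rightarrow> 'a set star_alg" where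
  "quotient_alg A I = \<lparr>carr = coset A I ` carr A,
    zeroA = coset A I (zeroA A),
    addA = (\<lambda>X Y. coset A I (addA A (rep X) (rep Y))),
    scaleA = (\<lambda>c X. coset A I (scaleA A c (rep X))),
    multA = (\<lambda>X Y. coset A I (multA A (rep X) (rep Y))),
    starA = (\<lambda>X. coset A I (starA A (rep X)))\<rparr>"

definition contracted_alg :: "('v, 'e) pre_digraph \<Rightarrow> (('v, 'e) gis_elem \<Rightarrow> complex) star_alg" where
  "contracted_alg E = \<lparr>carr = {f. finite {s. f s \<noteq> 0} \<and> {s. f s \<noteq> 0} \<subseteq> gis E - {Zero}},
    zeroA = (\<lambda>_. 0),
    addA = (\<lambda>f g s. f s + g s),
    scaleA = (\<lambda>c f s. c * f s),
    multA = (\<lambda>f g r. if r = Zero then 0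
      else \<Sum>s | f s \<noteq> 0. \<Sum>t | g t \<noteq> 0. if gis_mult s t = r then f s * g t else 0),
    starA = (\<lambda>f s. cnj (f (gis_star s)))\<rparr>"

definition basis_elem :: "('v, 'e) gis_elem \<Rightarrow> ('v, 'e) gis_elem \<Rightarrow> complex" where
  "basis_elem t = (\<lambda>s. if s = t \<and> t \<noteq> Zero then 1 else 0)"

definition vertex_elem :: "'v \<Rightarrow> ('v, 'e) gis_elem" where
  "vertex_elem u = Pr (vertex_path u) (vertex_path u)"

definition edge_elem :: "('v, 'e) pre_digraph \<Rightarrow> 'e \<Rightarrow> ('v, 'e) gis_elem" where
  "edge_elem E e = Pr (edge_path E e) (vertex_path (head E e))"

definition leavitt_relation ::
  "('v, 'e) pre_digraph \<Rightarrow> 'v \<Rightarrow> ('v, 'e) gis_elem \<Rightarrow> complex" where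
  "leavitt_relation E u = (\<lambda>s. basis_elem (vertex_elem u) s -
    (\<Sum>e\<in>out_arcs E u. multA (contracted_alg E) (basis_elem (edge_elem E e))
                                     (basis_elem (gis_star (edge_elem E e))) s))"

definition leavitt_ideal :: "('v, 'e) pre_digraph \<Rightarrow> (('v, 'e) gis_elem \<Rightarrow> complex) set" where
  "leavitt_ideal E = ideal_gen (contracted_alg E) (leavitt_relation E ` reg_verts E)"

definition leavitt :: "('v, 'e) pre_digraph \<Rightarrow> (('v, 'e) gis_elem \<Rightarrow> complex) set star_alg" where
  "leavitt E = quotient_alg (contracted_alg E) (leavitt_ideal E)"

definition leavitt_gen ::
  "('v, 'e) pre_digraph \<Rightarrow> ('v, 'e) gis_elem \<Rightarrow> (('v, 'e) gis_elem \<Rightarrow> complex) set" where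
  "leavitt_gen E t = coset (contracted_alg E) (leavitt_ideal E) (basis_elem t)"


section \<open>Universal enveloping C*-algebras and graph C*-algebras\<close>

text \<open>
  \<open>B\<close> ranges over the C*-algebras whose elements have the type given by the first argument.
\<close>

definition universal_enveloping ::
  "'b itself \<Rightarrow> ('a, 'z) star_alg_scheme \<Rightarrow> 'c normed_star_alg \<Rightarrow> ('a \<Rightarrow> 'c) \<Rightarrow> bool" where
  "universal_enveloping _ A C \<iota> \<longleftrightarrow>
    cstar_algebra C \<and> \<iota> \<in> star_hom A C \<and>
    (\<forall>(B :: 'b normed_star_alg) \<pi>. cstar_algebra B \<and> \<pi> \<in> star_hom A B \<longrightarrow>
      (\<exists>!\<rho>. \<rho> \<in> star_hom C B \<and> (\<forall>x\<in>carr A. \<rho> (\<iota> x) = \<pi> x)))"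

text \<open>
  The usual construction of the enveloping C*-algebra: the Hausdorff completion with respect to the
  largest C*-seminorm.  The C*-seminorms on a *-algebra are exactly the functions
  \<open>x \<mapsto> \<parallel>\<pi> x\<parallel>\<close> for *-homomorphisms \<open>\<pi>\<close> to C*-algebras.  The supremum is only meaningful
  when the values are bounded; in a Leavitt path algebra they are, since the generators are
  partial isometries.
\<close>

definition env_seminorm :: "('a, 'z) star_alg_scheme \<Rightarrow> 'a \<Rightarrow> real" where
  "env_seminorm A x = Sup {p x | p. cstar_seminorm A p}"

definition seq_class ::
  "('a, 'z) star_alg_scheme \<Rightarrow> ('a \<Rightarrow> real) \<Rightarrow> (nat \<Rightarrow> 'a) \<Rightarrow> (nat \<Rightarrow> 'a) set" where
  "seq_class A p x = {y \<in> cauchy_seqs A p. (\<lambda>n. p (diffA A (x n) (y n))) \<longlonglongrightarrow> 0}"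

definition completion ::
  "('a, 'z) star_alg_scheme \<Rightarrow> ('a \<Rightarrow> real) \<Rightarrow> (nat \<Rightarrow> 'a) set normed_star_alg" where
  "completion A p = \<lparr>carr = seq_class A p ` cauchy_seqs A p,
    zeroA = seq_class A p (\<lambda>_. zeroA A),
    addA = (\<lambda>X Y. seq_class A p (\<lambda>n. addA A (rep X n) (rep Y n))),
    scaleA = (\<lambda>c X. seq_class A p (\<lambda>n. scaleA A c (rep X n))),
    multA = (\<lambda>X Y. seq_class A p (\<lambda>n. multA A (rep X n) (rep Y n))),
    starA = (\<lambda>X. seq_class A p (\<lambda>n. starA A (rep X n))),
    normA = (\<lambda>X. lim (\<lambda>n. p (rep X n)))\<rparr>"

definition graph_cstar ::
  "('v, 'e) pre_digraph \<Rightarrow> (nat \<Rightarrow> (('v, 'e) gis_elem \<Rightarrow> complex) set) set normed_star_alg" where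
  "graph_cstar E = completion (leavitt E) (env_seminorm (leavitt E))"

definition graph_cstar_incl ::
  "('v, 'e) pre_digraph \<Rightarrow> (('v, 'e) gis_elem \<Rightarrow> complex) set
    \<Rightarrow> (nat \<Rightarrow> (('v, 'e) gis_elem \<Rightarrow> complex) set) set" where
  "graph_cstar_incl E =
    (\<lambda>x\<in>carr (leavitt E). seq_class (leavitt E) (env_seminorm (leavitt E)) (\<lambda>_. x))"


section \<open>Induced homomorphisms\<close>

definition is_leavitt_map ::
  "('v, 'e) pre_digraph \<Rightarrow> ('w, 'f) pre_digraph \<Rightarrow> (('v, 'e) gis_elem \<Rightarrow> ('w, 'f) gis_elem)
    \<Rightarrow> ((('v, 'e) gis_elem \<Rightarrow> complex) set \<Rightarrow> (('w, 'f) gis_elem \<Rightarrow> complex) set) \<Rightarrow> bool" where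
  "is_leavitt_map E F \<phi> f \<longleftrightarrow>
    f \<in> star_hom (leavitt E) (leavitt F) \<and>
    (\<forall>t\<in>gis E. f (leavitt_gen E t) = leavitt_gen F (\<phi> t))"

definition leavitt_map ::
  "('v, 'e) pre_digraph \<Rightarrow> ('w, 'f) pre_digraph \<Rightarrow> (('v, 'e) gis_elem \<Rightarrow> ('w, 'f) gis_elem)
    \<Rightarrow> ((('v, 'e) gis_elem \<Rightarrow> complex) set \<Rightarrow> (('w, 'f) gis_elem \<Rightarrow> complex) set)" where
  "leavitt_map E F \<phi> = (THE f. is_leavitt_map E F \<phi> f)"

definition is_cstar_map ::
  "('v, 'e) pre_digraph \<Rightarrow> ('w, 'f) pre_digraph \<Rightarrow> (('v, 'e) gis_elem \<Rightarrow> ('w, 'f) gis_elem)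
    \<Rightarrow> ((nat \<Rightarrow> (('v, 'e) gis_elem \<Rightarrow> complex) set) set
        \<Rightarrow> (nat \<Rightarrow> (('w, 'f) gis_elem \<Rightarrow> complex) set) set) \<Rightarrow> bool" where
  "is_cstar_map E F \<phi> g \<longleftrightarrow>
    g \<in> star_hom (graph_cstar E) (graph_cstar F) \<and>
    (\<forall>x\<in>carr (leavitt E). g (graph_cstar_incl E x) = graph_cstar_incl F (leavitt_map E F \<phi> x))"

definition cstar_map ::
  "('v, 'e) pre_digraph \<Rightarrow> ('w, 'f) pre_digraph \<Rightarrow> (('v, 'e) gis_elem \<Rightarrow> ('w, 'f) gis_elem)
    \<Rightarrow> ((nat \<Rightarrow> (('v, 'e) gis_elem \<Rightarrow> complex) set) set
        \<Rightarrow> (nat \<Rightarrow> (('w, 'f) gis_elem \<Rightarrow> complex) set) set)" where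
  "cstar_map E F \<phi> = (THE g. is_cstar_map E F \<phi> g)"

end

(*
  A regular homomorphism sends a regular vertex u to an idempotent (alpha, alpha) or to 0, and the
  edges leaving u to the idempotents of pairwise incomparable extensions of alpha that cover all
  extensions of alpha.  Such a finite cover forces the vertices passed below it to be regular, so by
  induction on its depth (alpha, alpha) minus the sum over the cover lies in the Leavitt ideal; this
  gives the induced maps of Leavitt path algebras.  The same induction shows that regular
  homomorphisms compose.

  The enveloping C*-algebra exists because the generators are partial isometries, so that every
  C*-seminorm is at most 1 on them.  Uniqueness of extensions needs that *-homomorphisms between
  C*-algebras are contractive.  This is proved without spectral theory: a self-adjoint h of norm
  less than 1 is the mean of two unitaries, on which every C*-seminorm is isometric.
*)
theory Submission
  imports Defs
begin

section \<open>Complex *-algebras\<close>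

text \<open>Homomorphisms of *-algebras carry no continuity assumption, so two extensions that agree
  on a dense subalgebra might differ a priori. The remedy is to argue with seminorms instead of
  maps: a homomorphism pulls a C*-norm back to a C*-seminorm, and on a C*-algebra the norm is the
  largest one. The same device gives existence, since the enveloping seminorm dominates all
  pullbacks, whatever the type of the target. The algebras have no unit, so unitaries appear only
  through their left multiplications.

  On the semigroup side, regularity speaks of the edges at one vertex, while a homomorphism may send
  a vertex to a long path \<alpha>, some of its edges to zero and the others to extensions of
  \<alpha> of different lengths. Finite covers are the notion stable under this, and they can be
  peeled off edge by edge. Morphisms are only assumed multiplicative; that they respect the
  involution comes from uniqueness of inverses in an inverse semigroup.\<close>

locale star_alg =
  fixes A :: "('a, 'z) star_alg_scheme"
  assumes star_algebra: "star_algebra A"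
begin

abbreviation add_alg (infixl \<open>\<oplus>\<close> 65) where "x \<oplus> y \<equiv> addA A x y"
abbreviation diff_alg (infixl \<open>\<ominus>\<close> 65) where "x \<ominus> y \<equiv> diffA A x y"
abbreviation mult_alg (infixl \<open>\<otimes>\<close> 70) where "x \<otimes> y \<equiv> multA A x y"
abbreviation scale_alg (infixr \<open>\<odot>\<close> 75) where "c \<odot> x \<equiv> scaleA A c x"
abbreviation zero_alg (\<open>\<zero>\<close>) where "\<zero> \<equiv> zeroA A"
abbreviation star_op where "star_op x \<equiv> starA A x"

lemma closed [simp, intro]:
  "\<zero> \<in> carr A"
  "\<lbrakk>x \<in> carr A; y \<in> carr A\<rbrakk> \<Longrightarrow> x \<oplus> y \<in> carr A"
  "\<lbrakk>x \<in> carr A; y \<in> carr A\<rbrakk> \<Longrightarrow> x \<otimes> y \<in> carr A"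
  "x \<in> carr A \<Longrightarrow> c \<odot> x \<in> carr A"
  "x \<in> carr A \<Longrightarrow> star_op x \<in> carr A"
  using star_algebra unfolding star_algebra_def by simp_all

lemma diff_closed [simp, intro]: "\<lbrakk>x \<in> carr A; y \<in> carr A\<rbrakk> \<Longrightarrow> x \<ominus> y \<in> carr A"
  by (simp add: diffA_def)

lemma add_assoc:
  "\<lbrakk>x \<in> carr A; y \<in> carr A; z \<in> carr A\<rbrakk> \<Longrightarrow> (x \<oplus> y) \<oplus> z = x \<oplus> (y \<oplus> z)"
  using star_algebra unfolding star_algebra_def by blast

lemma add_commute: "\<lbrakk>x \<in> carr A; y \<in> carr A\<rbrakk> \<Longrightarrow> x \<oplus> y = y \<oplus> x"
  using star_algebra unfolding star_algebra_def by blast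

lemma add_left_commute:
  "\<lbrakk>x \<in> carr A; y \<in> carr A; z \<in> carr A\<rbrakk> \<Longrightarrow> x \<oplus> (y \<oplus> z) = y \<oplus> (x \<oplus> z)"
  by (metis add_assoc add_commute)

lemmas add_ac = add_assoc add_commute add_left_commute

lemma mult_assoc:
  "\<lbrakk>x \<in> carr A; y \<in> carr A; z \<in> carr A\<rbrakk> \<Longrightarrow> (x \<otimes> y) \<otimes> z = x \<otimes> (y \<otimes> z)"
  using star_algebra unfolding star_algebra_def by blast

lemma distrib:
  "\<lbrakk>x \<in> carr A; y \<in> carr A; z \<in> carr A\<rbrakk> \<Longrightarrow> (x \<oplus> y) \<otimes> z = x \<otimes> z \<oplus> y \<otimes> z"
  "\<lbrakk>x \<in> carr A; y \<in> carr A; z \<in> carr A\<rbrakk> \<Longrightarrow> x \<otimes> (y \<oplus> z) = x \<otimes> y \<oplus> x \<otimes> z"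
  using star_algebra unfolding star_algebra_def by blast+

lemma add_zero [simp]: "x \<in> carr A \<Longrightarrow> x \<oplus> \<zero> = x"
  using star_algebra unfolding star_algebra_def by blast

lemma zero_add [simp]: "x \<in> carr A \<Longrightarrow> \<zero> \<oplus> x = x"
  using add_commute[of \<zero> x] by simp

lemma diff_self [simp]: "x \<in> carr A \<Longrightarrow> x \<ominus> x = \<zero>"
  using star_algebra unfolding star_algebra_def by blast

lemma scale_one [simp]: "x \<in> carr A \<Longrightarrow> 1 \<odot> x = x"
  using star_algebra unfolding star_algebra_def by blast

lemma scale_scale [simp]: "x \<in> carr A \<Longrightarrow> c \<odot> d \<odot> x = (c * d) \<odot> x"
  using star_algebra unfolding star_algebra_def by blast

lemma scale_add_left: "x \<in> carr A \<Longrightarrow> (c + d) \<odot> x = c \<odot> x \<oplus> d \<odot> x"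
  using star_algebra unfolding star_algebra_def by blast

lemma scale_add: "\<lbrakk>x \<in> carr A; y \<in> carr A\<rbrakk> \<Longrightarrow> c \<odot> (x \<oplus> y) = c \<odot> x \<oplus> c \<odot> y"
  using star_algebra unfolding star_algebra_def by blast

lemma mult_scale [simp]:
  "\<lbrakk>x \<in> carr A; y \<in> carr A\<rbrakk> \<Longrightarrow> (c \<odot> x) \<otimes> y = c \<odot> (x \<otimes> y)"
  "\<lbrakk>x \<in> carr A; y \<in> carr A\<rbrakk> \<Longrightarrow> x \<otimes> (c \<odot> y) = c \<odot> (x \<otimes> y)"
  using star_algebra unfolding star_algebra_def by blast+

lemma star_star [simp]: "x \<in> carr A \<Longrightarrow> star_op (star_op x) = x"
  using star_algebra unfolding star_algebra_def by blast

lemma star_scale [simp]: "x \<in> carr A \<Longrightarrow> star_op (c \<odot> x) = cnj c \<odot> star_op x"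
  using star_algebra unfolding star_algebra_def by blast

lemma star_add [simp]:
  "\<lbrakk>x \<in> carr A; y \<in> carr A\<rbrakk> \<Longrightarrow> star_op (x \<oplus> y) = star_op x \<oplus> star_op y"
  using star_algebra unfolding star_algebra_def by blast

lemma star_mult [simp]:
  "\<lbrakk>x \<in> carr A; y \<in> carr A\<rbrakk> \<Longrightarrow> star_op (x \<otimes> y) = star_op y \<otimes> star_op x"
  using star_algebra unfolding star_algebra_def by blast

lemma zero_scale [simp]: "x \<in> carr A \<Longrightarrow> 0 \<odot> x = \<zero>"
  using scale_add_left[of x 1 "-1"] diff_self[of x] by (simp add: diffA_def)

lemma scale_zero [simp]: "c \<odot> \<zero> = \<zero>"
  using zero_scale[of \<zero>] scale_scale[of \<zero> c 0] by simp

lemma mult_zero [simp]: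
  assumes "x \<in> carr A" shows "x \<otimes> \<zero> = \<zero>" "\<zero> \<otimes> x = \<zero>"
  using assms mult_scale[of \<zero> x 0] mult_scale[of x \<zero> 0] by simp_all

lemma star_zero [simp]: "star_op \<zero> = \<zero>"
  using star_scale[of \<zero> 0] by simp

lemma add_scale_neg [simp]:
  "x \<in> carr A \<Longrightarrow> x \<oplus> (-1) \<odot> x = \<zero>"
  "x \<in> carr A \<Longrightarrow> (-1) \<odot> x \<oplus> x = \<zero>"
  using diff_self[of x] add_commute[of x "(-1) \<odot> x"] by (simp_all add: diffA_def)

lemma add_cancel_neg [simp]:
  assumes "x \<in> carr A" "y \<in> carr A"
  shows "x \<oplus> ((-1) \<odot> x \<oplus> y) = y" "(-1) \<odot> x \<oplus> (x \<oplus> y) = y"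
  using assms by (simp_all flip: add_assoc)

lemma diff_add_cancel [simp]: "\<lbrakk>x \<in> carr A; y \<in> carr A\<rbrakk> \<Longrightarrow> (x \<ominus> y) \<oplus> y = x"
  by (simp add: diffA_def add_assoc)

lemma add_diff_cancel [simp]: "\<lbrakk>x \<in> carr A; y \<in> carr A\<rbrakk> \<Longrightarrow> (x \<oplus> y) \<ominus> y = x"
  by (simp add: diffA_def add_assoc)

lemma diff_zero [simp]: "x \<in> carr A \<Longrightarrow> x \<ominus> \<zero> = x"
  by (simp add: diffA_def)

lemma diff_eq_zero: "\<lbrakk>x \<in> carr A; y \<in> carr A; x \<ominus> y = \<zero>\<rbrakk> \<Longrightarrow> x = y"
  using diff_add_cancel[of x y] by simp

lemma diff_telescope:
  "\<lbrakk>x \<in> carr A; y \<in> carr A; z \<in> carr A\<rbrakk> \<Longrightarrow> x \<ominus> z = (x \<ominus> y) \<oplus> (y \<ominus> z)"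
  by (simp add: diffA_def add_assoc)

lemma add_diff_add:
  "\<lbrakk>x \<in> carr A; y \<in> carr A; z \<in> carr A; w \<in> carr A\<rbrakk>
    \<Longrightarrow> (x \<oplus> y) \<ominus> (z \<oplus> w) = (x \<ominus> z) \<oplus> (y \<ominus> w)"
  by (simp add: diffA_def scale_add add_ac)

lemma scale_diff: "\<lbrakk>x \<in> carr A; y \<in> carr A\<rbrakk> \<Longrightarrow> c \<odot> x \<ominus> c \<odot> y = c \<odot> (x \<ominus> y)"
  by (simp add: diffA_def scale_add)

lemma star_diff: "\<lbrakk>x \<in> carr A; y \<in> carr A\<rbrakk> \<Longrightarrow> star_op x \<ominus> star_op y = star_op (x \<ominus> y)"
  by (simp add: diffA_def)

lemma mult_diff_mult:
  "\<lbrakk>x \<in> carr A; y \<in> carr A; z \<in> carr A; w \<in> carr A\<rbrakk>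
    \<Longrightarrow> x \<otimes> y \<ominus> z \<otimes> w = (x \<ominus> z) \<otimes> y \<oplus> z \<otimes> (y \<ominus> w)"
  by (simp add: diffA_def distrib add_assoc)

lemma diff_swap: "\<lbrakk>x \<in> carr A; y \<in> carr A\<rbrakk> \<Longrightarrow> y \<ominus> x = (-1) \<odot> (x \<ominus> y)"
  by (simp add: diffA_def scale_add add_commute)

end

text \<open>The axioms are equations and closure conditions, so they pass to a surjective image
  compatible with all operations. This serves completions, as images of the algebra of Cauchy
  sequences, and quotients by ideals.\<close>

lemma star_algebra_surj_image:
  assumes A: "star_algebra A" and im: "carr B = h ` carr A"
    and zero: "zeroA B = h (zeroA A)"
    and add: "\<And>x y. \<lbrakk>x \<in> carr A; y \<in> carr A\<rbrakk> \<Longrightarrow> addA B (h x) (h y) = h (addA A x y)"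
    and mult: "\<And>x y. \<lbrakk>x \<in> carr A; y \<in> carr A\<rbrakk> \<Longrightarrow> multA B (h x) (h y) = h (multA A x y)"
    and scale: "\<And>c x. x \<in> carr A \<Longrightarrow> scaleA B c (h x) = h (scaleA A c x)"
    and star: "\<And>x. x \<in> carr A \<Longrightarrow> starA B (h x) = h (starA A x)"
  shows "star_algebra B"
proof -
  interpret star_alg A using A by unfold_locales
  show ?thesis
    unfolding star_algebra_def diffA_def im zero
    by (simp add: add mult scale star add_assoc mult_assoc distrib scale_add_left scale_add)
      (simp add: add_commute)
qed

section \<open>C*-seminorms and limits\<close>

locale seminormed_star_alg = star_alg +
  fixes p :: "'a \<Rightarrow> real"
  assumes cstar_seminorm: "cstar_seminorm A p"
begin

lemma seminorm_nonneg [simp]: "x \<in> carr A \<Longrightarrow> 0 \<le> p x"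
  using cstar_seminorm unfolding cstar_seminorm_def by blast

lemma seminorm_scale [simp]: "x \<in> carr A \<Longrightarrow> p (c \<odot> x) = cmod c * p x"
  using cstar_seminorm unfolding cstar_seminorm_def by blast

lemma seminorm_add: "\<lbrakk>x \<in> carr A; y \<in> carr A\<rbrakk> \<Longrightarrow> p (x \<oplus> y) \<le> p x + p y"
  using cstar_seminorm unfolding cstar_seminorm_def by blast

lemma seminorm_mult: "\<lbrakk>x \<in> carr A; y \<in> carr A\<rbrakk> \<Longrightarrow> p (x \<otimes> y) \<le> p x * p y"
  using cstar_seminorm unfolding cstar_seminorm_def by blast

lemma cstar_identity: "x \<in> carr A \<Longrightarrow> p (star_op x \<otimes> x) = (p x)\<^sup>2"
  using cstar_seminorm unfolding cstar_seminorm_def by blast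

lemma seminorm_zero [simp]: "p \<zero> = 0"
  using seminorm_scale[of \<zero> 0] by simp

text \<open>The C*-identity and submultiplicativity give p(y)^2 \<le> p(star y) p(y), hence p(y)
  \<le> p(star y); the same for star y gives equality.\<close>

lemma seminorm_star [simp]:
  assumes "x \<in> carr A" shows "p (star_op x) = p x"
proof -
  have le: "p y \<le> p (star_op y)" if "y \<in> carr A" for y
  proof (cases "p y = 0")
    case False
    with that have "p y > 0" using seminorm_nonneg[of y] by linarith
    moreover have "p y * p y \<le> p (star_op y) * p y"
      using cstar_identity[of y] seminorm_mult[of "star_op y" y] that by (simp add: power2_eq_square)
    ultimately show ?thesis by simp
  qed (use that in simp)
  show ?thesis using le[of x] le[of "star_op x"] assms by simp
qed

lemma seminorm_diff_swap: "\<lbrakk>x \<in> carr A; y \<in> carr A\<rbrakk> \<Longrightarrow> p (x \<ominus> y) = p (y \<ominus> x)"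
  using diff_swap[of x y] by simp

lemma seminorm_diff_triangle:
  "\<lbrakk>x \<in> carr A; y \<in> carr A; z \<in> carr A\<rbrakk> \<Longrightarrow> p (x \<ominus> z) \<le> p (x \<ominus> y) + p (y \<ominus> z)"
  using seminorm_add[of "x \<ominus> y" "y \<ominus> z"] by (simp add: diff_telescope[of x y z])

lemma abs_seminorm_diff:
  assumes "x \<in> carr A" "y \<in> carr A" shows "\<bar>p x - p y\<bar> \<le> p (x \<ominus> y)"
  using assms seminorm_diff_triangle[of x y \<zero>] seminorm_diff_triangle[of y x \<zero>]
    seminorm_diff_swap[of x y] by simp

lemma seminorm_mult_diff_mult:
  assumes "x \<in> carr A" "y \<in> carr A" "z \<in> carr A" "w \<in> carr A"
  shows "p (x \<otimes> y \<ominus> z \<otimes> w) \<le> p (x \<ominus> z) * p y + p z * p (y \<ominus> w)"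
  using assms seminorm_add[of "(x \<ominus> z) \<otimes> y" "z \<otimes> (y \<ominus> w)"]
    seminorm_mult[of "x \<ominus> z" y] seminorm_mult[of z "y \<ominus> w"]
  by (simp add: mult_diff_mult)

lemma seminorm_add_diff_add:
  assumes "x \<in> carr A" "y \<in> carr A" "z \<in> carr A" "w \<in> carr A"
  shows "p ((x \<oplus> y) \<ominus> (z \<oplus> w)) \<le> p (x \<ominus> z) + p (y \<ominus> w)"
  using assms by (simp add: add_diff_add seminorm_add)

text \<open>Membership in the carrier is built in, so that the limit rules chain without side
  conditions. For a seminorm, limits are determined only up to elements of seminorm zero.\<close>

definition tends :: "(nat \<Rightarrow> 'a) \<Rightarrow> 'a \<Rightarrow> bool" where
  "tends x l \<longleftrightarrow> (\<forall>n. x n \<in> carr A) \<and> l \<in> carr A \<and> (\<lambda>n. p (x n \<ominus> l)) \<longlonglongrightarrow> 0"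

lemma tendsD:
  assumes "tends x l"
  shows "x n \<in> carr A" "l \<in> carr A" "(\<lambda>n. p (x n \<ominus> l)) \<longlonglongrightarrow> 0"
  using assms by (auto simp: tends_def)

lemma tendsI_le:
  assumes "\<And>n. x n \<in> carr A" "l \<in> carr A" "\<And>n. p (x n \<ominus> l) \<le> b n" "b \<longlonglongrightarrow> 0"
  shows "tends x l"
proof -
  have "(\<lambda>n. p (x n \<ominus> l)) \<longlonglongrightarrow> 0"
    by (rule tendsto_sandwich[of "\<lambda>_. 0" _ _ b]) (use assms in auto)
  then show ?thesis using assms by (auto simp: tends_def)
qed

lemma tends_const: "l \<in> carr A \<Longrightarrow> tends (\<lambda>_. l) l"
  by (simp add: tends_def)

lemma tends_Suc: "tends x l \<Longrightarrow> tends (\<lambda>n. x (Suc n)) l"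
  unfolding tends_def using LIMSEQ_Suc[of "\<lambda>n. p (x n \<ominus> l)"] by blast

lemma tends_seminorm:
  assumes "tends x l" shows "(\<lambda>n. p (x n)) \<longlonglongrightarrow> p l"
proof -
  have "(\<lambda>n. p (x n) - p l) \<longlonglongrightarrow> 0"
    by (rule Lim_null_comparison[of _ "\<lambda>n. p (x n \<ominus> l)"])
      (use assms abs_seminorm_diff in \<open>auto simp: tends_def\<close>)
  then show ?thesis by (simp add: LIM_zero_iff)
qed

lemma tends_add:
  assumes "tends x l" "tends y m" shows "tends (\<lambda>n. x n \<oplus> y n) (l \<oplus> m)"
proof (rule tendsI_le)
  show "(\<lambda>n. p (x n \<ominus> l) + p (y n \<ominus> m)) \<longlonglongrightarrow> 0"
    using tendsto_add[OF tendsD(3)[OF assms(1)] tendsD(3)[OF assms(2)]] by simp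
qed (use assms in \<open>auto simp: tends_def seminorm_add_diff_add\<close>)

lemma tends_scale:
  assumes "tends x l" shows "tends (\<lambda>n. c \<odot> x n) (c \<odot> l)"
proof (rule tendsI_le)
  show "(\<lambda>n. cmod c * p (x n \<ominus> l)) \<longlonglongrightarrow> 0"
    using tendsto_mult[OF tendsto_const tendsD(3)[OF assms], of "cmod c"] by simp
qed (use assms in \<open>auto simp: tends_def scale_diff\<close>)

lemma tends_star: "tends x l \<Longrightarrow> tends (\<lambda>n. star_op (x n)) (star_op l)"
  by (auto simp: tends_def star_diff)

lemma tends_mult:
  assumes "tends x l" "tends y m" shows "tends (\<lambda>n. x n \<otimes> y n) (l \<otimes> m)"
proof (rule tendsI_le)
  show "(\<lambda>n. p (x n \<ominus> l) * p (y n) + p l * p (y n \<ominus> m)) \<longlonglongrightarrow> 0"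
    using tendsto_add[OF tendsto_mult[OF tendsD(3)[OF assms(1)] tends_seminorm[OF assms(2)]]
        tendsto_mult[OF tendsto_const tendsD(3)[OF assms(2)]], of "p l"] by simp
qed (use assms in \<open>auto simp: tends_def seminorm_mult_diff_mult\<close>)

lemma tends_unique:
  assumes "tends x l" "tends x m" shows "p (l \<ominus> m) = 0"
proof -
  have "tends (\<lambda>n. x n \<ominus> x n) (l \<ominus> m)"
    unfolding diffA_def by (intro tends_add tends_scale assms)
  from tends_seminorm[OF this] show ?thesis
    using assms by (simp add: tends_def LIMSEQ_const_iff)
qed

lemma cauchy_seqsD: "x \<in> cauchy_seqs A p \<Longrightarrow> x n \<in> carr A"
  by (simp add: cauchy_seqs_def)

lemma cauchy_seqsE:
  assumes "x \<in> cauchy_seqs A p" "\<epsilon> > 0"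
  obtains N where "\<And>m n. \<lbrakk>m \<ge> N; n \<ge> N\<rbrakk> \<Longrightarrow> p (x m \<ominus> x n) < \<epsilon>"
  using assms unfolding cauchy_seqs_def by blast

lemma cauchy_seqsI:
  assumes "\<And>n. x n \<in> carr A"
    and "\<And>\<epsilon>. \<epsilon> > 0 \<Longrightarrow> \<exists>N. \<forall>m\<ge>N. \<forall>n\<ge>N. p (x m \<ominus> x n) < \<epsilon>"
  shows "x \<in> cauchy_seqs A p"
  using assms by (auto simp: cauchy_seqs_def)

lemma cauchy_seqs_geometric:
  assumes x: "\<And>n. x n \<in> carr A" and s: "0 \<le> s" "s < 1" and c: "0 \<le> c"
    and le: "\<And>n. p (x (Suc n) \<ominus> x n) \<le> c * s ^ n"
  shows "x \<in> cauchy_seqs A p"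
proof (rule cauchy_seqsI[OF x])
  fix \<epsilon> :: real assume \<epsilon>: "\<epsilon> > 0"
  \<comment> \<open>The bound is c times the sum of s^i over n \<le> i < n + j in closed form, which
    reduces the induction on j to an identity of fractions.\<close>
  have aux: "p (x (n + j) \<ominus> x n) \<le> c * (s ^ n - s ^ (n + j)) / (1 - s)" for n j
  proof (induction j)
    case (Suc j)
    have "p (x (n + Suc j) \<ominus> x n) \<le> p (x (Suc (n + j)) \<ominus> x (n + j)) + p (x (n + j) \<ominus> x n)"
      using seminorm_diff_triangle[OF x x x] by simp
    also have "\<dots> \<le> c * s ^ (n + j) + c * (s ^ n - s ^ (n + j)) / (1 - s)"
      using Suc le[of "n + j"] by simp
    also have "\<dots> = c * (s ^ n - s ^ (n + Suc j)) / (1 - s)"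
      using s by (simp add: field_simps)
    finally show ?case .
  qed (use x in simp)
  have bound: "p (x (n + j) \<ominus> x n) \<le> c / (1 - s) * s ^ n" for n j
  proof -
    have "c * (s ^ n - s ^ (n + j)) / (1 - s) \<le> c * s ^ n / (1 - s)"
      using s c by (intro divide_right_mono mult_left_mono) auto
    then show ?thesis using aux[of n j] by simp
  qed
  have "(\<lambda>n. c / (1 - s) * s ^ n) \<longlonglongrightarrow> 0"
    using s by (intro tendsto_mult_right_zero LIMSEQ_power_zero) auto
  then obtain N where N: "\<And>n. n \<ge> N \<Longrightarrow> c / (1 - s) * s ^ n < \<epsilon>"
    using \<epsilon> by (metis order_tendstoD(2) eventually_sequentially)
  have "p (x m \<ominus> x n) < \<epsilon>" if "n \<ge> N" "m \<ge> n" for m n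
    using bound[of n "m - n"] N[of n] that by simp
  then show "\<exists>N. \<forall>m\<ge>N. \<forall>n\<ge>N. p (x m \<ominus> x n) < \<epsilon>"
    using seminorm_diff_swap[OF x x] by (metis nat_le_linear)
qed

end

section \<open>C*-algebras, on which every C*-seminorm is bounded by the norm\<close>

locale cstar_alg = fixes A :: "'a normed_star_alg"
  assumes cstar_algebra: "cstar_algebra A"

sublocale cstar_alg \<subseteq> seminormed_star_alg A "normA A"
  using cstar_algebra by unfold_locales (auto simp: cstar_algebra_def)

context cstar_alg begin

lemma norm_zero_imp: "\<lbrakk>x \<in> carr A; normA A x = 0\<rbrakk> \<Longrightarrow> x = \<zero>"
  using cstar_algebra by (auto simp: cstar_algebra_def)

lemma complete:
  assumes "x \<in> cauchy_seqs A (normA A)" obtains l where "tends x l"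
  using assms cstar_algebra unfolding cstar_algebra_def tends_def cauchy_seqs_def by blast

lemma tends_eq: "\<lbrakk>tends x l; tends x m\<rbrakk> \<Longrightarrow> l = m"
  using tends_unique norm_zero_imp diff_eq_zero by (metis tends_def diff_closed)

text \<open>
  Formally \<open>1 + k\<close> is a square root of \<open>1 - h\<^sup>2\<close>; it is the fixed point of the contraction
  \<open>k \<mapsto> -(h\<^sup>2 + k\<^sup>2) / 2\<close>.
\<close>

lemma self_adjoint_sqrt:
  assumes h: "h \<in> carr A" "star_op h = h" "normA A h < 1"
  obtains k where "k \<in> carr A" "star_op k = k" "h \<otimes> k = k \<otimes> h"
    "h \<otimes> h \<oplus> ((k \<oplus> k) \<oplus> k \<otimes> k) = \<zero>"
proof -
  define f where "f k = (-1/2) \<odot> (h \<otimes> h \<oplus> k \<otimes> k)" for k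
  define ks where "ks n = (f ^^ n) \<zero>" for n
  define s where "s = normA A h"
  have s: "0 \<le> s" "s < 1" using h by (auto simp: s_def)
  have ks_Suc: "ks (Suc n) = f (ks n)" for n by (simp add: ks_def)
  have ks0: "ks 0 = \<zero>" by (simp add: ks_def)
  have c: "ks n \<in> carr A" for n
    by (induction n) (use h in \<open>auto simp: ks0 ks_Suc f_def\<close>)
  \<comment> \<open>Every iterate is a real polynomial in h, hence self-adjoint and commuting with
    h; the limit k inherits both.\<close>
  have sa: "star_op (ks n) = ks n" for n
    by (induction n) (use h c in \<open>auto simp: ks0 ks_Suc f_def\<close>)
  have comm: "h \<otimes> ks n = ks n \<otimes> h" for n
  proof (induction n)
    case (Suc n)
    have "h \<otimes> (ks n \<otimes> ks n) = (ks n \<otimes> ks n) \<otimes> h"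
      using Suc h c by (metis mult_assoc)
    then show ?case using h c by (simp add: ks_Suc f_def distrib mult_assoc)
  qed (use h in \<open>simp add: ks0\<close>)
  \<comment> \<open>The ball of radius s is invariant under f because (s^2 + s^2) / 2 = s^2 \<le>
    s.\<close>
  have bound: "normA A (ks n) \<le> s" for n
  proof (induction n)
    case (Suc n)
    have "normA A (h \<otimes> h \<oplus> ks n \<otimes> ks n) \<le> s * s + s * s"
      using seminorm_add[of "h \<otimes> h" "ks n \<otimes> ks n"] seminorm_mult[of h h]
        seminorm_mult[of "ks n" "ks n"] h c mult_mono[OF Suc Suc] s
      by (fastforce simp: s_def)
    moreover have "s * s \<le> s" using s by (simp add: mult_left_le)
    ultimately show ?case using h c by (simp add: ks_Suc f_def)
  qed (use s in \<open>simp add: ks0\<close>)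
  \<comment> \<open>The difference k^2 - k'^2 = (k - k') k + k' (k - k') has norm at most 2 s times
    that of k - k'; the factor 1/2 in f leaves the Lipschitz constant s < 1.\<close>
  have contr: "normA A (f k \<ominus> f k') \<le> s * normA A (k \<ominus> k')"
    if "k \<in> carr A" "k' \<in> carr A" "normA A k \<le> s" "normA A k' \<le> s" for k k'
  proof -
    have "f k \<ominus> f k' = (-1/2) \<odot> (k \<otimes> k \<ominus> k' \<otimes> k')"
      using that h by (simp add: f_def scale_diff add_diff_add)
    moreover have "normA A (k \<otimes> k \<ominus> k' \<otimes> k') \<le> normA A (k \<ominus> k') * s + s * normA A (k \<ominus> k')"
      using seminorm_mult_diff_mult[of k k k' k'] that
        mult_left_mono[of "normA A k" s "normA A (k \<ominus> k')"]
        mult_right_mono[of "normA A k'" s "normA A (k \<ominus> k')"]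
      by (simp add: mult.commute)
    ultimately show ?thesis using that by simp
  qed
  have "normA A (ks (Suc n) \<ominus> ks n) \<le> s * s ^ n" for n
  proof (induction n)
    case 0
    then show ?case using bound[of 1] c by (simp add: ks0)
  next
    case (Suc n)
    have "normA A (ks (Suc (Suc n)) \<ominus> ks (Suc n)) \<le> s * normA A (ks (Suc n) \<ominus> ks n)"
      using contr[of "ks (Suc n)" "ks n", folded ks_Suc] c bound by blast
    also have "\<dots> \<le> s * (s * s ^ n)" using Suc s by (intro mult_left_mono) auto
    finally show ?case by simp
  qed
  then have "ks \<in> cauchy_seqs A (normA A)"
    using s c by (intro cauchy_seqs_geometric[of ks s s])
  then obtain k where k: "tends ks k" by (rule complete)
  then have kc: "k \<in> carr A" by (simp add: tends_def)
  note th = tends_const[OF h(1)]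
  have "tends (\<lambda>n. ks (Suc n)) (f k)"
    unfolding ks_Suc f_def by (intro tends_scale tends_add tends_mult th k)
  then have fk: "k = f k" using tends_eq tends_Suc[OF k] by blast
  have "star_op k = k" using tends_star[OF k] tends_eq k sa by simp
  moreover have "h \<otimes> k = k \<otimes> h"
    using tends_mult[OF th k] tends_mult[OF k th] tends_eq by (simp add: comm)
  \<comment> \<open>The fixed-point equation gives 2k = -(h^2 + k^2); the assertion is (1 + k)^2 = 1
    - h^2 with the missing unit cancelled.\<close>
  moreover have "h \<otimes> h \<oplus> ((k \<oplus> k) \<oplus> k \<otimes> k) = \<zero>"
  proof -
    have "k \<oplus> k = 2 \<odot> k" using scale_add_left[of k 1 1] kc by simp
    also have "\<dots> = (-1) \<odot> (h \<otimes> h \<oplus> k \<otimes> k)"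
      by (subst fk) (use h kc in \<open>simp add: f_def\<close>)
    finally have "k \<oplus> k = (-1) \<odot> (h \<otimes> h \<oplus> k \<otimes> k)" .
    then have "h \<otimes> h \<oplus> ((k \<oplus> k) \<oplus> k \<otimes> k)
      = (h \<otimes> h \<oplus> k \<otimes> k) \<oplus> (-1) \<odot> (h \<otimes> h \<oplus> k \<otimes> k)"
      using h kc by (simp only: closed add_ac)
    then show ?thesis using h kc by simp
  qed
  ultimately show ?thesis using that kc by blast
qed

text \<open>
  With \<open>k\<close> as above, \<open>u = h + i(1 + k)\<close> and \<open>v = h - i(1 + k)\<close> act on \<open>A\<close> by left multiplication
  as unitaries with mean \<open>h\<close>, and the C*-identity makes unitaries isometric for every C*-seminorm.
\<close>

lemma cstar_seminorm_self_adjoint_le_one: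
  assumes q: "cstar_seminorm A q"
    and h: "h \<in> carr A" "star_op h = h" "normA A h < 1"
  shows "q h \<le> 1"
proof -
  interpret q: seminormed_star_alg A q using q by unfold_locales
  obtain k where k: "k \<in> carr A" "star_op k = k" and hk: "h \<otimes> k = k \<otimes> h"
    and sq: "h \<otimes> h \<oplus> ((k \<oplus> k) \<oplus> k \<otimes> k) = \<zero>"
    using self_adjoint_sqrt[OF h] .
  \<comment> \<open>The conditions on c leave i and -i. With y = (h + c(1 + k)) b one has star y y =
    star b b, so the C*-identity gives q(y) = q(b).\<close>
  have iso: "q (h \<otimes> b \<oplus> c \<odot> (b \<oplus> k \<otimes> b)) = q b"
    if b: "b \<in> carr A" and c: "cnj c = - c" "c * c = -1" for b c
  proof -
    define w where "w = b \<oplus> k \<otimes> b"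
    have w: "w \<in> carr A" using b k by (simp add: w_def)
    have ww: "star_op w \<otimes> w = star_op b \<otimes> b \<oplus> star_op b \<otimes> (((k \<oplus> k) \<oplus> k \<otimes> k) \<otimes> b)"
      using b k by (simp add: w_def distrib mult_assoc add_ac)
    have hb: "star_op (h \<otimes> b) \<otimes> (h \<otimes> b) = star_op b \<otimes> ((h \<otimes> h) \<otimes> b)"
      using b h by (simp add: mult_assoc)
    have hkb: "h \<otimes> (k \<otimes> b) = k \<otimes> (h \<otimes> b)"
      using hk b h k by (metis mult_assoc)
    \<comment> \<open>As h and k are self-adjoint and commute, the two mixed products coincide;
      their coefficients c and -c then cancel.\<close>
    have cross: "star_op (h \<otimes> b) \<otimes> w = star_op w \<otimes> (h \<otimes> b)"
      using b h k hkb by (simp add: w_def distrib mult_assoc)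
    have "star_op (h \<otimes> b \<oplus> c \<odot> w) \<otimes> (h \<otimes> b \<oplus> c \<odot> w)
      = star_op (h \<otimes> b) \<otimes> (h \<otimes> b) \<oplus> star_op w \<otimes> w"
    proof -
      define P Q where "P = star_op (h \<otimes> b)" and "Q = star_op w"
      have PQ: "P \<in> carr A" "Q \<in> carr A" using b h w by (auto simp: P_def Q_def)
      have "star_op (h \<otimes> b \<oplus> c \<odot> w) = P \<oplus> (-c) \<odot> Q"
        using b h w c by (simp add: P_def Q_def)
      then have "star_op (h \<otimes> b \<oplus> c \<odot> w) \<otimes> (h \<otimes> b \<oplus> c \<odot> w)
        = (P \<otimes> (h \<otimes> b) \<oplus> Q \<otimes> w) \<oplus> ((-c) \<odot> (Q \<otimes> (h \<otimes> b)) \<oplus> c \<odot> (P \<otimes> w))"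
        using b h w PQ c by (simp add: distrib scale_add add_ac)
      also have "(-c) \<odot> (Q \<otimes> (h \<otimes> b)) \<oplus> c \<odot> (P \<otimes> w) = \<zero>"
        using b h w PQ cross scale_add_left[of "P \<otimes> w" "-c" c] by (simp add: P_def Q_def)
      finally show ?thesis using b h w PQ by (simp add: P_def Q_def)
    qed
    also have "\<dots> = star_op b \<otimes> b \<oplus> (star_op b \<otimes> ((h \<otimes> h \<oplus> ((k \<oplus> k) \<oplus> k \<otimes> k)) \<otimes> b))"
      unfolding ww hb using b h k by (simp add: distrib(1,2) add_ac)
    also have "\<dots> = star_op b \<otimes> b"
      unfolding sq using b by simp
    finally have "(q (h \<otimes> b \<oplus> c \<odot> w))\<^sup>2 = (q b)\<^sup>2"
      using q.cstar_identity[of "h \<otimes> b \<oplus> c \<odot> w"] q.cstar_identity[of b] b h w by simp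
    then show ?thesis using b h w by (simp add: w_def power2_eq_iff_nonneg)
  qed
  define w where "w = h \<oplus> k \<otimes> h"
  have w: "w \<in> carr A" using h k by (simp add: w_def)
  \<comment> \<open>Both isometries are applied to b = h itself: the mean of the two values is h^2,
    so q(h)^2 = q(h^2) \<le> q(h), which forces q(h) \<le> 1.\<close>
  have "h \<otimes> h = (1/2) \<odot> ((h \<otimes> h \<oplus> \<i> \<odot> w) \<oplus> (h \<otimes> h \<oplus> (-\<i>) \<odot> w))"
  proof -
    have "(h \<otimes> h \<oplus> \<i> \<odot> w) \<oplus> (h \<otimes> h \<oplus> (-\<i>) \<odot> w)
      = (h \<otimes> h \<oplus> h \<otimes> h) \<oplus> (\<i> \<odot> w \<oplus> (-\<i>) \<odot> w)"
      using h w by (simp only: closed add_ac)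
    also have "\<i> \<odot> w \<oplus> (-\<i>) \<odot> w = \<zero>"
      using scale_add_left[of w \<i> "-\<i>"] w by simp
    also have "h \<otimes> h \<oplus> h \<otimes> h = 2 \<odot> (h \<otimes> h)"
      using scale_add_left[of "h \<otimes> h" 1 1] h by simp
    finally show ?thesis using h by simp
  qed
  then have "q (h \<otimes> h) = q ((1/2) \<odot> ((h \<otimes> h \<oplus> \<i> \<odot> w) \<oplus> (h \<otimes> h \<oplus> (-\<i>) \<odot> w)))"
    by (rule arg_cong)
  also have "\<dots> = q ((h \<otimes> h \<oplus> \<i> \<odot> w) \<oplus> (h \<otimes> h \<oplus> (-\<i>) \<odot> w)) / 2"
    using h w by (subst q.seminorm_scale) auto
  also have "\<dots> \<le> (q (h \<otimes> h \<oplus> \<i> \<odot> w) + q (h \<otimes> h \<oplus> (-\<i>) \<odot> w)) / 2"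
    using h w q.seminorm_add by (intro divide_right_mono) auto
  also have "\<dots> = q h"
    using iso[OF h(1), of \<i>] iso[OF h(1), of "-\<i>"] by (simp add: w_def)
  finally have "q h * q h \<le> q h" using q.cstar_identity[of h] h by (simp add: power2_eq_square)
  moreover have "q h * 1 < q h * q h" if "\<not> q h \<le> 1"
    using that by (intro mult_strict_left_mono) auto
  ultimately show ?thesis by fastforce
qed

text \<open>Dividing a self-adjoint h by any r > ||h|| reduces to the unit ball, and the C*-identity
  reduces x to the self-adjoint element star x x. Applied to the seminorm induced by a homomorphism,
  this is its contractivity.\<close>

theorem cstar_seminorm_le_norm:
  assumes q: "cstar_seminorm A q" and x: "x \<in> carr A"
  shows "q x \<le> normA A x"
proof -
  interpret q: seminormed_star_alg A q using q by unfold_locales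
  have sa: "q h \<le> normA A h" if h: "h \<in> carr A" "star_op h = h" for h
  proof (rule dense_ge)
    show "q h \<le> r" if "normA A h < r" for r
    proof -
      have r: "r > 0" using that h seminorm_nonneg[of h] by linarith
      have "q (complex_of_real (1 / r) \<odot> h) \<le> 1"
        using h r that
        by (intro cstar_seminorm_self_adjoint_le_one[OF q]) (auto simp: norm_divide)
      then show ?thesis using h r by (simp add: norm_divide field_simps)
    qed
  qed
  have "(q x)\<^sup>2 \<le> (normA A x)\<^sup>2"
    using sa[of "star_op x \<otimes> x"] x q.cstar_identity[of x] cstar_identity[of x] by simp
  then show ?thesis using x by (simp add: power2_le_iff_abs_le)
qed

end

section \<open>Completions\<close>

context seminormed_star_alg begin

lemma cauchy_bounded:
  assumes "x \<in> cauchy_seqs A p" obtains M where "M > 0" "\<And>n. p (x n) \<le> M"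
proof -
  obtain N where N: "\<And>m n. \<lbrakk>m \<ge> N; n \<ge> N\<rbrakk> \<Longrightarrow> p (x m \<ominus> x n) < 1"
    using cauchy_seqsE[OF assms, of 1] by auto
  have x: "x n \<in> carr A" for n using assms by (rule cauchy_seqsD)
  \<comment> \<open>The entry 1 makes the bound positive, so that it may be divided by.\<close>
  have "p (x n) \<le> Max (insert 1 ((p \<circ> x) ` {..N})) + 1" for n
  proof (cases "n \<le> N")
    case True
    then have "p (x n) \<le> Max (insert 1 ((p \<circ> x) ` {..N}))" by (intro Max_ge) auto
    then show ?thesis by simp
  next
    case False
    then have "p (x n) \<le> p (x N) + 1"
      using abs_seminorm_diff[OF x x, of n N] N[of n N] by simp
    also have "p (x N) \<le> Max (insert 1 ((p \<circ> x) ` {..N}))" by (intro Max_ge) auto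
    finally show ?thesis by simp
  qed
  moreover have "1 \<le> Max (insert 1 ((p \<circ> x) ` {..N}))" by (intro Max_ge) auto
  ultimately show ?thesis using that[of "Max (insert 1 ((p \<circ> x) ` {..N})) + 1"] by simp
qed

lemma cauchy_const [simp, intro]: "a \<in> carr A \<Longrightarrow> (\<lambda>_. a) \<in> cauchy_seqs A p"
  by (simp add: cauchy_seqs_def)

lemma cauchy_star [simp, intro]:
  "x \<in> cauchy_seqs A p \<Longrightarrow> (\<lambda>n. star_op (x n)) \<in> cauchy_seqs A p"
  by (simp add: cauchy_seqs_def star_diff)

lemma cauchy_add [simp, intro]:
  assumes "x \<in> cauchy_seqs A p" "y \<in> cauchy_seqs A p"
  shows "(\<lambda>n. x n \<oplus> y n) \<in> cauchy_seqs A p"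
proof (rule cauchy_seqsI)
  fix \<epsilon> :: real assume "\<epsilon> > 0"
  then have \<epsilon>: "\<epsilon> / 2 > 0" by simp
  obtain N where N: "\<And>m n. \<lbrakk>m \<ge> N; n \<ge> N\<rbrakk> \<Longrightarrow> p (x m \<ominus> x n) < \<epsilon> / 2"
    using cauchy_seqsE[OF assms(1) \<epsilon>] by blast
  obtain M where M: "\<And>m n. \<lbrakk>m \<ge> M; n \<ge> M\<rbrakk> \<Longrightarrow> p (y m \<ominus> y n) < \<epsilon> / 2"
    using cauchy_seqsE[OF assms(2) \<epsilon>] by blast
  have "p (x m \<oplus> y m \<ominus> (x n \<oplus> y n)) < \<epsilon>" if "m \<ge> max N M" "n \<ge> max N M" for m n
    using seminorm_add_diff_add[of "x m" "y m" "x n" "y n"] N[of m n] M[of m n] that assms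
    by (simp add: cauchy_seqsD)
  then show "\<exists>N. \<forall>m\<ge>N. \<forall>n\<ge>N. p (x m \<oplus> y m \<ominus> (x n \<oplus> y n)) < \<epsilon>" by blast
qed (use assms in \<open>simp add: cauchy_seqsD\<close>)

lemma cauchy_mult [simp, intro]:
  assumes "x \<in> cauchy_seqs A p" "y \<in> cauchy_seqs A p"
  shows "(\<lambda>n. x n \<otimes> y n) \<in> cauchy_seqs A p"
proof (rule cauchy_seqsI)
  fix \<epsilon> :: real assume "\<epsilon> > 0"
  obtain B where B: "B > 0" "\<And>n. p (x n) \<le> B" using cauchy_bounded[OF assms(1)] by blast
  obtain B' where B': "B' > 0" "\<And>n. p (y n) \<le> B'" using cauchy_bounded[OF assms(2)] by blast
  have \<epsilon>: "\<epsilon> / 2 / B' > 0" "\<epsilon> / 2 / B > 0" using \<open>\<epsilon> > 0\<close> B B' by simp_all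
  obtain N where N: "\<And>m n. \<lbrakk>m \<ge> N; n \<ge> N\<rbrakk> \<Longrightarrow> p (x m \<ominus> x n) < \<epsilon> / 2 / B'"
    using cauchy_seqsE[OF assms(1) \<epsilon>(1)] by blast
  obtain M where M: "\<And>m n. \<lbrakk>m \<ge> M; n \<ge> M\<rbrakk> \<Longrightarrow> p (y m \<ominus> y n) < \<epsilon> / 2 / B"
    using cauchy_seqsE[OF assms(2) \<epsilon>(2)] by blast
  have "p (x m \<otimes> y m \<ominus> (x n \<otimes> y n)) < \<epsilon>" if "m \<ge> max N M" "n \<ge> max N M" for m n
  proof -
    have c: "x m \<in> carr A" "x n \<in> carr A" "y m \<in> carr A" "y n \<in> carr A"
      using assms by (simp_all add: cauchy_seqsD)
    have "p (x m \<ominus> x n) * p (y m) \<le> p (x m \<ominus> x n) * B'"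
      using B' c by (intro mult_left_mono) auto
    also have "\<dots> < \<epsilon> / 2" using N[of m n] that B' by (simp add: field_simps)
    finally have 1: "p (x m \<ominus> x n) * p (y m) < \<epsilon> / 2" .
    have "p (x n) * p (y m \<ominus> y n) \<le> B * p (y m \<ominus> y n)"
      using B c by (intro mult_right_mono) auto
    also have "\<dots> < \<epsilon> / 2" using M[of m n] that B by (simp add: field_simps)
    finally show ?thesis using 1 seminorm_mult_diff_mult[of "x m" "y m" "x n" "y n"] c by simp
  qed
  then show "\<exists>N. \<forall>m\<ge>N. \<forall>n\<ge>N. p (x m \<otimes> y m \<ominus> (x n \<otimes> y n)) < \<epsilon>" by blast
qed (use assms in \<open>simp add: cauchy_seqsD\<close>)

lemma cauchy_scale [simp, intro]:
  assumes "x \<in> cauchy_seqs A p"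
  shows "(\<lambda>n. c \<odot> x n) \<in> cauchy_seqs A p"
proof (rule cauchy_seqsI)
  fix \<epsilon> :: real assume \<epsilon>: "\<epsilon> > 0"
  \<comment> \<open>The summand 1 keeps the divisor positive for c = 0.\<close>
  define d where "d = cmod c + 1"
  have d: "d > 0" "cmod c \<le> d" by (auto simp: d_def add_nonneg_pos)
  obtain N where N: "\<And>m n. \<lbrakk>m \<ge> N; n \<ge> N\<rbrakk> \<Longrightarrow> p (x m \<ominus> x n) < \<epsilon> / d"
    using cauchy_seqsE[OF assms, of "\<epsilon> / d"] \<epsilon> d by auto
  have "p (c \<odot> x m \<ominus> c \<odot> x n) < \<epsilon>" if "m \<ge> N" "n \<ge> N" for m n
  proof -
    have "p (c \<odot> x m \<ominus> c \<odot> x n) = cmod c * p (x m \<ominus> x n)"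
      using assms by (simp add: cauchy_seqsD scale_diff)
    also have "\<dots> \<le> d * p (x m \<ominus> x n)"
      using d assms by (intro mult_right_mono) (auto simp: cauchy_seqsD)
    also have "\<dots> < \<epsilon>" using N[OF that] d by (simp add: field_simps)
    finally show ?thesis .
  qed
  then show "\<exists>N. \<forall>m\<ge>N. \<forall>n\<ge>N. p (c \<odot> x m \<ominus> c \<odot> x n) < \<epsilon>" by blast
qed (use assms in \<open>simp add: cauchy_seqsD\<close>)

text \<open>Its axioms hold termwise; the completion is its image under \<open>seq_class A p\<close>
  and inherits them.\<close>

definition cauchy_alg :: "(nat \<Rightarrow> 'a) star_alg" where
  "cauchy_alg = \<lparr>carr = cauchy_seqs A p, zeroA = (\<lambda>_. \<zero>), addA = (\<lambda>x y n. x n \<oplus> y n),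
    scaleA = (\<lambda>c x n. c \<odot> x n), multA = (\<lambda>x y n. x n \<otimes> y n), starA = (\<lambda>x n. star_op (x n))\<rparr>"

lemma star_algebra_cauchy_alg: "star_algebra cauchy_alg"
  unfolding star_algebra_def cauchy_alg_def diffA_def
  by (simp add: cauchy_seqsD add_assoc mult_assoc distrib scale_add_left scale_add)
    (simp add: cauchy_seqsD add_commute)

definition asymp :: "(nat \<Rightarrow> 'a) \<Rightarrow> (nat \<Rightarrow> 'a) \<Rightarrow> bool" where
  "asymp x y \<longleftrightarrow> (\<lambda>n. p (x n \<ominus> y n)) \<longlonglongrightarrow> 0"

lemma asympI:
  assumes "x \<in> cauchy_seqs A p" "y \<in> cauchy_seqs A p" "\<And>n. p (x n \<ominus> y n) \<le> b n" "b \<longlonglongrightarrow> 0"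
  shows "asymp x y"
  unfolding asymp_def
  by (rule tendsto_sandwich[of "\<lambda>_. 0" _ _ b]) (use assms in \<open>auto simp: cauchy_seqsD\<close>)

lemma asymp_refl: "x \<in> cauchy_seqs A p \<Longrightarrow> asymp x x"
  by (simp add: asymp_def cauchy_seqsD)

lemma asymp_sym: "\<lbrakk>x \<in> cauchy_seqs A p; y \<in> cauchy_seqs A p; asymp x y\<rbrakk> \<Longrightarrow> asymp y x"
  by (simp add: asymp_def cauchy_seqsD seminorm_diff_swap)

lemma asymp_trans:
  assumes "x \<in> cauchy_seqs A p" "y \<in> cauchy_seqs A p" "z \<in> cauchy_seqs A p"
    "asymp x y" "asymp y z"
  shows "asymp x z"
proof (rule asympI[OF assms(1,3)])
  show "(\<lambda>n. p (x n \<ominus> y n) + p (y n \<ominus> z n)) \<longlonglongrightarrow> 0"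
    using tendsto_add[OF assms(4,5)[unfolded asymp_def]] by simp
qed (use assms in \<open>auto simp: cauchy_seqsD intro: seminorm_diff_triangle\<close>)

lemma seq_class_eq_iff:
  assumes "x \<in> cauchy_seqs A p" "y \<in> cauchy_seqs A p"
  shows "seq_class A p x = seq_class A p y \<longleftrightarrow> asymp x y"
proof
  assume "seq_class A p x = seq_class A p y"
  moreover have "y \<in> seq_class A p y"
    using assms asymp_refl[of y] by (simp add: seq_class_def asymp_def)
  ultimately show "asymp x y" by (auto simp: seq_class_def asymp_def)
next
  assume xy: "asymp x y"
  have "asymp x z \<longleftrightarrow> asymp y z" if z: "z \<in> cauchy_seqs A p" for z
    using asymp_trans[OF assms(2,1) z asymp_sym[OF assms xy]] asymp_trans[OF assms z xy] by blast
  then show "seq_class A p x = seq_class A p y"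
    by (auto simp: seq_class_def simp flip: asymp_def)
qed

text \<open>The operations of \<open>completion\<close> act on chosen representatives. As the chosen
  one is asymptotic to the given sequence, each rule below can be computed with any
  representative.\<close>

lemma rep_seq_class:
  assumes "x \<in> cauchy_seqs A p"
  shows "rep (seq_class A p x) \<in> cauchy_seqs A p" "asymp x (rep (seq_class A p x))"
proof -
  have "x \<in> seq_class A p x"
    using assms asymp_refl[of x] by (simp add: seq_class_def asymp_def)
  then have "rep (seq_class A p x) \<in> seq_class A p x"
    unfolding rep_def by (rule someI[where P = "\<lambda>y. y \<in> seq_class A p x"])
  then show "rep (seq_class A p x) \<in> cauchy_seqs A p" "asymp x (rep (seq_class A p x))"
    by (auto simp: seq_class_def asymp_def)
qed

lemma asymp_seminorm_lim:
  assumes "x \<in> cauchy_seqs A p" "y \<in> cauchy_seqs A p" "asymp x y" "(\<lambda>n. p (x n)) \<longlonglongrightarrow> l"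
  shows "(\<lambda>n. p (y n)) \<longlonglongrightarrow> l"
proof -
  have "(\<lambda>n. p (x n) - p (y n)) \<longlonglongrightarrow> 0"
    by (rule Lim_null_comparison[OF _ assms(3)[unfolded asymp_def]])
      (use assms abs_seminorm_diff in \<open>auto simp: cauchy_seqsD\<close>)
  from tendsto_diff[OF assms(4) this] show ?thesis by simp
qed

lemma cauchy_seminorm_convergent:
  assumes "x \<in> cauchy_seqs A p" shows "convergent (\<lambda>n. p (x n))"
proof -
  have "Cauchy (\<lambda>n. p (x n))"
  proof (rule metric_CauchyI)
    fix e :: real assume "e > 0"
    then obtain N where N: "\<And>m n. \<lbrakk>m \<ge> N; n \<ge> N\<rbrakk> \<Longrightarrow> p (x m \<ominus> x n) < e"
      using cauchy_seqsE[OF assms] by blast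
    have "dist (p (x m)) (p (x n)) < e" if "m \<ge> N" "n \<ge> N" for m n
      using N[OF that] abs_seminorm_diff[of "x m" "x n"] assms
      by (simp add: cauchy_seqsD dist_real_def)
    then show "\<exists>M. \<forall>m\<ge>M. \<forall>n\<ge>M. dist (p (x m)) (p (x n)) < e" by blast
  qed
  then show ?thesis by (rule Cauchy_convergent)
qed

section \<open>Operations and norm of the completion, computed on classes\<close>

lemma carr_completion: "carr (completion A p) = seq_class A p ` cauchy_seqs A p"
  by (simp add: completion_def)

lemma zero_completion: "zeroA (completion A p) = seq_class A p (\<lambda>_. \<zero>)"
  by (simp add: completion_def)

text \<open>Since p(x) and p(y) differ by at most p(x - y), the seminorms along a Cauchy sequence
  converge, to a limit independent of the representative. Stated as convergence, it lets termwise
  estimates pass to the norm.\<close>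

lemma norm_completion:
  assumes "x \<in> cauchy_seqs A p"
  shows "(\<lambda>n. p (x n)) \<longlonglongrightarrow> normA (completion A p) (seq_class A p x)"
proof -
  note r = rep_seq_class[OF assms]
  have "(\<lambda>n. p (rep (seq_class A p x) n)) \<longlonglongrightarrow> normA (completion A p) (seq_class A p x)"
    using cauchy_seminorm_convergent[OF r(1)] by (simp add: completion_def convergent_LIMSEQ_iff)
  then show ?thesis using asymp_seminorm_lim[OF r(1) assms asymp_sym[OF assms r]] by blast
qed

lemma add_completion:
  assumes x: "x \<in> cauchy_seqs A p" and y: "y \<in> cauchy_seqs A p"
  shows "addA (completion A p) (seq_class A p x) (seq_class A p y)
    = seq_class A p (\<lambda>n. x n \<oplus> y n)"
proof -
  note rx = rep_seq_class[OF x] and ry = rep_seq_class[OF y]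
  have "asymp (\<lambda>n. x n \<oplus> y n) (\<lambda>n. rep (seq_class A p x) n \<oplus> rep (seq_class A p y) n)"
  proof (rule asympI)
    show "(\<lambda>n. p (x n \<ominus> rep (seq_class A p x) n) + p (y n \<ominus> rep (seq_class A p y) n)) \<longlonglongrightarrow> 0"
      using tendsto_add[OF rx(2)[unfolded asymp_def] ry(2)[unfolded asymp_def]] by simp
  qed (use x y rx ry in \<open>auto simp: cauchy_seqsD intro!: seminorm_add_diff_add\<close>)
  then show ?thesis
    using x y rx ry by (simp add: completion_def seq_class_eq_iff asymp_sym)
qed

lemma scale_completion:
  assumes x: "x \<in> cauchy_seqs A p"
  shows "scaleA (completion A p) c (seq_class A p x) = seq_class A p (\<lambda>n. c \<odot> x n)"
proof -
  note rx = rep_seq_class[OF x]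
  have "asymp (\<lambda>n. c \<odot> x n) (\<lambda>n. c \<odot> rep (seq_class A p x) n)"
  proof (rule asympI)
    show "(\<lambda>n. cmod c * p (x n \<ominus> rep (seq_class A p x) n)) \<longlonglongrightarrow> 0"
      using tendsto_mult[OF tendsto_const rx(2)[unfolded asymp_def], of "cmod c"] by simp
  qed (use x rx in \<open>auto simp: cauchy_seqsD scale_diff\<close>)
  then show ?thesis
    using x rx by (simp add: completion_def seq_class_eq_iff asymp_sym)
qed

lemma star_completion:
  assumes x: "x \<in> cauchy_seqs A p"
  shows "starA (completion A p) (seq_class A p x) = seq_class A p (\<lambda>n. star_op (x n))"
proof -
  note rx = rep_seq_class[OF x]
  have "asymp (\<lambda>n. star_op (x n)) (\<lambda>n. star_op (rep (seq_class A p x) n))"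
    using rx x by (simp add: asymp_def cauchy_seqsD star_diff)
  then show ?thesis
    using x rx by (simp add: completion_def seq_class_eq_iff asymp_sym)
qed

lemma mult_completion:
  assumes x: "x \<in> cauchy_seqs A p" and y: "y \<in> cauchy_seqs A p"
  shows "multA (completion A p) (seq_class A p x) (seq_class A p y)
    = seq_class A p (\<lambda>n. x n \<otimes> y n)"
proof -
  note rx = rep_seq_class[OF x] and ry = rep_seq_class[OF y]
  let ?x = "rep (seq_class A p x)" and ?y = "rep (seq_class A p y)"
  have "asymp (\<lambda>n. x n \<otimes> y n) (\<lambda>n. ?x n \<otimes> ?y n)"
  proof (rule asympI)
    show "(\<lambda>n. p (x n \<ominus> ?x n) * p (y n) + p (?x n) * p (y n \<ominus> ?y n)) \<longlonglongrightarrow> 0"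
      using tendsto_add[OF
          tendsto_mult[OF rx(2)[unfolded asymp_def] norm_completion[OF y]]
          tendsto_mult[OF norm_completion[OF rx(1)] ry(2)[unfolded asymp_def]]] by simp
  qed (use x y rx ry in \<open>auto simp: cauchy_seqsD intro!: seminorm_mult_diff_mult\<close>)
  then show ?thesis
    using x y rx ry by (simp add: completion_def seq_class_eq_iff asymp_sym)
qed

lemmas completion_ops =
  zero_completion add_completion scale_completion mult_completion star_completion

lemma diff_completion:
  "\<lbrakk>x \<in> cauchy_seqs A p; y \<in> cauchy_seqs A p\<rbrakk> \<Longrightarrow>
    diffA (completion A p) (seq_class A p x) (seq_class A p y) = seq_class A p (\<lambda>n. x n \<ominus> y n)"
  by (simp add: diffA_def completion_ops)

lemma cauchy_diff [simp, intro]: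
  "\<lbrakk>x \<in> cauchy_seqs A p; y \<in> cauchy_seqs A p\<rbrakk> \<Longrightarrow> (\<lambda>n. x n \<ominus> y n) \<in> cauchy_seqs A p"
  by (simp add: diffA_def)

lemma star_algebra_completion: "star_algebra (completion A p)"
proof (rule star_algebra_surj_image[OF star_algebra_cauchy_alg])
  show "carr (completion A p) = seq_class A p ` carr cauchy_alg"
    by (simp add: carr_completion cauchy_alg_def)
qed (simp_all add: cauchy_alg_def completion_ops)

lemma cstar_seminorm_completion:
  "cstar_seminorm (completion A p) (normA (completion A p))"
  unfolding cstar_seminorm_def carr_completion ball_simps
proof (intro conjI ballI allI)
  fix x assume x: "x \<in> cauchy_seqs A p"
  note nx = norm_completion[OF x]
  show "0 \<le> normA (completion A p) (seq_class A p x)"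
    by (rule LIMSEQ_le_const[OF nx]) (use x in \<open>auto simp: cauchy_seqsD\<close>)
  show "normA (completion A p) (scaleA (completion A p) c (seq_class A p x))
    = cmod c * normA (completion A p) (seq_class A p x)" for c
  proof (rule LIMSEQ_unique)
    show "(\<lambda>n. p (c \<odot> x n)) \<longlonglongrightarrow> normA (completion A p) (scaleA (completion A p) c (seq_class A p x))"
      using norm_completion[OF cauchy_scale[OF x]] x by (simp add: completion_ops)
    show "(\<lambda>n. p (c \<odot> x n)) \<longlonglongrightarrow> cmod c * normA (completion A p) (seq_class A p x)"
      using tendsto_mult[OF tendsto_const nx, of "cmod c"] x by (simp add: cauchy_seqsD)
  qed
  show "normA (completion A p)
      (multA (completion A p) (starA (completion A p) (seq_class A p x)) (seq_class A p x))
    = (normA (completion A p) (seq_class A p x))\<^sup>2"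
  proof (rule LIMSEQ_unique)
    show "(\<lambda>n. p (star_op (x n) \<otimes> x n)) \<longlonglongrightarrow> normA (completion A p)
      (multA (completion A p) (starA (completion A p) (seq_class A p x)) (seq_class A p x))"
      using norm_completion[OF cauchy_mult[OF cauchy_star[OF x] x]] x by (simp add: completion_ops)
    show "(\<lambda>n. p (star_op (x n) \<otimes> x n)) \<longlonglongrightarrow> (normA (completion A p) (seq_class A p x))\<^sup>2"
      using tendsto_power[OF nx, of 2] x by (simp add: cauchy_seqsD cstar_identity)
  qed
  fix y assume y: "y \<in> cauchy_seqs A p"
  note ny = norm_completion[OF y]
  show "normA (completion A p) (addA (completion A p) (seq_class A p x) (seq_class A p y))
    \<le> normA (completion A p) (seq_class A p x) + normA (completion A p) (seq_class A p y)"
    using x y by (intro LIMSEQ_le[OF norm_completion[OF cauchy_add[OF x y], folded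
            add_completion[OF x y]] tendsto_add[OF nx ny]])
      (auto simp: cauchy_seqsD seminorm_add)
  show "normA (completion A p) (multA (completion A p) (seq_class A p x) (seq_class A p y))
    \<le> normA (completion A p) (seq_class A p x) * normA (completion A p) (seq_class A p y)"
    using x y by (intro LIMSEQ_le[OF norm_completion[OF cauchy_mult[OF x y], folded
            mult_completion[OF x y]] tendsto_mult[OF nx ny]])
      (auto simp: cauchy_seqsD seminorm_mult)
qed

end

text \<open>The assumptions of \<open>seminormed_star_alg\<close> under a second name, so that the
  completion can be attached as a further seminormed algebra without attaching its own completion in
  turn.\<close>

locale seminorm_completion = seminormed_star_alg

sublocale seminorm_completion \<subseteq> completion: seminormed_star_alg "completion A p" "normA (completion A p)"
  using star_algebra_completion cstar_seminorm_completion by unfold_locales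

context seminorm_completion begin

definition incl :: "'a \<Rightarrow> (nat \<Rightarrow> 'a) set" where "incl a = seq_class A p (\<lambda>_. a)"

lemma incl_closed [simp, intro]: "a \<in> carr A \<Longrightarrow> incl a \<in> carr (completion A p)"
  by (auto simp: incl_def carr_completion)

lemma norm_incl: "a \<in> carr A \<Longrightarrow> normA (completion A p) (incl a) = p a"
  using norm_completion[of "\<lambda>_. a"] by (simp add: incl_def LIMSEQ_const_iff)

lemma diff_incl:
  "\<lbrakk>a \<in> carr A; b \<in> carr A\<rbrakk> \<Longrightarrow> diffA (completion A p) (incl a) (incl b) = incl (a \<ominus> b)"
  by (simp add: incl_def diff_completion)

text \<open>Density of A: the distance from the k-th term to the class of x is the limit over m of
  p(x k - x m), which the Cauchy property makes small for large k.\<close>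

lemma incl_tends:
  assumes x: "x \<in> cauchy_seqs A p"
  shows "completion.tends (\<lambda>n. incl (x n)) (seq_class A p x)"
proof -
  have n: "(\<lambda>m. p (x k \<ominus> x m)) \<longlonglongrightarrow>
      normA (completion A p) (diffA (completion A p) (incl (x k)) (seq_class A p x))" for k
    using norm_completion[of "\<lambda>m. x k \<ominus> x m"] x
    by (simp add: incl_def diff_completion cauchy_seqsD)
  have "(\<lambda>k. normA (completion A p) (diffA (completion A p) (incl (x k)) (seq_class A p x))) \<longlonglongrightarrow> 0"
  proof (rule LIMSEQ_I)
    fix r :: real assume "r > 0"
    then obtain N where N: "\<And>m n. \<lbrakk>m \<ge> N; n \<ge> N\<rbrakk> \<Longrightarrow> p (x m \<ominus> x n) < r / 2"
      using cauchy_seqsE[OF x, of "r / 2"] by auto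
    have "normA (completion A p) (diffA (completion A p) (incl (x k)) (seq_class A p x)) \<le> r / 2"
      if "k \<ge> N" for k
      using LIMSEQ_le_const2[OF n] N[OF that] by (meson less_imp_le)
    moreover have "0 \<le> normA (completion A p) (diffA (completion A p) (incl (x k)) (seq_class A p x))" for k
      using x by (intro completion.seminorm_nonneg completion.diff_closed incl_closed)
        (auto simp: cauchy_seqsD carr_completion)
    ultimately show "\<exists>no. \<forall>k\<ge>no. norm (normA (completion A p)
        (diffA (completion A p) (incl (x k)) (seq_class A p x)) - 0) < r"
      using \<open>r > 0\<close> by (intro exI[of _ N]) (auto, smt (verit) field_sum_of_halves)
  qed
  moreover have "seq_class A p x \<in> carr (completion A p)" using x by (simp add: carr_completion)
  ultimately show ?thesis using x by (auto simp: completion.tends_def cauchy_seqsD)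
qed

lemma completion_approx:
  assumes "X \<in> carr (completion A p)"
  obtains x where "x \<in> cauchy_seqs A p" "X = seq_class A p x" "completion.tends (\<lambda>n. incl (x n)) X"
  using assms incl_tends by (auto simp: carr_completion)

text \<open>For completeness, each X k is replaced by an element of A at distance less than 1 / (k +
  1). These elements form a Cauchy sequence in A, and its class is the limit of X.\<close>

theorem cstar_algebra_completion: "cstar_algebra (completion A p)"
  unfolding cstar_algebra_def
proof (intro conjI ballI impI)
  fix X assume "X \<in> carr (completion A p)" "normA (completion A p) X = 0"
  moreover then obtain x where x: "x \<in> cauchy_seqs A p" "X = seq_class A p x"
    by (auto simp: carr_completion)
  ultimately have "asymp x (\<lambda>_. \<zero>)"
    using norm_completion[OF x(1)] by (simp add: asymp_def cauchy_seqsD)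
  then show "X = zeroA (completion A p)"
    using x by (simp add: completion_ops seq_class_eq_iff)
next
  fix X assume X: "X \<in> cauchy_seqs (completion A p) (normA (completion A p))"
  let ?N = "normA (completion A p)" and ?d = "diffA (completion A p)"
  have Xc: "X k \<in> carr (completion A p)" for k using X by (rule completion.cauchy_seqsD)
  have "\<exists>a\<in>carr A. ?N (?d (incl a) (X k)) < 1 / real (Suc k)" for k
  proof -
    obtain x where x: "x \<in> cauchy_seqs A p" and t: "completion.tends (\<lambda>n. incl (x n)) (X k)"
      using completion_approx[OF Xc] by metis
    have "\<forall>\<^sub>F n in sequentially. ?N (?d (incl (x n)) (X k)) < 1 / real (Suc k)"
      by (rule order_tendstoD[OF completion.tendsD(3)[OF t]]) simp
    then show ?thesis using x by (auto simp: cauchy_seqsD dest!: eventually_happens)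
  qed
  then obtain a where a: "\<And>k. a k \<in> carr A"
    and aX: "\<And>k. ?N (?d (incl (a k)) (X k)) < 1 / real (Suc k)" by metis
  have null: "(\<lambda>k. 1 / real (Suc k)) \<longlonglongrightarrow> 0"
    using LIMSEQ_inverse_real_of_nat by (simp add: inverse_eq_divide)
  have "a \<in> cauchy_seqs A p"
  proof (rule cauchy_seqsI[OF a])
    fix \<epsilon> :: real assume "\<epsilon> > 0"
    then have \<epsilon>: "\<epsilon> / 3 > 0" by simp
    obtain M where M: "\<And>k. k \<ge> M \<Longrightarrow> 1 / real (Suc k) < \<epsilon> / 3"
      using order_tendstoD(2)[OF null \<epsilon>] by (auto simp: eventually_sequentially)
    obtain N where N: "\<And>m n. \<lbrakk>m \<ge> N; n \<ge> N\<rbrakk> \<Longrightarrow> ?N (?d (X m) (X n)) < \<epsilon> / 3"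
      using completion.cauchy_seqsE[OF X \<epsilon>] by blast
    have "p (a m \<ominus> a n) < \<epsilon>" if "m \<ge> max M N" "n \<ge> max M N" for m n
    proof -
      have "p (a m \<ominus> a n) = ?N (?d (incl (a m)) (incl (a n)))"
        using a by (simp add: diff_incl norm_incl)
      also have "\<dots> \<le> ?N (?d (incl (a m)) (X m)) + ?N (?d (X m) (incl (a n)))"
        using a Xc by (intro completion.seminorm_diff_triangle) auto
      also have "?N (?d (X m) (incl (a n))) \<le> ?N (?d (X m) (X n)) + ?N (?d (X n) (incl (a n)))"
        using a Xc by (intro completion.seminorm_diff_triangle) auto
      also have "?N (?d (X n) (incl (a n))) = ?N (?d (incl (a n)) (X n))"
        using a Xc by (intro completion.seminorm_diff_swap) auto
      finally show ?thesis
        using aX[of m] aX[of n] M[of m] M[of n] N[of m n] that by simp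
    qed
    then show "\<exists>N. \<forall>m\<ge>N. \<forall>n\<ge>N. p (a m \<ominus> a n) < \<epsilon>" by blast
  qed
  then have t: "completion.tends (\<lambda>n. incl (a n)) (seq_class A p a)" by (rule incl_tends)
  let ?L = "seq_class A p a"
  have L: "?L \<in> carr (completion A p)" using t by (rule completion.tendsD)
  have "completion.tends X ?L"
  proof (rule completion.tendsI_le[OF Xc L])
    show "?N (?d (X n) ?L) \<le> 1 / real (Suc n) + ?N (?d (incl (a n)) ?L)" for n
      using completion.seminorm_diff_triangle[OF Xc incl_closed[OF a] L, of n n] aX[of n]
        completion.seminorm_diff_swap[OF Xc incl_closed[OF a], of n n] by simp
    show "(\<lambda>n. 1 / real (Suc n) + ?N (?d (incl (a n)) ?L)) \<longlonglongrightarrow> 0"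
      using tendsto_add[OF null completion.tendsD(3)[OF t]] by simp
  qed
  then show "\<exists>l\<in>carr (completion A p). (\<lambda>n. ?N (?d (X n) l)) \<longlonglongrightarrow> 0"
    using L by (auto simp: completion.tends_def)
qed (rule star_algebra_completion cstar_seminorm_completion)+

end

section \<open>Universal enveloping C*-algebras\<close>

lemma star_homD:
  assumes "f \<in> star_hom A B"
  shows "x \<in> carr A \<Longrightarrow> f x \<in> carr B"
    "\<lbrakk>x \<in> carr A; y \<in> carr A\<rbrakk> \<Longrightarrow> f (addA A x y) = addA B (f x) (f y)"
    "\<lbrakk>x \<in> carr A; y \<in> carr A\<rbrakk> \<Longrightarrow> f (multA A x y) = multA B (f x) (f y)"
    "x \<in> carr A \<Longrightarrow> f (scaleA A c x) = scaleA B c (f x)"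
    "x \<in> carr A \<Longrightarrow> f (starA A x) = starA B (f x)"
  using assms unfolding star_hom_def by blast+

lemma star_hom_eqI:
  assumes "f \<in> star_hom A B" "g \<in> star_hom A B" "\<And>x. x \<in> carr A \<Longrightarrow> f x = g x"
  shows "f = g"
  using assms by (auto simp: star_hom_def intro: PiE_ext)

lemma star_hom_restrictI:
  assumes "star_algebra A"
    and "\<And>x. x \<in> carr A \<Longrightarrow> f x \<in> carr B"
    and "\<And>x y. \<lbrakk>x \<in> carr A; y \<in> carr A\<rbrakk> \<Longrightarrow> f (addA A x y) = addA B (f x) (f y)"
    and "\<And>x y. \<lbrakk>x \<in> carr A; y \<in> carr A\<rbrakk> \<Longrightarrow> f (multA A x y) = multA B (f x) (f y)"
    and "\<And>c x. x \<in> carr A \<Longrightarrow> f (scaleA A c x) = scaleA B c (f x)"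
    and "\<And>x. x \<in> carr A \<Longrightarrow> f (starA A x) = starA B (f x)"
  shows "restrict f (carr A) \<in> star_hom A B"
proof -
  interpret star_alg A using assms(1) by unfold_locales
  show ?thesis using assms(2-) by (simp add: star_hom_def)
qed

lemma star_hom_id: "star_algebra A \<Longrightarrow> restrict id (carr A) \<in> star_hom A A"
  by (rule star_hom_restrictI) auto

lemma star_hom_compose:
  assumes "star_algebra A" "f \<in> star_hom A B" "g \<in> star_hom B C"
  shows "compose (carr A) g f \<in> star_hom A C"
  unfolding compose_def
  by (rule star_hom_restrictI) (use assms in \<open>simp_all add: star_homD\<close>)

lemma star_hom_diff:
  assumes "star_algebra A" "f \<in> star_hom A B" "x \<in> carr A" "y \<in> carr A"
  shows "f (diffA A x y) = diffA B (f x) (f y)"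
proof -
  interpret star_alg A using assms(1) by unfold_locales
  show ?thesis using assms(3,4) by (simp add: diffA_def star_homD[OF assms(2)])
qed

lemma star_hom_zero:
  assumes "star_algebra A" "star_algebra B" "f \<in> star_hom A B"
  shows "f (zeroA A) = zeroA B"
proof -
  interpret A: star_alg A using assms(1) by unfold_locales
  interpret B: star_alg B using assms(2) by unfold_locales
  show ?thesis using star_homD(4)[OF assms(3), of "zeroA A" 0] star_homD(1)[OF assms(3)] by simp
qed

text \<open>The passage from homomorphisms to seminorms: with q the norm of B, a bound valid for all
  C*-seminorms on A bounds the homomorphism f.\<close>

lemma cstar_seminorm_pullback:
  assumes "star_algebra A" "f \<in> star_hom A B" "cstar_seminorm B q"
  shows "cstar_seminorm A (\<lambda>x. q (f x))"
proof -
  interpret star_alg A using assms(1) by unfold_locales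
  show ?thesis
    using assms(3) closed unfolding cstar_seminorm_def
    by (simp add: star_homD[OF assms(2)])
qed

context seminorm_completion begin

text \<open>Maximality of p makes \<pi> contractive, so images of Cauchy sequences converge and
  \<rho> is defined by limits, independently of the representative. Two extensions agree because
  both are contractive on the completion and A is dense there.\<close>

theorem completion_universal:
  assumes maximal: "\<And>q x. \<lbrakk>cstar_seminorm A q; x \<in> carr A\<rbrakk> \<Longrightarrow> q x \<le> p x"
    and B: "cstar_algebra B" and \<pi>: "\<pi> \<in> star_hom A B"
  shows "\<exists>!\<rho>. \<rho> \<in> star_hom (completion A p) B \<and> (\<forall>x\<in>carr A. \<rho> (incl x) = \<pi> x)"
proof -
  interpret B: cstar_alg B using B by unfold_locales
  note \<pi>D = star_homD[OF \<pi>] and \<pi>_diff = star_hom_diff[OF star_algebra \<pi>]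
  have le: "normA B (\<pi> x) \<le> p x" if "x \<in> carr A" for x
    by (rule maximal[OF cstar_seminorm_pullback[OF star_algebra \<pi> B.cstar_seminorm] that])
  have le_diff: "normA B (diffA B (\<pi> x) (\<pi> y)) \<le> p (x \<ominus> y)" if "x \<in> carr A" "y \<in> carr A" for x y
    using le[of "x \<ominus> y"] that by (simp add: \<pi>_diff)
  define L where "L x = (SOME l. B.tends (\<lambda>n. \<pi> (x n)) l)" for x
  have L: "B.tends (\<lambda>n. \<pi> (x n)) (L x)" if x: "x \<in> cauchy_seqs A p" for x
  proof -
    have "(\<lambda>n. \<pi> (x n)) \<in> cauchy_seqs B (normA B)"
    proof (rule B.cauchy_seqsI)
      fix \<epsilon> :: real assume "\<epsilon> > 0"
      then obtain N where N: "\<And>m n. \<lbrakk>m \<ge> N; n \<ge> N\<rbrakk> \<Longrightarrow> p (x m \<ominus> x n) < \<epsilon>"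
        using cauchy_seqsE[OF x] by blast
      then show "\<exists>N. \<forall>m\<ge>N. \<forall>n\<ge>N. normA B (diffA B (\<pi> (x m)) (\<pi> (x n))) < \<epsilon>"
        using le_diff[OF cauchy_seqsD[OF x] cauchy_seqsD[OF x]] by (meson le_less_trans)
    qed (use x \<pi>D in \<open>auto simp: cauchy_seqsD\<close>)
    then obtain l where "B.tends (\<lambda>n. \<pi> (x n)) l" by (rule B.complete)
    then show ?thesis unfolding L_def by (rule someI)
  qed
  have L_eqI: "L x = l" if "x \<in> cauchy_seqs A p" "B.tends (\<lambda>n. \<pi> (x n)) l" for x l
    using L[OF that(1)] that(2) by (rule B.tends_eq)
  have L_asymp: "L x = L y" if xy: "x \<in> cauchy_seqs A p" "y \<in> cauchy_seqs A p" "asymp x y" for x y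
  proof (rule L_eqI[OF xy(1)], rule B.tendsI_le)
    show "normA B (diffA B (\<pi> (x n)) (L y))
      \<le> p (x n \<ominus> y n) + normA B (diffA B (\<pi> (y n)) (L y))" for n
      using B.seminorm_diff_triangle[of "\<pi> (x n)" "\<pi> (y n)" "L y"] le_diff[of "x n" "y n"]
        xy L[OF xy(2)] \<pi>D(1) by (simp add: cauchy_seqsD B.tends_def)
    show "(\<lambda>n. p (x n \<ominus> y n) + normA B (diffA B (\<pi> (y n)) (L y))) \<longlonglongrightarrow> 0"
      using tendsto_add[OF xy(3)[unfolded asymp_def] B.tendsD(3)[OF L[OF xy(2)]]] by simp
  qed (use xy L[OF xy(2)] in \<open>auto simp: \<pi>D(1) cauchy_seqsD B.tends_def\<close>)
  define \<rho> where "\<rho> = (\<lambda>X\<in>carr (completion A p). L (rep X))"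
  have \<rho>: "\<rho> (seq_class A p x) = L x" if x: "x \<in> cauchy_seqs A p" for x
    using L_asymp[OF x rep_seq_class(1)[OF x] rep_seq_class(2)[OF x]] x
    by (simp add: \<rho>_def carr_completion)
  have "\<rho> \<in> star_hom (completion A p) B"
    unfolding star_hom_def carr_completion
  proof (intro CollectI conjI ballI allI; (elim imageE)?; hypsubst?)
    show "\<rho> \<in> seq_class A p ` cauchy_seqs A p \<rightarrow>\<^sub>E carr B"
    proof (rule PiE_I)
      show "\<rho> X \<in> carr B" if "X \<in> seq_class A p ` cauchy_seqs A p" for X
        using that \<rho> B.tendsD(2)[OF L] by auto
    qed (simp add: \<rho>_def carr_completion)
  next
    fix X Y x y assume x: "x \<in> cauchy_seqs A p" and y: "y \<in> cauchy_seqs A p"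
    have "L (\<lambda>n. x n \<oplus> y n) = addA B (L x) (L y)"
      using B.tends_add[OF L[OF x] L[OF y]] x y \<pi>D(2)
      by (intro L_eqI) (auto simp: cauchy_seqsD)
    then show "\<rho> (addA (completion A p) (seq_class A p x) (seq_class A p y))
        = addA B (\<rho> (seq_class A p x)) (\<rho> (seq_class A p y))"
      using x y by (simp add: add_completion \<rho>)
    have "L (\<lambda>n. x n \<otimes> y n) = multA B (L x) (L y)"
      using B.tends_mult[OF L[OF x] L[OF y]] x y \<pi>D(3)
      by (intro L_eqI) (auto simp: cauchy_seqsD)
    then show "\<rho> (multA (completion A p) (seq_class A p x) (seq_class A p y))
        = multA B (\<rho> (seq_class A p x)) (\<rho> (seq_class A p y))"
      using x y by (simp add: mult_completion \<rho>)
  next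
    fix c X x assume x: "x \<in> cauchy_seqs A p"
    have "L (\<lambda>n. c \<odot> x n) = scaleA B c (L x)"
      using B.tends_scale[OF L[OF x]] x \<pi>D(4) by (intro L_eqI) (auto simp: cauchy_seqsD)
    then show "\<rho> (scaleA (completion A p) c (seq_class A p x))
        = scaleA B c (\<rho> (seq_class A p x))"
      using x by (simp add: scale_completion \<rho>)
  next
    fix X x assume x: "x \<in> cauchy_seqs A p"
    have "L (\<lambda>n. star_op (x n)) = starA B (L x)"
      using B.tends_star[OF L[OF x]] x \<pi>D(5) by (intro L_eqI) (auto simp: cauchy_seqsD)
    then show "\<rho> (starA (completion A p) (seq_class A p x)) = starA B (\<rho> (seq_class A p x))"
      using x by (simp add: star_completion \<rho>)
  qed
  moreover have "\<rho> (incl x) = \<pi> x" if "x \<in> carr A" for x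
    using that \<pi>D(1) by (auto simp: incl_def \<rho> intro!: L_eqI B.tends_const)
  moreover have "\<sigma> = \<tau>"
    if \<sigma>: "\<sigma> \<in> star_hom (completion A p) B" "\<forall>x\<in>carr A. \<sigma> (incl x) = \<pi> x"
      and \<tau>: "\<tau> \<in> star_hom (completion A p) B" "\<forall>x\<in>carr A. \<tau> (incl x) = \<pi> x" for \<sigma> \<tau>
  proof (rule star_hom_eqI[OF \<sigma>(1) \<tau>(1)])
    fix X assume X: "X \<in> carr (completion A p)"
    then obtain x where x: "x \<in> cauchy_seqs A p"
      and t: "completion.tends (\<lambda>n. incl (x n)) X" using completion_approx by metis
    \<comment> \<open>Continuity of \<sigma> is not assumed; it follows because ||\<sigma> X|| is a
      C*-seminorm in X on the C*-algebra \<open>completion A p\<close>, hence at most its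
      norm.\<close>
    have lim: "B.tends (\<lambda>n. \<pi> (x n)) (\<sigma> X)"
      if \<sigma>: "\<sigma> \<in> star_hom (completion A p) B" "\<forall>x\<in>carr A. \<sigma> (incl x) = \<pi> x" for \<sigma>
    proof (rule B.tendsI_le[OF _ _ _ completion.tendsD(3)[OF t]])
      interpret C: cstar_alg "completion A p" using cstar_algebra_completion by unfold_locales
      show "\<pi> (x n) \<in> carr B" for n using x \<pi>D(1) by (simp add: cauchy_seqsD)
      show "\<sigma> X \<in> carr B" using X star_homD(1)[OF \<sigma>(1)] by simp
      fix n
      have xn: "x n \<in> carr A" using x by (rule cauchy_seqsD)
      have "diffA B (\<pi> (x n)) (\<sigma> X) = \<sigma> (diffA (completion A p) (incl (x n)) X)"
        using \<sigma> X xn by (simp add: star_hom_diff[OF star_algebra_completion])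
      moreover have "normA B (\<sigma> (diffA (completion A p) (incl (x n)) X))
          \<le> normA (completion A p) (diffA (completion A p) (incl (x n)) X)"
        using X xn by (intro C.cstar_seminorm_le_norm cstar_seminorm_pullback[OF star_algebra_completion \<sigma>(1)]
            B.cstar_seminorm completion.diff_closed incl_closed)
      ultimately show "normA B (diffA B (\<pi> (x n)) (\<sigma> X))
          \<le> normA (completion A p) (diffA (completion A p) (incl (x n)) X)" by simp
    qed
    show "\<sigma> X = \<tau> X" using B.tends_eq[OF lim[OF \<sigma>] lim[OF \<tau>]] .
  qed
  ultimately show ?thesis by blast
qed

lemma incl_star_hom: "restrict incl (carr A) \<in> star_hom A (completion A p)"
  by (rule star_hom_restrictI[OF star_algebra])
    (simp_all add: incl_closed, simp_all add: incl_def completion_ops)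

end

section \<open>The largest C*-seminorm on a *-algebra\<close>

lemma cstar_seminorm_zero: "cstar_seminorm A (\<lambda>_. 0)"
  by (simp add: cstar_seminorm_def)

text \<open>Pointwise boundedness makes the real supremum in \<open>env_seminorm\<close> a least
  upper bound; the zero seminorm shows that the set of values is nonempty.\<close>

locale bounded_star_alg = star_alg +
  assumes seminorms_bounded:
    "x \<in> carr A \<Longrightarrow> \<exists>M. \<forall>q. cstar_seminorm A q \<longrightarrow> q x \<le> M"
begin

lemma seminorm_le_env:
  assumes "cstar_seminorm A q" "x \<in> carr A" shows "q x \<le> env_seminorm A x"
  unfolding env_seminorm_def
  using seminorms_bounded[OF assms(2)] assms(1)
  by (intro cSup_upper) (auto simp: bdd_above_def)

lemma env_seminorm_le:
  assumes "\<And>q. cstar_seminorm A q \<Longrightarrow> q x \<le> M" shows "env_seminorm A x \<le> M"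
  unfolding env_seminorm_def
  by (rule cSup_least) (use assms cstar_seminorm_zero in auto)

text \<open>Upper bounds for the supremum follow from each q directly. The reverse inequalities in
  the two equalities need a detour: dividing by c for homogeneity, and taking square roots in q(x)^2
  = q(star x x) for the C*-identity.\<close>

lemma cstar_seminorm_env: "cstar_seminorm A (env_seminorm A)"
proof -
  let ?e = "env_seminorm A"
  have nonneg: "0 \<le> ?e x" if "x \<in> carr A" for x
    using seminorm_le_env[OF cstar_seminorm_zero that] .
  have scale_le: "?e (c \<odot> x) \<le> cmod c * ?e x" if "x \<in> carr A" for c x
  proof (rule env_seminorm_le)
    fix q assume q: "cstar_seminorm A q"
    then have "q (c \<odot> x) = cmod c * q x" using that by (simp add: cstar_seminorm_def)
    then show "q (c \<odot> x) \<le> cmod c * ?e x"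
      using seminorm_le_env[OF q that] by (simp add: mult_left_mono)
  qed
  have scale: "?e (c \<odot> x) = cmod c * ?e x" if "x \<in> carr A" for c x
  proof (cases "c = 0")
    case True
    then show ?thesis using scale_le[OF that, of 0] nonneg[of "0 \<odot> x"] that by simp
  next
    case False
    have "?e x \<le> cmod (1 / c) * ?e (c \<odot> x)"
      using scale_le[of "c \<odot> x" "1 / c"] that False by simp
    then show ?thesis
      using scale_le[OF that, of c] False by (simp add: norm_divide field_simps)
  qed
  have add: "?e (x \<oplus> y) \<le> ?e x + ?e y" if "x \<in> carr A" "y \<in> carr A" for x y
  proof (rule env_seminorm_le)
    fix q assume q: "cstar_seminorm A q"
    then have "q (x \<oplus> y) \<le> q x + q y" using that by (simp add: cstar_seminorm_def)
    then show "q (x \<oplus> y) \<le> ?e x + ?e y"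
      using seminorm_le_env[OF q that(1)] seminorm_le_env[OF q that(2)] by simp
  qed
  have mult: "?e (x \<otimes> y) \<le> ?e x * ?e y" if "x \<in> carr A" "y \<in> carr A" for x y
  proof (rule env_seminorm_le)
    fix q assume q: "cstar_seminorm A q"
    then have "q (x \<otimes> y) \<le> q x * q y" "0 \<le> q y" using that by (simp_all add: cstar_seminorm_def)
    then show "q (x \<otimes> y) \<le> ?e x * ?e y"
      using mult_mono[OF seminorm_le_env[OF q that(1)] seminorm_le_env[OF q that(2)]]
        nonneg that by (meson order_trans)
  qed
  have star: "?e (star_op x \<otimes> x) = (?e x)\<^sup>2" if "x \<in> carr A" for x
  proof (rule antisym)
    show "?e (star_op x \<otimes> x) \<le> (?e x)\<^sup>2"
    proof (rule env_seminorm_le)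
      fix q assume q: "cstar_seminorm A q"
      then have "q (star_op x \<otimes> x) = (q x)\<^sup>2" "0 \<le> q x" using that by (simp_all add: cstar_seminorm_def)
      then show "q (star_op x \<otimes> x) \<le> (?e x)\<^sup>2"
        using power_mono[OF seminorm_le_env[OF q that], of 2] by simp
    qed
    have "?e x \<le> sqrt (?e (star_op x \<otimes> x))"
    proof (rule env_seminorm_le)
      fix q assume q: "cstar_seminorm A q"
      then have "(q x)\<^sup>2 = q (star_op x \<otimes> x)" using that by (simp add: cstar_seminorm_def)
      also have "\<dots> \<le> ?e (star_op x \<otimes> x)" using that by (intro seminorm_le_env[OF q]) auto
      finally show "q x \<le> sqrt (?e (star_op x \<otimes> x))" by (rule real_le_rsqrt)
    qed
    then show "(?e x)\<^sup>2 \<le> ?e (star_op x \<otimes> x)"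
      using nonneg[OF that] nonneg[of "star_op x \<otimes> x"] that
      by (metis closed(3,5) power_mono real_sqrt_pow2)
  qed
  show ?thesis
    using nonneg scale add mult star by (simp add: cstar_seminorm_def)
qed

text \<open>For the existence of extensions, a homomorphism into a C*-algebra of any element type
  matters only through the C*-seminorm it induces on A, and \<open>env_seminorm A\<close> dominates
  all of these.\<close>

theorem universal_enveloping_completion:
  "universal_enveloping TYPE('c) A (completion A (env_seminorm A))
     (\<lambda>x\<in>carr A. seq_class A (env_seminorm A) (\<lambda>_. x))"
proof -
  interpret seminorm_completion A "env_seminorm A"
    using cstar_seminorm_env by unfold_locales
  have "(\<lambda>x\<in>carr A. seq_class A (env_seminorm A) (\<lambda>_. x)) = restrict incl (carr A)"
    by (simp add: incl_def cong: restrict_cong)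
  moreover have "\<exists>!\<rho>. \<rho> \<in> star_hom (completion A (env_seminorm A)) B \<and> (\<forall>x\<in>carr A. \<rho> (incl x) = \<pi> x)"
    if "cstar_algebra B" "\<pi> \<in> star_hom A B" for B :: "'c normed_star_alg" and \<pi>
    using completion_universal[OF _ that] seminorm_le_env by blast
  ultimately show ?thesis
    unfolding universal_enveloping_def
    using cstar_algebra_completion incl_star_hom by simp
qed

end

section \<open>The graph inverse semigroup\<close>

lemma path_prefix_refl [simp]: "path_prefix \<alpha> \<alpha>"
  by (simp add: path_prefix_def)

lemma path_prefix_antisym: "\<lbrakk>path_prefix \<alpha> \<beta>; path_prefix \<beta> \<alpha>\<rbrakk> \<Longrightarrow> \<alpha> = \<beta>"
  by (auto simp: path_prefix_def prod_eq_iff)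

lemma extend_by_self [simp]: "extend_by \<alpha> \<beta> \<beta> = \<alpha>"
  by (simp add: extend_by_def)

lemma extend_by_same [simp]: "path_prefix \<beta> \<gamma> \<Longrightarrow> extend_by \<beta> \<beta> \<gamma> = \<gamma>"
  by (auto simp: path_prefix_def extend_by_def prod_eq_iff prefix_def)

lemma path_prefix_comparable:
  "\<lbrakk>path_prefix \<alpha> \<gamma>; path_prefix \<beta> \<gamma>\<rbrakk> \<Longrightarrow> path_prefix \<alpha> \<beta> \<or> path_prefix \<beta> \<alpha>"
  using prefix_same_cases by (auto simp: path_prefix_def)

text \<open>An extension of \<alpha> is recorded by its additional edges alone; that they fit
  together is expressed by membership in \<open>fin_paths\<close>.\<close>

definition append_edges :: "('v, 'e) path \<Rightarrow> 'e list \<Rightarrow> ('v, 'e) path" where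
  "append_edges \<alpha> p = (fst \<alpha>, snd \<alpha> @ p)"

lemma append_edges_Nil [simp]: "append_edges \<alpha> [] = \<alpha>"
  by (simp add: append_edges_def)

lemma append_edges_append [simp]:
  "append_edges (append_edges \<alpha> p) q = append_edges \<alpha> (p @ q)"
  by (simp add: append_edges_def)

lemma append_edges_inject [simp]: "append_edges \<alpha> p = append_edges \<alpha> q \<longleftrightarrow> p = q"
  by (simp add: append_edges_def)

lemma path_prefix_append_edges [simp]:
  "path_prefix (append_edges \<alpha> p) (append_edges \<alpha> q) \<longleftrightarrow> prefix p q"
  "path_prefix \<alpha> (append_edges \<alpha> q)"
  by (simp_all add: append_edges_def path_prefix_def)

lemma path_prefixE:
  assumes "path_prefix \<alpha> \<beta>" obtains p where "\<beta> = append_edges \<alpha> p"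
  using assms by (auto simp: path_prefix_def append_edges_def prefix_def prod_eq_iff)

lemma extend_by_append_edges [simp]:
  "extend_by \<alpha> \<beta> (append_edges \<beta> p) = append_edges \<alpha> p"
  "extend_by \<alpha> (append_edges \<beta> p) (append_edges \<beta> (p @ q)) = append_edges \<alpha> q"
  by (simp_all add: extend_by_def append_edges_def)

text \<open>
  A pair \<open>(\<alpha>, \<beta>)\<close> acts as the partial map \<open>\<beta>\<gamma> \<mapsto> \<alpha>\<gamma>\<close>; this faithful representation turns
  multiplication into composition.
\<close>

fun gis_act :: "('v, 'e) gis_elem \<Rightarrow> ('v, 'e) path \<Rightarrow> ('v, 'e) path option" where
  "gis_act Zero \<gamma> = None"
| "gis_act (Pr \<alpha> \<beta>) \<gamma> = (if path_prefix \<beta> \<gamma> then Some (extend_by \<alpha> \<beta> \<gamma>) else None)"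

text \<open>\<open>Pr \<alpha> \<beta>\<close> is recovered from its action: \<beta> is the shortest
  path on which it is defined, and \<alpha> is the value there.\<close>

lemma gis_act_inj:
  assumes "gis_act s = gis_act t" shows "s = t"
proof (cases s)
  case Zero
  then show ?thesis
    using fun_cong[OF assms] by (cases t) (auto, metis option.distinct(1) path_prefix_refl)
next
  case (Pr \<alpha> \<beta>)
  have "gis_act t \<beta> = Some \<alpha>" using assms Pr by (metis gis_act.simps(2) extend_by_self path_prefix_refl)
  then obtain \<gamma> \<delta> where t: "t = Pr \<gamma> \<delta>" and "path_prefix \<delta> \<beta>" "extend_by \<gamma> \<delta> \<beta> = \<alpha>"
    by (cases t) (auto split: if_splits)
  moreover have "gis_act s \<delta> = Some \<gamma>" using assms t by simp
  then have "path_prefix \<beta> \<delta>" using Pr by (auto split: if_splits)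
  ultimately show ?thesis using Pr path_prefix_antisym by fastforce
qed

lemma gis_act_mult: "gis_act (gis_mult s t) \<gamma> = Option.bind (gis_act t \<gamma>) (gis_act s)"
proof (cases s; cases t)
  fix \<alpha> \<beta> \<gamma>' \<delta> assume st: "s = Pr \<alpha> \<beta>" "t = Pr \<gamma>' \<delta>"
  show ?thesis
  proof (cases "path_prefix \<delta> \<gamma>")
    case True
    then obtain r where r: "\<gamma> = append_edges \<delta> r" by (rule path_prefixE)
    consider "path_prefix \<beta> \<gamma>'" | "\<not> path_prefix \<beta> \<gamma>'" "path_prefix \<gamma>' \<beta>"
      | "\<not> path_prefix \<beta> \<gamma>'" "\<not> path_prefix \<gamma>' \<beta>" by blast
    then show ?thesis
    proof cases
      case 1
      then obtain q where "\<gamma>' = append_edges \<beta> q" by (rule path_prefixE)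
      then show ?thesis using st r by simp
    next
      case 2
      then obtain q where q: "\<beta> = append_edges \<gamma>' q" by (metis path_prefixE)
      show ?thesis
      proof (cases "prefix q r")
        case True
        then obtain u where "r = q @ u" by (rule prefixE)
        then show ?thesis using st r q 2 by simp
      next
        case False
        then show ?thesis using st r q 2 by simp
      qed
    next
      case 3
      have "\<not> path_prefix \<beta> (append_edges \<gamma>' r)"
        using 3 path_prefix_comparable[of \<beta> "append_edges \<gamma>' r" \<gamma>'] by auto
      then show ?thesis using st r 3 by simp
    qed
  next
    case False
    moreover have "\<not> path_prefix (append_edges \<delta> q) \<gamma>" for q
      using False by (auto simp: path_prefix_def append_edges_def dest: append_prefixD)
    ultimately show ?thesis using st by (auto elim!: path_prefixE)
  qed
qed auto

text \<open>Composition of partial maps is associative. The representation is faithful on arbitrary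
  formal pairs, so the law holds without reference to a graph.\<close>

lemma gis_mult_assoc: "gis_mult (gis_mult s t) r = gis_mult s (gis_mult t r)"
  by (rule gis_act_inj, rule ext) (simp add: gis_act_mult, metis bind_assoc gis_act_mult)

lemma gis_star_star [simp]: "gis_star (gis_star s) = s"
  by (cases s) auto

lemma gis_star_eq_Zero [simp]: "gis_star s = Zero \<longleftrightarrow> s = Zero"
  by (cases s) auto

lemma gis_mult_Zero [simp]: "gis_mult s Zero = Zero"
  by (cases s) auto

lemma gis_star_mult: "gis_star (gis_mult s t) = gis_mult (gis_star t) (gis_star s)"
proof (cases s; cases t)
  fix \<alpha> \<beta> \<gamma> \<delta> assume "s = Pr \<alpha> \<beta>" "t = Pr \<gamma> \<delta>"
  then show ?thesis using path_prefix_antisym[of \<beta> \<gamma>] by auto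
qed auto

lemma gis_star_inverse [simp]: "gis_mult (gis_mult s (gis_star s)) s = s"
  by (cases s) auto

subsection \<open>Idempotents\<close>

abbreviation idem :: "('v, 'e) path \<Rightarrow> ('v, 'e) gis_elem" where "idem \<alpha> \<equiv> Pr \<alpha> \<alpha>"

lemma idem_mult_idem:
  "gis_mult (idem \<alpha>) (idem \<beta>) =
    (if path_prefix \<alpha> \<beta> then idem \<beta> else if path_prefix \<beta> \<alpha> then idem \<alpha> else Zero)"
  by auto

lemma gis_idempotent:
  assumes "gis_mult s s = s" "s \<noteq> Zero" obtains \<alpha> where "s = idem \<alpha>"
proof (cases s)
  case (Pr \<alpha> \<beta>)
  then have "\<alpha> = \<beta>" using assms
    by (auto simp: path_prefix_def extend_by_def prod_eq_iff prefix_def split: if_splits)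
  then show ?thesis using that Pr by blast
qed (use assms in simp)

lemma gis_idempotent_cases:
  assumes "gis_mult s s = s" obtains "s = Zero" | \<alpha> where "s = idem \<alpha>"
  using assms gis_idempotent by metis

lemma idempotents_commute:
  assumes "gis_mult s s = s" "gis_mult t t = t" shows "gis_mult s t = gis_mult t s"
  using assms(1)
proof (cases rule: gis_idempotent_cases)
  case (2 \<alpha>)
  note s = this
  show ?thesis using assms(2)
    by (cases rule: gis_idempotent_cases) (auto simp: s dest: path_prefix_antisym)
qed simp

text \<open>The classical argument that commuting idempotents make inverses unique: x s, s x and
  their analogues for \<open>gis_star s\<close> are idempotents, and exchanging them turns x into
  \<open>gis_star s\<close>. Maps known to preserve products thereby preserve the
  involution.\<close>

lemma gis_star_unique:
  assumes "gis_mult (gis_mult s x) s = s" "gis_mult (gis_mult x s) x = x"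
  shows "x = gis_star s"
proof -
  let ?m = gis_mult and ?y = "gis_star s"
  have y: "?m (?m s ?y) s = s" "?m (?m ?y s) ?y = ?y"
    using gis_star_inverse[of s] gis_star_inverse[of "gis_star s"] by simp_all
  have c1: "?m (?m x s) (?m ?y s) = ?m (?m ?y s) (?m x s)"
    by (rule idempotents_commute) (metis assms y gis_mult_assoc)+
  have c2: "?m (?m s x) (?m s ?y) = ?m (?m s ?y) (?m s x)"
    by (rule idempotents_commute) (metis assms y gis_mult_assoc)+
  have "x = ?m (?m (?m x s) (?m ?y s)) x"
    by (metis assms(2) y(1) gis_mult_assoc)
  also have "\<dots> = ?m (?m ?y s) x"
    unfolding c1 by (metis assms(2) gis_mult_assoc)
  also have "\<dots> = ?m ?y (?m (?m s ?y) (?m s x))"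
    by (metis y(1) gis_mult_assoc)
  also have "\<dots> = ?m (?m ?y s) ?y"
    by (metis c2 assms(1) gis_mult_assoc)
  also have "\<dots> = ?y" by (rule y)
  finally show ?thesis .
qed

text \<open>If t lies below e, then t is the product of the commuting idempotents
  \<open>gis_mult t (gis_star t)\<close> and e, hence idempotent. Regularity therefore has to be
  tested only on idempotents.\<close>

lemma gis_le_idempotent:
  assumes "gis_mult e e = e"
  shows "gis_le t e \<longleftrightarrow> gis_mult t t = t \<and> gis_mult t e = t"
proof
  assume le: "gis_le t e"
  let ?f = "gis_mult t (gis_star t)"
  have f: "gis_mult ?f ?f = ?f" by (metis gis_mult_assoc gis_star_inverse)
  have t: "gis_mult ?f e = t" using le by (simp add: gis_le_def)
  have "gis_mult e ?f = t" using idempotents_commute[OF assms f] t by simp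
  then show "gis_mult t t = t \<and> gis_mult t e = t"
    by (metis assms f gis_mult_assoc t)
next
  assume "gis_mult t t = t \<and> gis_mult t e = t"
  then show "gis_le t e"
    unfolding gis_le_def by (metis gis_idempotent gis_mult.simps(2) gis_star.simps(2) gis_star_unique)
qed

subsection \<open>Paths\<close>

context wf_digraph begin

lemma fin_paths_iff: "\<alpha> \<in> fin_paths G \<longleftrightarrow> awalk (fst \<alpha>) (snd \<alpha>) (path_target G \<alpha>)"
  by (auto simp: fin_paths_def path_target_def split: prod.splits)

lemma path_target_Pair: "path_target G (u, p) = awlast u p"
  by (simp add: path_target_def)

lemma path_target_in_verts: "\<alpha> \<in> fin_paths G \<Longrightarrow> path_target G \<alpha> \<in> verts G"
  by (auto simp: fin_paths_iff)

lemma append_edges_fin_paths: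
  "append_edges \<alpha> p \<in> fin_paths G \<longleftrightarrow>
    \<alpha> \<in> fin_paths G \<and> awalk (path_target G \<alpha>) p (path_target G (append_edges \<alpha> p))"
  by (auto simp: append_edges_def fin_paths_def path_target_def split: prod.splits)

lemma path_target_append_edges:
  assumes "append_edges \<alpha> p \<in> fin_paths G"
  shows "path_target G (append_edges \<alpha> p) = path_target G (path_target G \<alpha>, p)"
  using assms by (auto simp: append_edges_fin_paths path_target_Pair)

text \<open>The possible continuations of a path depend only on the vertex it has reached; this is
  what closes \<open>gis\<close> under products.\<close>

lemma append_edges_transfer:
  assumes "append_edges \<beta> p \<in> fin_paths G" "\<alpha> \<in> fin_paths G" "path_target G \<alpha> = path_target G \<beta>"
  shows "append_edges \<alpha> p \<in> fin_paths G"
    "path_target G (append_edges \<alpha> p) = path_target G (append_edges \<beta> p)"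
proof -
  have "awalk (path_target G \<alpha>) p (path_target G (append_edges \<beta> p))"
    using assms by (simp add: append_edges_fin_paths)
  then show 1: "append_edges \<alpha> p \<in> fin_paths G"
    using assms(2) by (auto simp: append_edges_def fin_paths_def path_target_def split: prod.splits)
  show "path_target G (append_edges \<alpha> p) = path_target G (append_edges \<beta> p)"
    using path_target_append_edges[OF 1] path_target_append_edges[OF assms(1)] assms(3) by simp
qed

lemma gis_iff [simp]:
  "Zero \<in> gis G"
  "Pr \<alpha> \<beta> \<in> gis G \<longleftrightarrow> \<alpha> \<in> fin_paths G \<and> \<beta> \<in> fin_paths G \<and> path_target G \<alpha> = path_target G \<beta>"
  by (simp_all add: gis_def) (cases \<alpha>; cases \<beta>; auto)

lemma gis_mult_closed [simp, intro]:
  assumes "s \<in> gis G" "t \<in> gis G" shows "gis_mult s t \<in> gis G"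
proof (cases s; cases t)
  fix \<alpha> \<beta> \<gamma> \<delta> assume st: "s = Pr \<alpha> \<beta>" "t = Pr \<gamma> \<delta>"
  consider p where "\<gamma> = append_edges \<beta> p"
    | p where "\<not> path_prefix \<beta> \<gamma>" "\<beta> = append_edges \<gamma> p"
    | "\<not> path_prefix \<beta> \<gamma>" "\<not> path_prefix \<gamma> \<beta>"
    by (metis path_prefixE)
  then show ?thesis
  proof cases
    case 1
    then show ?thesis using assms st append_edges_transfer[of \<beta> p \<alpha>] by simp
  next
    case 2
    then show ?thesis using assms st append_edges_transfer[of \<gamma> p \<delta>] by simp
  next
    case 3
    then show ?thesis using st by simp
  qed
qed auto

lemma gis_star_closed [simp, intro]: "s \<in> gis G \<Longrightarrow> gis_star s \<in> gis G"
  by (cases s) auto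

lemma vertex_path_fin_paths [simp]: "vertex_path v \<in> fin_paths G \<longleftrightarrow> v \<in> verts G"
  by (auto simp: vertex_path_def fin_paths_def awalk_Nil_iff)

lemma edge_path_fin_paths [simp]: "e \<in> arcs G \<Longrightarrow> edge_path G e \<in> fin_paths G"
  using arc_implies_awalk[of e] by (auto simp: edge_path_def fin_paths_def)

lemma path_target_vertex [simp]: "path_target G (vertex_path v) = v"
  by (simp add: vertex_path_def path_target_def)

lemma path_target_edge [simp]: "path_target G (edge_path G e) = head G e"
  by (simp add: edge_path_def path_target_def)

lemma edge_path_append: "edge_path G e = append_edges (vertex_path (tail G e)) [e]"
  by (simp add: edge_path_def vertex_path_def append_edges_def)

lemma append_edge_fin_paths:
  assumes "\<alpha> \<in> fin_paths G" "e \<in> out_arcs G (path_target G \<alpha>)"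
  shows "append_edges \<alpha> [e] \<in> fin_paths G" "path_target G (append_edges \<alpha> [e]) = head G e"
proof -
  have e: "e \<in> arcs G" "tail G e = path_target G \<alpha>" using assms(2) by simp_all
  note t = append_edges_transfer[of "vertex_path (tail G e)" "[e]" \<alpha>, folded edge_path_append]
  show "append_edges \<alpha> [e] \<in> fin_paths G"
    by (rule t(1)) (simp_all add: e assms(1))
  show "path_target G (append_edges \<alpha> [e]) = head G e"
    using t(2) by (simp add: e assms(1))
qed

lemma append_edges_hd_out_arcs:
  assumes "append_edges \<alpha> (e # p) \<in> fin_paths G"
  shows "e \<in> out_arcs G (path_target G \<alpha>)"
  using assms by (auto simp: append_edges_fin_paths awalk_Cons_iff)

subsection \<open>Finite covers by path extensions\<close>

text \<open>A list \<gamma> stands for the extension \<alpha>\<gamma>. The last clause says that the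
  idempotent of every extension \<alpha>\<delta> has nonzero product with that of some
  \<alpha>\<gamma>; taking \<delta> = [], it also makes \<Gamma> nonempty when \<alpha> is a
  path.\<close>

definition covers :: "('a, 'b) path \<Rightarrow> 'b list set \<Rightarrow> bool" where
  "covers \<alpha> \<Gamma> \<longleftrightarrow> finite \<Gamma> \<and> (\<forall>\<gamma>\<in>\<Gamma>. append_edges \<alpha> \<gamma> \<in> fin_paths G) \<and>
    (\<forall>\<delta>. append_edges \<alpha> \<delta> \<in> fin_paths G \<longrightarrow> (\<exists>\<gamma>\<in>\<Gamma>. prefix \<gamma> \<delta> \<or> prefix \<delta> \<gamma>))"

text \<open>
  A finite cover without the trivial extension forces the target of \<open>\<alpha>\<close> to be a regular vertex,
  so that a property of covers can be proved by splitting along the edges leaving that vertex.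
\<close>

lemma covers_induct [consumes 2, case_names Nil step]:
  assumes "covers \<alpha> \<Gamma>" "\<alpha> \<in> fin_paths G"
    and Nil: "\<And>\<alpha> \<Gamma>. \<lbrakk>covers \<alpha> \<Gamma>; \<alpha> \<in> fin_paths G; [] \<in> \<Gamma>\<rbrakk> \<Longrightarrow> P \<alpha> \<Gamma>"
    and step: "\<And>\<alpha> \<Gamma>. \<lbrakk>covers \<alpha> \<Gamma>; \<alpha> \<in> fin_paths G; [] \<notin> \<Gamma>; path_target G \<alpha> \<in> reg_verts G;
      \<Gamma> = (\<Union>e\<in>out_arcs G (path_target G \<alpha>). (#) e ` {\<gamma>. e # \<gamma> \<in> \<Gamma>});
      \<And>e. e \<in> out_arcs G (path_target G \<alpha>) \<Longrightarrow>
        covers (append_edges \<alpha> [e]) {\<gamma>. e # \<gamma> \<in> \<Gamma>} \<and> P (append_edges \<alpha> [e]) {\<gamma>. e # \<gamma> \<in> \<Gamma>}\<rbrakk>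
      \<Longrightarrow> P \<alpha> \<Gamma>"
  shows "P \<alpha> \<Gamma>"
proof -
  \<comment> \<open>Induction on a bound for the lengths in \<Gamma>. It drops by one when \<Gamma>
    is replaced by the tails of its members beginning with e.\<close>
  have *: "P \<alpha> \<Gamma>" if "covers \<alpha> \<Gamma>" "\<alpha> \<in> fin_paths G" "\<forall>\<gamma>\<in>\<Gamma>. length \<gamma> \<le> n" for n
    using that
  proof (induction n arbitrary: \<alpha> \<Gamma>)
    case 0
    then have "[] \<in> \<Gamma>" by (auto simp: covers_def dest: spec[of _ "[]"])
    then show ?case using Nil 0 by blast
  next
    case (Suc n)
    show ?case
    proof (cases "[] \<in> \<Gamma>")
      case True
      then show ?thesis using Nil Suc by blast
    next
      case False
      let ?v = "path_target G \<alpha>"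
      have fin: "finite \<Gamma>" and paths: "\<And>\<gamma>. \<gamma> \<in> \<Gamma> \<Longrightarrow> append_edges \<alpha> \<gamma> \<in> fin_paths G"
        and cov: "\<And>\<delta>. append_edges \<alpha> \<delta> \<in> fin_paths G \<Longrightarrow> \<exists>\<gamma>\<in>\<Gamma>. prefix \<gamma> \<delta> \<or> prefix \<delta> \<gamma>"
        using Suc.prems by (auto simp: covers_def)
      have hd: "e \<in> out_arcs G ?v" if "e # \<gamma> \<in> \<Gamma>" for e \<gamma>
        using paths[OF that] by (rule append_edges_hd_out_arcs)
      have eq: "\<Gamma> = (\<Union>e\<in>out_arcs G ?v. (#) e ` {\<gamma>. e # \<gamma> \<in> \<Gamma>})"
      proof (intro equalityI subsetI)
        fix \<gamma> assume "\<gamma> \<in> \<Gamma>"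
        then show "\<gamma> \<in> (\<Union>e\<in>out_arcs G ?v. (#) e ` {\<gamma>. e # \<gamma> \<in> \<Gamma>})"
          using False hd by (cases \<gamma>) blast+
      qed auto
      \<comment> \<open>The extension [e] must be comparable with a member of \<Gamma>; all members
        are nonempty lists, so this one begins with e. Hence the edges at the target are among the
        first edges of the finite set \<Gamma>.\<close>
      have out: "\<exists>\<gamma>. e # \<gamma> \<in> \<Gamma>" if e: "e \<in> out_arcs G ?v" for e
      proof -
        obtain \<gamma> where "\<gamma> \<in> \<Gamma>" "prefix \<gamma> [e] \<or> prefix [e] \<gamma>"
          using cov append_edge_fin_paths(1)[OF Suc.prems(2) e] by blast
        then show ?thesis using False by (cases \<gamma>) auto
      qed
      obtain \<gamma> where "\<gamma> \<in> \<Gamma>" using cov[of "[]"] Suc.prems(2) by auto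
      then have "out_arcs G ?v \<noteq> {}" using eq by blast
      moreover have "out_arcs G ?v \<subseteq> hd ` \<Gamma>" using out by force
      then have "finite (out_arcs G ?v)" using fin finite_subset by blast
      ultimately have "?v \<in> reg_verts G"
        using path_target_in_verts[OF Suc.prems(2)] by (simp add: reg_verts_def)
      moreover have "covers (append_edges \<alpha> [e]) {\<gamma>. e # \<gamma> \<in> \<Gamma>}
          \<and> P (append_edges \<alpha> [e]) {\<gamma>. e # \<gamma> \<in> \<Gamma>}" if e: "e \<in> out_arcs G ?v" for e
      proof -
        have "finite {\<gamma>. e # \<gamma> \<in> \<Gamma>}"
          using finite_vimageI[OF fin, of "(#) e"] by (simp add: vimage_def)
        moreover have "\<exists>\<gamma>. e # \<gamma> \<in> \<Gamma> \<and> (prefix \<gamma> \<delta> \<or> prefix \<delta> \<gamma>)"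
          if e\<delta>: "append_edges \<alpha> (e # \<delta>) \<in> fin_paths G" for \<delta>
        proof -
          obtain \<gamma> where \<gamma>: "\<gamma> \<in> \<Gamma>" "prefix \<gamma> (e # \<delta>) \<or> prefix (e # \<delta>) \<gamma>" using cov[OF e\<delta>] by blast
          then show ?thesis using False by (cases \<gamma>) auto
        qed
        ultimately have c: "covers (append_edges \<alpha> [e]) {\<gamma>. e # \<gamma> \<in> \<Gamma>}"
          using paths by (auto simp: covers_def)
        moreover have "P (append_edges \<alpha> [e]) {\<gamma>. e # \<gamma> \<in> \<Gamma>}"
          using Suc.prems(3) append_edge_fin_paths(1)[OF Suc.prems(2) e]
          by (intro Suc.IH[OF c]) auto
        ultimately show ?thesis by blast
      qed
      ultimately show ?thesis using step[OF Suc.prems(1,2) False _ eq] by blast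
    qed
  qed
  have "finite \<Gamma>" using assms(1) by (simp add: covers_def)
  then have "\<forall>\<gamma>\<in>\<Gamma>. length \<gamma> \<le> Max (length ` \<Gamma>)" by simp
  then show ?thesis by (rule *[OF assms(1,2)])
qed

end

section \<open>Quotients by ideals\<close>

lemma (in star_alg) two_sided_ideal_gen:
  assumes "R \<subseteq> carr A"
  shows "two_sided_ideal A (ideal_gen A R)" "R \<subseteq> ideal_gen A R"
proof -
  have "two_sided_ideal A (carr A)" by (auto simp: two_sided_ideal_def)
  with assms have "ideal_gen A R \<subseteq> carr A" unfolding ideal_gen_def by blast
  then show "two_sided_ideal A (ideal_gen A R)"
    unfolding two_sided_ideal_def by (simp add: ideal_gen_def two_sided_ideal_def)
  show "R \<subseteq> ideal_gen A R" by (auto simp: ideal_gen_def)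
qed

lemma ideal_gen_least: "\<lbrakk>two_sided_ideal A I; R \<subseteq> I\<rbrakk> \<Longrightarrow> ideal_gen A R \<subseteq> I"
  by (auto simp: ideal_gen_def)

text \<open>A generated ideal is the least one containing its generators, so this shows that a
  self-adjoint set generates an ideal closed under the involution.
  \<open>two_sided_ideal_hom_vimage\<close> plays the same role for homomorphisms.\<close>

lemma (in star_alg) two_sided_ideal_star_vimage:
  assumes "two_sided_ideal A I" shows "two_sided_ideal A {x \<in> carr A. star_op x \<in> I}"
  using assms by (simp add: two_sided_ideal_def)

lemma two_sided_ideal_hom_vimage:
  assumes A: "star_algebra A" and B: "star_algebra B" and f: "f \<in> star_hom A B"
    and I: "two_sided_ideal B I"
  shows "two_sided_ideal A {x \<in> carr A. f x \<in> I}"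
proof -
  interpret A: star_alg A using A by unfold_locales
  show ?thesis
    using I by (simp add: two_sided_ideal_def star_hom_zero[OF A B f] star_homD[OF f])
qed

locale star_ideal = star_alg +
  fixes I :: "'a set"
  assumes ideal: "two_sided_ideal A I"
    and star_ideal: "x \<in> I \<Longrightarrow> star_op x \<in> I"
begin

lemma ideal_closed:
  "x \<in> I \<Longrightarrow> x \<in> carr A" "\<zero> \<in> I"
  "\<lbrakk>x \<in> I; y \<in> I\<rbrakk> \<Longrightarrow> x \<oplus> y \<in> I" "x \<in> I \<Longrightarrow> c \<odot> x \<in> I"
  "\<lbrakk>a \<in> carr A; x \<in> I\<rbrakk> \<Longrightarrow> a \<otimes> x \<in> I" "\<lbrakk>a \<in> carr A; x \<in> I\<rbrakk> \<Longrightarrow> x \<otimes> a \<in> I"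
  using ideal unfolding two_sided_ideal_def by blast+

lemma coset_eq_iff:
  assumes x: "x \<in> carr A" and y: "y \<in> carr A"
  shows "coset A I x = coset A I y \<longleftrightarrow> x \<ominus> y \<in> I"
proof
  assume "coset A I x = coset A I y"
  moreover have "x \<in> coset A I x" unfolding coset_def using x ideal_closed(2) add_zero by force
  ultimately obtain i where i: "i \<in> I" "x = y \<oplus> i" by (auto simp: coset_def)
  then have "x \<ominus> y = i"
    using y ideal_closed(1)[OF i(1)] by (simp add: add_commute[of y i])
  then show "x \<ominus> y \<in> I" using i by simp
next
  have sub: "coset A I x \<subseteq> coset A I y"
    if x: "x \<in> carr A" and y: "y \<in> carr A" and d: "x \<ominus> y \<in> I" for x y
  proof
    fix z assume "z \<in> coset A I x"
    then obtain i where i: "i \<in> I" "z = x \<oplus> i" by (auto simp: coset_def)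
    have "z = y \<oplus> ((x \<ominus> y) \<oplus> i)"
      using x y ideal_closed(1)[OF i(1)]
      by (simp add: i(2) add_commute[of y] flip: add_assoc)
    then show "z \<in> coset A I y" using d i ideal_closed(3) by (auto simp: coset_def)
  qed
  assume d: "x \<ominus> y \<in> I"
  then have "y \<ominus> x \<in> I" using ideal_closed(4)[OF d, of "-1"] diff_swap[of x y] x y by simp
  then show "coset A I x = coset A I y" using sub x y d by blast
qed

lemma rep_coset:
  assumes x: "x \<in> carr A"
  shows "rep (coset A I x) \<in> carr A" "coset A I (rep (coset A I x)) = coset A I x"
    "rep (coset A I x) \<ominus> x \<in> I"
proof -
  have "x \<in> coset A I x" unfolding coset_def using x ideal_closed(2) add_zero by force
  then have "rep (coset A I x) \<in> coset A I x"
    unfolding rep_def by (rule someI[where P = "\<lambda>y. y \<in> coset A I x"])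
  then obtain i where i: "i \<in> I" "rep (coset A I x) = x \<oplus> i" by (auto simp: coset_def)
  then show c: "rep (coset A I x) \<in> carr A" using x ideal_closed(1) by simp
  have "x \<oplus> i \<ominus> x = i" using x ideal_closed(1)[OF i(1)] by (simp add: add_commute[of x])
  then show "rep (coset A I x) \<ominus> x \<in> I" using i by simp
  then show "coset A I (rep (coset A I x)) = coset A I x"
    using coset_eq_iff[OF c x] by simp
qed

lemma carr_quotient: "carr (quotient_alg A I) = coset A I ` carr A"
  by (simp add: quotient_alg_def)

lemma quotient_zero: "zeroA (quotient_alg A I) = coset A I \<zero>"
  by (simp add: quotient_alg_def)

lemma quotient_add:
  assumes x: "x \<in> carr A" and y: "y \<in> carr A"
  shows "addA (quotient_alg A I) (coset A I x) (coset A I y) = coset A I (x \<oplus> y)"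
proof -
  note rx = rep_coset[OF x] and ry = rep_coset[OF y]
  have "(rep (coset A I x) \<ominus> x) \<oplus> (rep (coset A I y) \<ominus> y) \<in> I"
    using rx ry x y by (simp add: ideal_closed)
  then show ?thesis
    using x y rx ry by (simp add: quotient_alg_def coset_eq_iff add_diff_add)
qed

lemma quotient_mult:
  assumes x: "x \<in> carr A" and y: "y \<in> carr A"
  shows "multA (quotient_alg A I) (coset A I x) (coset A I y) = coset A I (x \<otimes> y)"
proof -
  note rx = rep_coset[OF x] and ry = rep_coset[OF y]
  have "(rep (coset A I x) \<ominus> x) \<otimes> rep (coset A I y) \<oplus> x \<otimes> (rep (coset A I y) \<ominus> y) \<in> I"
    using rx ry x y by (simp add: ideal_closed)
  then show ?thesis
    using x y rx ry by (simp add: quotient_alg_def coset_eq_iff mult_diff_mult)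
qed

lemma quotient_scale:
  assumes x: "x \<in> carr A"
  shows "scaleA (quotient_alg A I) c (coset A I x) = coset A I (c \<odot> x)"
proof -
  note rx = rep_coset[OF x]
  have "c \<odot> (rep (coset A I x) \<ominus> x) \<in> I"
    using rx x by (simp add: ideal_closed)
  then show ?thesis
    using x rx by (simp add: quotient_alg_def coset_eq_iff scale_diff)
qed

lemma quotient_star:
  assumes x: "x \<in> carr A"
  shows "starA (quotient_alg A I) (coset A I x) = coset A I (star_op x)"
proof -
  note rx = rep_coset[OF x]
  have "star_op (rep (coset A I x) \<ominus> x) \<in> I"
    using rx by (simp add: star_ideal)
  then show ?thesis
    using x rx by (simp add: quotient_alg_def coset_eq_iff star_diff)
qed

lemmas quotient_ops = quotient_zero quotient_add quotient_mult quotient_scale quotient_star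

lemma star_algebra_quotient: "star_algebra (quotient_alg A I)"
  by (rule star_algebra_surj_image[OF star_algebra, of _ "coset A I"])
    (simp_all add: carr_quotient quotient_ops)

end

text \<open>The map on chosen representatives is well defined because h(x - y) lies in J whenever x
  - y lies in I.\<close>

lemma quotient_hom:
  assumes A: "star_ideal A I" and B: "star_ideal B J"
    and h: "h \<in> star_hom A B" and IJ: "\<And>x. x \<in> I \<Longrightarrow> h x \<in> J"
  obtains f where "f \<in> star_hom (quotient_alg A I) (quotient_alg B J)"
    "\<And>x. x \<in> carr A \<Longrightarrow> f (coset A I x) = coset B J (h x)"
proof -
  interpret A: star_ideal A I by (rule A)
  interpret B: star_ideal B J by (rule B)
  note hD = star_homD[OF h]
  define g where "g X = coset B J (h (rep X))" for X
  have g: "g (coset A I x) = coset B J (h x)" if x: "x \<in> carr A" for x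
  proof -
    note rx = A.rep_coset[OF x]
    have "h (rep (coset A I x)) \<in> carr B" "h x \<in> carr B" using rx x hD(1) by auto
    moreover have "h (A.diff_alg (rep (coset A I x)) x) \<in> J"
      using A.coset_eq_iff rx x by (intro IJ) blast
    ultimately show ?thesis
      using rx x by (simp add: g_def B.coset_eq_iff star_hom_diff[OF A.star_algebra h])
  qed
  have "restrict g (carr (quotient_alg A I)) \<in> star_hom (quotient_alg A I) (quotient_alg B J)"
    by (rule star_hom_restrictI[OF A.star_algebra_quotient])
      (auto simp: A.carr_quotient B.carr_quotient A.quotient_ops B.quotient_ops g hD)
  moreover have "restrict g (carr (quotient_alg A I)) (coset A I x) = coset B J (h x)"
    if "x \<in> carr A" for x
    using that g by (simp add: A.carr_quotient)
  ultimately show ?thesis using that by blast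
qed

section \<open>The contracted semigroup algebra\<close>

definition supp :: "('s \<Rightarrow> complex) \<Rightarrow> 's set" where "supp f = {s. f s \<noteq> 0}"

text \<open>
  \<open>ev \<kappa>\<close> is the linear functional with value \<open>\<kappa> s\<close> on the basis element of \<open>s\<close>.  Values of
  products, involutions and induced maps are all of this form, so identities of algebra elements
  reduce to identities of semigroup elements.
\<close>

definition ev :: "('s \<Rightarrow> complex) \<Rightarrow> ('s \<Rightarrow> complex) \<Rightarrow> complex" where
  "ev \<kappa> f = (\<Sum>s\<in>supp f. f s * \<kappa> s)"

definition conv :: "(('v, 'e) gis_elem \<Rightarrow> complex) \<Rightarrow> (('v, 'e) gis_elem \<Rightarrow> complex)
    \<Rightarrow> ('v, 'e) gis_elem \<Rightarrow> complex" where
  "conv f g r = (if r = Zero then 0 else ev (\<lambda>s. ev (\<lambda>t. of_bool (gis_mult s t = r)) g) f)"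

definition adj :: "(('v, 'e) gis_elem \<Rightarrow> complex) \<Rightarrow> ('v, 'e) gis_elem \<Rightarrow> complex" where
  "adj f s = cnj (f (gis_star s))"

text \<open>The linear extension of \<phi>; dropping the coefficient at \<open>Zero\<close>
  identifies the zero of the semigroup with that of the algebra.\<close>

definition push :: "(('v, 'e) gis_elem \<Rightarrow> ('w, 'f) gis_elem)
    \<Rightarrow> (('v, 'e) gis_elem \<Rightarrow> complex) \<Rightarrow> ('w, 'f) gis_elem \<Rightarrow> complex" where
  "push \<phi> f r = (if r = Zero then 0 else ev (\<lambda>s. of_bool (\<phi> s = r)) f)"

lemma contracted_alg_simps:
  "carr (contracted_alg E) = {f. finite (supp f) \<and> supp f \<subseteq> gis E - {Zero}}"
  "zeroA (contracted_alg E) = (\<lambda>_. 0)"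
  "addA (contracted_alg E) f g = (\<lambda>s. f s + g s)"
  "scaleA (contracted_alg E) c f = (\<lambda>s. c * f s)"
  "multA (contracted_alg E) f g = conv f g"
  "starA (contracted_alg E) f = adj f"
  by (auto simp: contracted_alg_def supp_def conv_def ev_def adj_def fun_eq_iff
      sum_distrib_left intro!: sum.cong)

lemma ev_superset: "\<lbrakk>finite S; supp f \<subseteq> S\<rbrakk> \<Longrightarrow> ev \<kappa> f = (\<Sum>s\<in>S. f s * \<kappa> s)"
  unfolding ev_def by (rule sum.mono_neutral_left) (auto simp: supp_def)

lemma ev_cong: "(\<And>s. s \<in> supp f \<Longrightarrow> \<kappa> s = \<psi> s) \<Longrightarrow> ev \<kappa> f = ev \<psi> f"
  unfolding ev_def by (rule sum.cong) auto

lemma supp_add: "supp (\<lambda>s. f s + g s) \<subseteq> supp f \<union> supp g"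
  by (auto simp: supp_def)

lemma supp_scale: "supp (\<lambda>s. c * f s) \<subseteq> supp f"
  by (auto simp: supp_def)

lemma ev_add:
  assumes "finite (supp f)" "finite (supp g)"
  shows "ev \<kappa> (\<lambda>s. f s + g s) = ev \<kappa> f + ev \<kappa> g"
proof -
  have "finite (supp f \<union> supp g)" using assms by simp
  then show ?thesis
    using supp_add[of f g]
    by (simp add: ev_superset[of "supp f \<union> supp g"] distrib_right sum.distrib)
qed

lemma ev_scale: "ev \<kappa> (\<lambda>s. c * f s) = c * ev \<kappa> f"
  by (cases "c = 0") (simp_all add: ev_def supp_def sum_distrib_left mult_ac)

lemma ev_const_mult: "ev (\<lambda>s. c * \<kappa> s) f = c * ev \<kappa> f"
  by (simp add: ev_def sum_distrib_left mult_ac)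

lemma ev_chi_add: "ev (\<lambda>s. \<kappa> s + \<psi> s) f = ev \<kappa> f + ev \<psi> f"
  by (simp add: ev_def distrib_left sum.distrib)

lemma ev_zero [simp]: "ev (\<lambda>_. 0) f = 0"
  by (simp add: ev_def)

lemma ev_swap: "ev (\<lambda>s. ev (\<lambda>t. X s t) g) f = ev (\<lambda>t. ev (\<lambda>s. X s t) f) g"
  unfolding ev_def sum_distrib_left by (subst sum.swap) (simp add: mult_ac)

text \<open>Interchange of finite sums: the functional of a product is the double sum of the values
  \<kappa>(st). The condition on \<kappa> matches the fact that \<open>conv\<close> discards
  products equal to \<open>Zero\<close>.\<close>

lemma ev_conv_aux:
  assumes "finite (supp f)" "finite (supp g)"
  shows "finite (supp (conv f g))" "\<kappa> Zero = 0 \<Longrightarrow>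
    ev \<kappa> (conv f g) = ev (\<lambda>s. ev (\<lambda>t. \<kappa> (gis_mult s t)) g) f"
    "supp (conv f g) \<subseteq> (\<lambda>(s, t). gis_mult s t) ` (supp f \<times> supp g) - {Zero}"
proof -
  let ?R = "(\<lambda>(s, t). gis_mult s t) ` (supp f \<times> supp g)"
  show sub: "supp (conv f g) \<subseteq> ?R - {Zero}"
  proof
    fix r assume r: "r \<in> supp (conv f g)"
    then have "r \<noteq> Zero" by (auto simp: supp_def conv_def)
    moreover have "r \<in> ?R"
    proof (rule ccontr)
      assume "r \<notin> ?R"
      then have "ev (\<lambda>s. ev (\<lambda>t. of_bool (gis_mult s t = r)) g) f = ev (\<lambda>_. 0) f"
        by (intro ev_cong trans[OF ev_cong ev_zero]) force
      then show False using r by (simp add: supp_def conv_def split: if_splits)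
    qed
    ultimately show "r \<in> ?R - {Zero}" by blast
  qed
  have fin: "finite ?R" using assms by simp
  with sub show "finite (supp (conv f g))" by (meson finite_Diff finite_subset)
  assume \<kappa>: "\<kappa> Zero = 0"
  have "ev \<kappa> (conv f g) = (\<Sum>r\<in>?R. conv f g r * \<kappa> r)"
    using sub fin by (intro ev_superset) auto
  also have "\<dots> = (\<Sum>r\<in>?R. \<Sum>s\<in>supp f. \<Sum>t\<in>supp g. f s * g t * (of_bool (gis_mult s t = r) * \<kappa> r))"
    using \<kappa> by (intro sum.cong refl) (auto simp: conv_def ev_def sum_distrib_left sum_distrib_right mult_ac)
  also have "\<dots> = (\<Sum>s\<in>supp f. \<Sum>t\<in>supp g. \<Sum>r\<in>?R. f s * g t * (of_bool (gis_mult s t = r) * \<kappa> r))"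
    by (rule trans[OF sum.swap sum.cong[OF refl sum.swap]])
  also have "\<dots> = (\<Sum>s\<in>supp f. \<Sum>t\<in>supp g. f s * g t * \<kappa> (gis_mult s t))"
  proof (intro sum.cong refl)
    fix s t assume "s \<in> supp f" "t \<in> supp g"
    then have "gis_mult s t \<in> ?R" by force
    then show "(\<Sum>r\<in>?R. f s * g t * (of_bool (gis_mult s t = r) * \<kappa> r)) = f s * g t * \<kappa> (gis_mult s t)"
      using fin sum.delta'[of ?R "gis_mult s t" \<kappa>]
      by (simp add: of_bool_def if_distrib[of "\<lambda>x. x * _"] cong: if_cong flip: sum_distrib_left)
  qed
  also have "\<dots> = ev (\<lambda>s. ev (\<lambda>t. \<kappa> (gis_mult s t)) g) f"
    by (simp add: ev_def sum_distrib_left mult_ac)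
  finally show "ev \<kappa> (conv f g) = ev (\<lambda>s. ev (\<lambda>t. \<kappa> (gis_mult s t)) g) f" .
qed

lemmas finite_supp_conv = ev_conv_aux(1) and ev_conv = ev_conv_aux(2)

lemma supp_adj: "supp (adj f) = gis_star ` supp f"
proof (intro equalityI subsetI)
  fix s assume "s \<in> supp (adj f)"
  then have "gis_star s \<in> supp f" by (simp add: supp_def adj_def)
  then show "s \<in> gis_star ` supp f" by (metis gis_star_star imageI)
qed (auto simp: supp_def adj_def)

lemma ev_adj: "ev \<kappa> (adj f) = cnj (ev (\<lambda>s. cnj (\<kappa> (gis_star s))) f)"
proof -
  have "inj_on gis_star (supp f)" by (metis inj_onI gis_star_star)
  then show ?thesis by (simp add: ev_def supp_adj sum.reindex adj_def)
qed

lemma ev_push_aux: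
  assumes "finite (supp f)"
  shows "finite (supp (push \<phi> f))" "\<kappa> Zero = 0 \<Longrightarrow> ev \<kappa> (push \<phi> f) = ev (\<lambda>s. \<kappa> (\<phi> s)) f"
    "supp (push \<phi> f) \<subseteq> \<phi> ` supp f - {Zero}"
proof -
  show sub: "supp (push \<phi> f) \<subseteq> \<phi> ` supp f - {Zero}"
  proof
    fix r assume r: "r \<in> supp (push \<phi> f)"
    then have "r \<noteq> Zero" by (auto simp: supp_def push_def)
    moreover have "r \<in> \<phi> ` supp f"
    proof (rule ccontr)
      assume "r \<notin> \<phi> ` supp f"
      then have "ev (\<lambda>s. of_bool (\<phi> s = r)) f = ev (\<lambda>_. 0) f" by (intro ev_cong) force
      then show False using r by (simp add: supp_def push_def split: if_splits)
    qed
    ultimately show "r \<in> \<phi> ` supp f - {Zero}" by blast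
  qed
  have fin: "finite (\<phi> ` supp f)" using assms by simp
  with sub show "finite (supp (push \<phi> f))" by (meson finite_Diff finite_subset)
  assume \<kappa>: "\<kappa> Zero = 0"
  have "ev \<kappa> (push \<phi> f) = (\<Sum>r\<in>\<phi> ` supp f. push \<phi> f r * \<kappa> r)"
    using sub fin by (intro ev_superset) auto
  also have "\<dots> = (\<Sum>r\<in>\<phi> ` supp f. \<Sum>s\<in>supp f. f s * (of_bool (\<phi> s = r) * \<kappa> r))"
    using \<kappa> by (intro sum.cong refl) (auto simp: push_def ev_def sum_distrib_left sum_distrib_right mult_ac)
  also have "\<dots> = (\<Sum>s\<in>supp f. f s * (\<Sum>r\<in>\<phi> ` supp f. of_bool (\<phi> s = r) * \<kappa> r))"
    by (subst sum.swap) (simp add: sum_distrib_left)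
  also have "\<dots> = (\<Sum>s\<in>supp f. f s * \<kappa> (\<phi> s))"
    using fin by (intro sum.cong refl arg_cong2[of _ _ _ _ "(*)"])
      (simp add: of_bool_def if_distrib[of "\<lambda>x. x * _"] cong: if_cong)
  finally show "ev \<kappa> (push \<phi> f) = ev (\<lambda>s. \<kappa> (\<phi> s)) f" by (simp add: ev_def)
qed

lemmas ev_push = ev_push_aux(2)

text \<open>The coefficient at r \<noteq> Zero is a functional built from the indicator of r, which
  vanishes at \<open>Zero\<close>; so \<open>ev_conv\<close> applies, and only associativity of the
  semigroup remains.\<close>

lemma conv_assoc:
  assumes "finite (supp f)" "finite (supp g)" "finite (supp h)"
  shows "conv (conv f g) h = conv f (conv g h)"
proof
  fix r :: "('a, 'b) gis_elem"
  show "conv (conv f g) h r = conv f (conv g h) r"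
  proof (cases "r = Zero")
    case False
    then show ?thesis
      unfolding conv_def[of "conv f g"] conv_def[of f "conv g h"]
      by (simp add: ev_conv[OF assms(1,2)] ev_conv[OF assms(2,3)] gis_mult_assoc)
  qed (simp add: conv_def)
qed

lemma adj_conv: "adj (conv f g) = conv (adj g) (adj f)"
proof
  fix r :: "('a, 'b) gis_elem"
  have "gis_mult s t = gis_star r \<longleftrightarrow> gis_mult (gis_star t) (gis_star s) = r"
    for s t :: "('a, 'b) gis_elem"
    by (metis gis_star_mult gis_star_star)
  moreover have "cnj (of_bool b) = of_bool b" for b by (cases b) auto
  ultimately show "adj (conv f g) r = conv (adj g) (adj f) r"
    by (simp add: adj_def[of "conv f g"] conv_def ev_adj ev_swap[of _ g])
qed

lemma star_algebra_contracted:
  assumes "wf_digraph E" shows "star_algebra (contracted_alg E)"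
proof -
  interpret wf_digraph E by (rule assms)
  have conv_closed: "conv f g \<in> carr (contracted_alg E)"
    if "f \<in> carr (contracted_alg E)" "g \<in> carr (contracted_alg E)" for f g
    using that ev_conv_aux(3)[of f g] finite_supp_conv[of f g]
    by (auto simp: contracted_alg_simps(1) dest!: subsetD)
  have adj_closed: "adj f \<in> carr (contracted_alg E)" if "f \<in> carr (contracted_alg E)" for f
    using that by (auto simp: contracted_alg_simps(1) supp_adj)
  have add_closed: "(\<lambda>s. f s + g s) \<in> carr (contracted_alg E)"
    if "f \<in> carr (contracted_alg E)" "g \<in> carr (contracted_alg E)" for f g
    using that supp_add[of f g] by (auto simp: contracted_alg_simps(1) intro: finite_subset)
  have scale_closed: "(\<lambda>s. c * f s) \<in> carr (contracted_alg E)"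
    if "f \<in> carr (contracted_alg E)" for f c
    using that supp_scale[of c f] by (auto simp: contracted_alg_simps(1) intro: finite_subset)
  have zero_closed: "(\<lambda>_. 0) \<in> carr (contracted_alg E)"
    by (simp add: contracted_alg_simps(1) supp_def)
  have fin: "finite (supp f)" if "f \<in> carr (contracted_alg E)" for f
    using that by (simp add: contracted_alg_simps(1))
  show ?thesis
    unfolding star_algebra_def diffA_def contracted_alg_simps(2-)
    by (intro conjI ballI allI)
      (simp_all add: conv_closed adj_closed add_closed scale_closed zero_closed conv_assoc fin
        adj_conv fun_eq_iff conv_def ev_add ev_scale ev_chi_add ev_const_mult adj_def algebra_simps)
qed

lemma supp_basis: "supp (basis_elem t) = (if t = Zero then {} else {t})"
  by (auto simp: supp_def basis_elem_def)

lemma finite_supp_basis [simp]: "finite (supp (basis_elem t))"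
  by (simp add: supp_basis)

lemma ev_basis: "\<kappa> Zero = 0 \<Longrightarrow> ev \<kappa> (basis_elem t) = \<kappa> t"
  by (cases "t = Zero") (simp_all add: ev_def supp_basis, simp add: basis_elem_def)

lemma basis_carr [simp]: "t \<in> gis E \<Longrightarrow> basis_elem t \<in> carr (contracted_alg E)"
  by (simp add: contracted_alg_simps(1) supp_basis)

lemma conv_basis: "conv (basis_elem s) (basis_elem t) = basis_elem (gis_mult s t)"
  by (rule ext) (simp add: conv_def ev_basis, auto simp: basis_elem_def)

lemma adj_basis: "adj (basis_elem t) = basis_elem (gis_star t)"
  by (rule ext) (auto simp: adj_def basis_elem_def)

lemma push_basis: "\<phi> Zero = Zero \<Longrightarrow> push \<phi> (basis_elem t) = basis_elem (\<phi> t)"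
  by (rule ext) (simp add: push_def ev_basis, auto simp: basis_elem_def)

lemma contracted_induct [consumes 1, case_names zero add]:
  assumes "f \<in> carr (contracted_alg E)"
    and zero: "P (\<lambda>_. 0)"
    and add: "\<And>c t f. \<lbrakk>t \<in> gis E; t \<noteq> Zero; f \<in> carr (contracted_alg E); P f\<rbrakk>
      \<Longrightarrow> P (\<lambda>s. c * basis_elem t s + f s)"
  shows "P f"
proof -
  have "finite S \<Longrightarrow> supp f = S \<Longrightarrow> S \<subseteq> gis E - {Zero} \<Longrightarrow> P f" for S
  proof (induction S arbitrary: f rule: finite_induct)
    case empty
    then have "f = (\<lambda>_. 0)" by (auto simp: supp_def)
    then show ?case using zero by simp
  next
    case (insert t S)
    define g where "g = f(t := 0)"
    have g: "supp g = S" using insert.hyps(2) insert.prems(1) by (auto simp: g_def supp_def)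
    then have "P g" using insert by simp
    moreover have "f = (\<lambda>s. f t * basis_elem t s + g s)"
      using insert.prems by (auto simp: g_def basis_elem_def)
    moreover have "g \<in> carr (contracted_alg E)"
      using g insert by (simp add: contracted_alg_simps(1))
    ultimately show ?case using add[of t g "f t"] insert.prems by force
  qed
  from this[of "supp f"] show ?thesis using assms(1) by (simp add: contracted_alg_simps(1))
qed

section \<open>Leavitt path algebras\<close>

text \<open>The common form of the Leavitt relations, their conjugates and their images under
  homomorphisms. A family g is used instead of a set of values because several indices may be sent
  to \<open>Zero\<close>.\<close>

definition defect :: "('v, 'e) gis_elem \<Rightarrow> ('i \<Rightarrow> ('v, 'e) gis_elem) \<Rightarrow> 'i set
    \<Rightarrow> ('v, 'e) gis_elem \<Rightarrow> complex" where
  "defect t g J = (\<lambda>s. basis_elem t s - (\<Sum>j\<in>J. basis_elem (g j) s))"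

lemma supp_defect:
  assumes "finite J"
  shows "finite (supp (defect t g J))" "supp (defect t g J) \<subseteq> insert t (g ` J) - {Zero}"
proof -
  show "supp (defect t g J) \<subseteq> insert t (g ` J) - {Zero}"
  proof
    fix s assume "s \<in> supp (defect t g J)"
    then have "basis_elem t s \<noteq> 0 \<or> (\<exists>j\<in>J. basis_elem (g j) s \<noteq> 0)"
      by (auto simp: supp_def defect_def intro: ccontr)
    then show "s \<in> insert t (g ` J) - {Zero}" by (auto simp: basis_elem_def split: if_splits)
  qed
  then show "finite (supp (defect t g J))" using assms by (meson finite_Diff finite_imageI finite_insert finite_subset)
qed

lemma ev_defect:
  assumes "finite J" "\<kappa> Zero = 0"
  shows "ev \<kappa> (defect t g J) = \<kappa> t - (\<Sum>j\<in>J. \<kappa> (g j))"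
  using assms(1)
proof (induction J rule: finite_induct)
  case empty
  then show ?case using assms(2) by (simp add: defect_def ev_basis)
next
  case (insert j J)
  have "defect t g (insert j J) = (\<lambda>s. defect t g J s + (-1) * basis_elem (g j) s)"
    using insert by (auto simp: defect_def)
  moreover have "finite (supp (\<lambda>s. (-1) * basis_elem (g j) s))"
    by (rule finite_subset[OF supp_scale]) simp
  ultimately have "ev \<kappa> (defect t g (insert j J)) = ev \<kappa> (defect t g J) + (-1) * \<kappa> (g j)"
    using insert assms(2) by (simp only: ev_add supp_defect ev_scale ev_basis)
  then show ?case using insert by simp
qed

lemma push_defect:
  assumes "finite J" "\<phi> Zero = Zero"
  shows "push \<phi> (defect t g J) = defect (\<phi> t) (\<lambda>j. \<phi> (g j)) J"
proof
  fix r
  show "push \<phi> (defect t g J) r = defect (\<phi> t) (\<lambda>j. \<phi> (g j)) J r"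
  proof -
    have b: "basis_elem s r = (if r = Zero then 0 else of_bool (s = r))" for s
      by (auto simp: basis_elem_def)
    have "push \<phi> (defect t g J) r
        = (if r = Zero then 0 else of_bool (\<phi> t = r) - (\<Sum>j\<in>J. of_bool (\<phi> (g j) = r)))"
      using assms by (simp add: push_def ev_defect)
    then show ?thesis by (simp add: defect_def b)
  qed
qed

text \<open>One-sided multiplication by a semigroup element is itself a \<open>push\<close>, along a
  translation that fixes \<open>Zero\<close>; hence \<open>push_defect\<close> also computes
  conjugates of relations.\<close>

lemma conv_basis_left: "conv (basis_elem a) f = push (gis_mult a) f"
  by (rule ext) (simp add: conv_def push_def ev_basis)

lemma conv_basis_right: "conv f (basis_elem a) = push (\<lambda>s. gis_mult s a) f"
  by (rule ext) (simp add: conv_def push_def ev_basis)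

lemma adj_defect: "adj (defect t g J) = defect (gis_star t) (\<lambda>j. gis_star (g j)) J"
  by (rule ext) (simp add: defect_def adj_def fun_cong[OF adj_basis, unfolded adj_def, symmetric])

lemma defect_carr:
  "\<lbrakk>finite J; t \<in> gis E; \<And>j. j \<in> J \<Longrightarrow> g j \<in> gis E\<rbrakk> \<Longrightarrow> defect t g J \<in> carr (contracted_alg E)"
  using supp_defect[of J t g] by (auto simp: contracted_alg_simps(1))

text \<open>The product of S_e and its adjoint is the basis element of the idempotent (e, e), so
  every relation is a self-adjoint combination of idempotents.\<close>

lemma leavitt_relation_eq:
  "leavitt_relation E u = defect (vertex_elem u) (\<lambda>e. idem (edge_path E e)) (out_arcs E u)"
  by (simp add: leavitt_relation_def defect_def contracted_alg_simps conv_basis edge_elem_def)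

section \<open>The Leavitt ideal along paths and covers, and bounds for C*-seminorms\<close>

context wf_digraph begin

lemma vertex_elem_gis [simp]: "u \<in> verts G \<Longrightarrow> vertex_elem u \<in> gis G"
  by (simp add: vertex_elem_def)

lemma reg_vertsD: "u \<in> reg_verts G \<Longrightarrow> u \<in> verts G \<and> finite (out_arcs G u)"
  by (simp add: reg_verts_def)

lemma leavitt_relation_carr: "leavitt_relation G ` reg_verts G \<subseteq> carr (contracted_alg G)"
  by (auto simp: leavitt_relation_eq dest: reg_vertsD intro!: defect_carr)

lemma star_ideal_leavitt: "star_ideal (contracted_alg G) (leavitt_ideal G)"
proof -
  interpret star_alg "contracted_alg G"
    using star_algebra_contracted wf_digraph by unfold_locales
  note I = two_sided_ideal_gen[OF leavitt_relation_carr, folded leavitt_ideal_def]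
  have "leavitt_ideal G \<subseteq> {x \<in> carr (contracted_alg G). starA (contracted_alg G) x \<in> leavitt_ideal G}"
    unfolding leavitt_ideal_def[of G]
    by (rule ideal_gen_least[OF two_sided_ideal_star_vimage], fold leavitt_ideal_def)
      (use I leavitt_relation_carr in \<open>auto simp: contracted_alg_simps(6) leavitt_relation_eq
        adj_defect vertex_elem_def\<close>)
  then show ?thesis using I by unfold_locales auto
qed

sublocale leavitt: star_ideal "contracted_alg G" "leavitt_ideal G"
  by (rule star_ideal_leavitt)

lemma star_algebra_leavitt: "star_algebra (leavitt G)"
  unfolding leavitt_def by (rule leavitt.star_algebra_quotient)

lemma leavitt_relation_ideal: "u \<in> reg_verts G \<Longrightarrow> leavitt_relation G u \<in> leavitt_ideal G"
  using leavitt.two_sided_ideal_gen(2)[OF leavitt_relation_carr] by (auto simp: leavitt_ideal_def)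

lemma leavitt_ideal_sum:
  assumes "finite J" "\<And>j. j \<in> J \<Longrightarrow> f j \<in> leavitt_ideal G"
  shows "(\<lambda>s. \<Sum>j\<in>J. f j s) \<in> leavitt_ideal G"
  using assms
proof (induction J rule: finite_induct)
  case empty
  then show ?case using leavitt.ideal_closed(2) by (simp add: contracted_alg_simps)
next
  case (insert j J)
  then show ?case
    using leavitt.ideal_closed(3)[of "f j" "\<lambda>s. \<Sum>j\<in>J. f j s"] by (simp add: contracted_alg_simps)
qed

lemma path_prefix_append_edges_self [simp]: "path_prefix (append_edges \<alpha> p) \<alpha> \<longleftrightarrow> p = []"
  using path_prefix_append_edges(1)[of \<alpha> p "[]"] by simp

text \<open>This is the relation at the vertex v reached by \<alpha>, multiplied by (\<alpha>, v) on
  the left and by (v, \<alpha>) on the right.\<close>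

lemma edge_relation_at_path:
  assumes "\<alpha> \<in> fin_paths G" "path_target G \<alpha> \<in> reg_verts G"
  shows "defect (idem \<alpha>) (\<lambda>e. idem (append_edges \<alpha> [e])) (out_arcs G (path_target G \<alpha>))
    \<in> leavitt_ideal G"
proof -
  let ?v = "path_target G \<alpha>"
  let ?\<nu> = "vertex_path ?v"
  have v: "?v \<in> verts G" "finite (out_arcs G ?v)" using reg_vertsD[OF assms(2)] by auto
  have "conv (basis_elem (Pr \<alpha> ?\<nu>)) (conv (leavitt_relation G ?v) (basis_elem (Pr ?\<nu> \<alpha>)))
    \<in> leavitt_ideal G"
    using leavitt.ideal_closed(5,6) leavitt_relation_ideal[OF assms(2)] assms(1) v
    by (simp add: contracted_alg_simps(5))
  also have "conv (basis_elem (Pr \<alpha> ?\<nu>)) (conv (leavitt_relation G ?v) (basis_elem (Pr ?\<nu> \<alpha>)))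
    = defect (idem \<alpha>) (\<lambda>e. gis_mult (Pr \<alpha> ?\<nu>) (gis_mult (idem (edge_path G e)) (Pr ?\<nu> \<alpha>)))
        (out_arcs G ?v)"
    using v by (simp add: leavitt_relation_eq conv_basis_left conv_basis_right push_defect vertex_elem_def)
  also have "\<dots> = defect (idem \<alpha>) (\<lambda>e. idem (append_edges \<alpha> [e])) (out_arcs G ?v)"
    by (auto simp: defect_def edge_path_append intro!: sum.cong)
  finally show ?thesis .
qed

text \<open>Telescoping: in the edge relation at \<alpha> plus the defects of the covers of all
  \<alpha>e, every (\<alpha>e, \<alpha>e) cancels. The antichain condition enters where the cover
  contains [], since then it is {[]} and its defect is 0.\<close>

lemma covers_defect:
  assumes "covers \<alpha> \<Gamma>" "\<alpha> \<in> fin_paths G"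
    and "\<And>\<gamma> \<gamma>'. \<lbrakk>\<gamma> \<in> \<Gamma>; \<gamma>' \<in> \<Gamma>; prefix \<gamma> \<gamma>'\<rbrakk> \<Longrightarrow> \<gamma> = \<gamma>'"
  shows "defect (idem \<alpha>) (\<lambda>\<gamma>. idem (append_edges \<alpha> \<gamma>)) \<Gamma> \<in> leavitt_ideal G"
  using assms
proof (induction rule: covers_induct)
  case (Nil \<alpha> \<Gamma>)
  have "\<gamma> = []" if "\<gamma> \<in> \<Gamma>" for \<gamma>
    using Nil.prems[of "[]" \<gamma>] Nil.hyps(3) that by simp
  with Nil.hyps(3) have "\<Gamma> = {[]}" by auto
  then have "defect (idem \<alpha>) (\<lambda>\<gamma>. idem (append_edges \<alpha> \<gamma>)) \<Gamma> = zeroA (contracted_alg G)"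
    by (simp add: defect_def contracted_alg_simps)
  then show ?case using leavitt.ideal_closed(2) by simp
next
  case (step \<alpha> \<Gamma>)
  let ?O = "out_arcs G (path_target G \<alpha>)" and ?\<Gamma> = "\<lambda>e. {\<gamma>. e # \<gamma> \<in> \<Gamma>}"
  let ?b = "\<lambda>\<gamma>. basis_elem (idem (append_edges \<alpha> \<gamma>))"
  have O: "finite ?O" using step.hyps(4) reg_vertsD by blast
  have \<Gamma>: "finite \<Gamma>" using step.hyps(1) by (simp add: covers_def)
  have \<Gamma>e: "finite (?\<Gamma> e)" for e using finite_vimageI[OF \<Gamma>, of "(#) e"] by (simp add: vimage_def)
  have "defect (idem (append_edges \<alpha> [e])) (\<lambda>\<gamma>. idem (append_edges (append_edges \<alpha> [e]) \<gamma>)) (?\<Gamma> e)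
      \<in> leavitt_ideal G" if "e \<in> ?O" for e
  proof -
    have "\<gamma> = \<gamma>'" if "\<gamma> \<in> ?\<Gamma> e" "\<gamma>' \<in> ?\<Gamma> e" "prefix \<gamma> \<gamma>'" for \<gamma> \<gamma>'
      using step.prems[of "e # \<gamma>" "e # \<gamma>'"] that by simp
    then show ?thesis using step.IH[OF that] by blast
  qed
  then have "(\<lambda>s. \<Sum>e\<in>?O. defect (idem (append_edges \<alpha> [e]))
      (\<lambda>\<gamma>. idem (append_edges (append_edges \<alpha> [e]) \<gamma>)) (?\<Gamma> e) s) \<in> leavitt_ideal G"
    using O by (intro leavitt_ideal_sum)
  from leavitt.ideal_closed(3)[OF edge_relation_at_path[OF step.hyps(2,4)] this]
  have "(\<lambda>s. defect (idem \<alpha>) (\<lambda>e. idem (append_edges \<alpha> [e])) ?O s +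
      (\<Sum>e\<in>?O. ?b [e] s - (\<Sum>\<gamma>\<in>?\<Gamma> e. ?b (e # \<gamma>) s))) \<in> leavitt_ideal G"
    by (simp add: contracted_alg_simps(3) defect_def)
  moreover have "(\<Sum>\<gamma>\<in>\<Gamma>. ?b \<gamma> s) = (\<Sum>e\<in>?O. \<Sum>\<gamma>\<in>?\<Gamma> e. ?b (e # \<gamma>) s)" for s
  proof -
    have "(\<Sum>\<gamma>\<in>\<Gamma>. ?b \<gamma> s) = (\<Sum>\<gamma>\<in>(\<Union>e\<in>?O. (#) e ` ?\<Gamma> e). ?b \<gamma> s)"
      using step.hyps(5) by (rule arg_cong)
    also have "\<dots> = (\<Sum>e\<in>?O. \<Sum>\<gamma>\<in>(#) e ` ?\<Gamma> e. ?b \<gamma> s)"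
      using O \<Gamma>e by (intro sum.UNION_disjoint) auto
    also have "\<dots> = (\<Sum>e\<in>?O. \<Sum>\<gamma>\<in>?\<Gamma> e. ?b (e # \<gamma>) s)"
      by (simp add: sum.reindex)
    finally show ?thesis .
  qed
  then have "(\<lambda>s. defect (idem \<alpha>) (\<lambda>e. idem (append_edges \<alpha> [e])) ?O s +
      (\<Sum>e\<in>?O. ?b [e] s - (\<Sum>\<gamma>\<in>?\<Gamma> e. ?b (e # \<gamma>) s)))
    = defect (idem \<alpha>) (\<lambda>\<gamma>. idem (append_edges \<alpha> \<gamma>)) \<Gamma>"
    by (simp add: defect_def sum_subtractf)
  ultimately show ?case by simp
qed

lemma leavitt_gen_ops:
  assumes "s \<in> gis G" "t \<in> gis G"
  shows "leavitt_gen G s \<in> carr (leavitt G)"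
    "multA (leavitt G) (leavitt_gen G s) (leavitt_gen G t) = leavitt_gen G (gis_mult s t)"
    "starA (leavitt G) (leavitt_gen G s) = leavitt_gen G (gis_star s)"
  using assms
  by (simp_all add: leavitt_gen_def leavitt_def leavitt.carr_quotient leavitt.quotient_ops)
    (simp_all add: contracted_alg_simps conv_basis adj_basis)

lemma leavitt_induct [consumes 1, case_names zero add]:
  assumes "x \<in> carr (leavitt G)" and "P (zeroA (leavitt G))"
    and add: "\<And>c t x. \<lbrakk>t \<in> gis G; x \<in> carr (leavitt G); P x\<rbrakk>
      \<Longrightarrow> P (addA (leavitt G) (scaleA (leavitt G) c (leavitt_gen G t)) x)"
  shows "P x"
proof -
  obtain f where "f \<in> carr (contracted_alg G)" "x = coset (contracted_alg G) (leavitt_ideal G) f"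
    using assms(1) by (auto simp: leavitt_def leavitt.carr_quotient)
  moreover have "f \<in> carr (contracted_alg G) \<Longrightarrow> P (coset (contracted_alg G) (leavitt_ideal G) f)"
  proof (induction rule: contracted_induct)
    case zero
    then show ?case using assms(2) by (simp add: leavitt_def leavitt.quotient_zero contracted_alg_simps)
  next
    case (add c t f)
    have "addA (leavitt G) (scaleA (leavitt G) c (leavitt_gen G t))
        (coset (contracted_alg G) (leavitt_ideal G) f)
      = coset (contracted_alg G) (leavitt_ideal G)
          (leavitt.add_alg (leavitt.scale_alg c (basis_elem t)) f)"
      using add by (simp add: leavitt_gen_def leavitt_def leavitt.quotient_ops)
    then show ?case
      using assms(3)[of t "coset (contracted_alg G) (leavitt_ideal G) f" c] add
      by (simp add: contracted_alg_simps(3,4) leavitt_def leavitt.carr_quotient)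
  qed
  ultimately show ?thesis by simp
qed

text \<open>For the self-adjoint idempotent e = star t t the C*-identity reads p(e)^2 = p(e), so
  p(e) \<le> 1; for t itself it reads p(t)^2 = p(e).\<close>

lemma leavitt_gen_seminorm_le_one:
  assumes p: "cstar_seminorm (leavitt G) p" and t: "t \<in> gis G"
  shows "p (leavitt_gen G t) \<le> 1"
proof -
  interpret seminormed_star_alg "leavitt G" p
    using p star_algebra_leavitt by unfold_locales
  let ?e = "gis_mult (gis_star t) t"
  have e: "?e \<in> gis G" "gis_star ?e = ?e" "gis_mult ?e ?e = ?e"
    using t by (auto simp: gis_star_mult) (metis gis_mult_assoc gis_star_inverse)
  have "(p (leavitt_gen G ?e))\<^sup>2 = p (leavitt_gen G ?e)"
    using cstar_identity[of "leavitt_gen G ?e"] e by (simp add: leavitt_gen_ops)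
  then have "p (leavitt_gen G ?e) \<le> 1" by (auto simp: power2_eq_square)
  moreover have "(p (leavitt_gen G t))\<^sup>2 = p (leavitt_gen G ?e)"
    using cstar_identity[of "leavitt_gen G t"] t by (simp add: leavitt_gen_ops)
  ultimately show ?thesis using abs_square_le_1[of "p (leavitt_gen G t)"] by simp
qed

lemma bounded_star_alg_leavitt: "bounded_star_alg (leavitt G)"
proof
  show "star_algebra (leavitt G)" by (rule star_algebra_leavitt)
  fix x assume "x \<in> carr (leavitt G)"
  then show "\<exists>M. \<forall>q. cstar_seminorm (leavitt G) q \<longrightarrow> q x \<le> M"
  proof (induction rule: leavitt_induct)
    case zero
    have "q (zeroA (leavitt G)) \<le> 0" if "cstar_seminorm (leavitt G) q" for q
    proof -
      interpret seminormed_star_alg "leavitt G" q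
        using that star_algebra_leavitt by unfold_locales
      show ?thesis by simp
    qed
    then show ?case by blast
  next
    case (add c t x)
    then obtain M where M: "\<And>q. cstar_seminorm (leavitt G) q \<Longrightarrow> q x \<le> M" by blast
    have "q (addA (leavitt G) (scaleA (leavitt G) c (leavitt_gen G t)) x) \<le> cmod c * 1 + M"
      if q: "cstar_seminorm (leavitt G) q" for q
    proof -
      interpret seminormed_star_alg "leavitt G" q
        using q star_algebra_leavitt by unfold_locales
      have "q (addA (leavitt G) (scaleA (leavitt G) c (leavitt_gen G t)) x)
        \<le> cmod c * q (leavitt_gen G t) + q x"
        using seminorm_add[of "scaleA (leavitt G) c (leavitt_gen G t)" x] add leavitt_gen_ops(1)[of t]
        by simp
      moreover have "cmod c * q (leavitt_gen G t) \<le> cmod c * 1"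
        using leavitt_gen_seminorm_le_one[OF q add(1)] by (intro mult_left_mono) auto
      ultimately show ?thesis using M[OF q] by linarith
    qed
    then show ?case by blast
  qed
qed

lemma universal_enveloping_graph_cstar:
  "universal_enveloping TYPE('c) (leavitt G) (graph_cstar G) (graph_cstar_incl G)"
  unfolding graph_cstar_def graph_cstar_incl_def
  by (rule bounded_star_alg.universal_enveloping_completion[OF bounded_star_alg_leavitt])

end

section \<open>Regular extended path homomorphisms\<close>

lemma ext_path_homD:
  assumes "\<phi> \<in> ext_path_hom E F"
  shows "\<phi> Zero = Zero" "s \<in> gis E \<Longrightarrow> \<phi> s \<in> gis F"
    "\<lbrakk>s \<in> gis E; t \<in> gis E\<rbrakk> \<Longrightarrow> \<phi> (gis_mult s t) = gis_mult (\<phi> s) (\<phi> t)"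
  using assms unfolding ext_path_hom_def by blast+

text \<open>Applying \<phi> to the two equations between s and \<open>gis_star s\<close> shows that
  the image of \<open>gis_star s\<close> is an inverse of \<phi> s, and inverses are unique.\<close>

lemma ext_path_hom_star:
  assumes "wf_digraph E" "\<phi> \<in> ext_path_hom E F" "s \<in> gis E"
  shows "\<phi> (gis_star s) = gis_star (\<phi> s)"
proof (rule gis_star_unique)
  interpret wf_digraph E by (rule assms(1))
  note mult = ext_path_homD(3)[OF assms(2), symmetric]
  show "gis_mult (gis_mult (\<phi> s) (\<phi> (gis_star s))) (\<phi> s) = \<phi> s"
    using assms(3) by (simp add: mult)
  show "gis_mult (gis_mult (\<phi> (gis_star s)) (\<phi> s)) (\<phi> (gis_star s)) = \<phi> (gis_star s)"
    using assms(3) gis_star_inverse[of "gis_star s"] by (simp add: mult del: gis_star_inverse)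
qed

lemma ext_path_hom_idem:
  assumes "wf_digraph E" "\<phi> \<in> ext_path_hom E F" "idem \<alpha> \<in> gis E"
  shows "gis_mult (\<phi> (idem \<alpha>)) (\<phi> (idem \<alpha>)) = \<phi> (idem \<alpha>)"
  using ext_path_homD(3)[OF assms(2,3,3)] by simp

lemma vertex_elem_mult_edge:
  "tail E e = u \<Longrightarrow> gis_mult (idem (edge_path E e)) (vertex_elem u) = idem (edge_path E e)"
  "tail E e = u \<Longrightarrow> gis_mult (vertex_elem u) (idem (edge_path E e)) = idem (edge_path E e)"
  by (auto simp: vertex_elem_def edge_path_def vertex_path_def path_prefix_def extend_by_def)

lemma (in wf_digraph) edge_idem_gis [simp]: "e \<in> arcs G \<Longrightarrow> idem (edge_path G e) \<in> gis G"
  by simp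

text \<open>The image of (u, u) is idempotent, so the nonzero elements below it are the idempotents
  (\<tau>, \<tau>) that it absorbs. This turns the order condition into one about paths.\<close>

lemma reg_hom_iff:
  assumes E: "wf_digraph E"
  shows "\<phi> \<in> reg_hom E F \<longleftrightarrow> \<phi> \<in> ext_path_hom E F \<and>
    (\<forall>u\<in>reg_verts E. \<forall>\<tau>. idem \<tau> \<in> gis F \<longrightarrow> gis_mult (idem \<tau>) (\<phi> (vertex_elem u)) = idem \<tau> \<longrightarrow>
      (\<exists>e\<in>out_arcs E u. gis_mult (idem \<tau>) (\<phi> (idem (edge_path E e))) \<noteq> Zero))"
    (is "_ \<longleftrightarrow> _ \<and> ?R")
proof -
  interpret wf_digraph E by (rule E)
  have le: "t \<noteq> Zero \<and> gis_le t (\<phi> (vertex_elem u)) \<longleftrightarrow>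
      (\<exists>\<tau>. t = idem \<tau> \<and> gis_mult (idem \<tau>) (\<phi> (vertex_elem u)) = idem \<tau>)"
    if \<phi>: "\<phi> \<in> ext_path_hom E F" and u: "u \<in> reg_verts E" for t u
  proof -
    have "vertex_elem u \<in> gis E" using reg_vertsD[OF u] by simp
    then have "gis_mult (\<phi> (vertex_elem u)) (\<phi> (vertex_elem u)) = \<phi> (vertex_elem u)"
      using ext_path_hom_idem[OF E \<phi>] by (simp add: vertex_elem_def)
    then have "gis_le t (\<phi> (vertex_elem u)) \<longleftrightarrow> gis_mult t t = t \<and> gis_mult t (\<phi> (vertex_elem u)) = t"
      by (rule gis_le_idempotent)
    then show ?thesis using gis_idempotent[of t] by fastforce
  qed
  have "(\<forall>u\<in>reg_verts E. \<forall>t\<in>gis F. t \<noteq> Zero \<and> gis_le t (\<phi> (vertex_elem u)) \<longrightarrow>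
      (\<exists>e\<in>out_arcs E u. gis_mult t (\<phi> (idem (edge_path E e))) \<noteq> Zero)) \<longleftrightarrow> ?R"
    if "\<phi> \<in> ext_path_hom E F"
  proof (rule ball_cong[OF refl])
    fix u assume u: "u \<in> reg_verts E"
    show "(\<forall>t\<in>gis F. t \<noteq> Zero \<and> gis_le t (\<phi> (vertex_elem u)) \<longrightarrow>
        (\<exists>e\<in>out_arcs E u. gis_mult t (\<phi> (idem (edge_path E e))) \<noteq> Zero)) \<longleftrightarrow>
      (\<forall>\<tau>. idem \<tau> \<in> gis F \<longrightarrow> gis_mult (idem \<tau>) (\<phi> (vertex_elem u)) = idem \<tau> \<longrightarrow>
        (\<exists>e\<in>out_arcs E u. gis_mult (idem \<tau>) (\<phi> (idem (edge_path E e))) \<noteq> Zero))"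
      unfolding le[OF that u] by blast
  qed
  then show ?thesis unfolding reg_hom_def vertex_elem_def mem_Collect_eq by (rule conj_cong[OF refl])
qed

section \<open>Images of regular vertices and the maps induced on the algebras\<close>

locale regular_hom = E: wf_digraph E + F: wf_digraph F
  for E :: "('v, 'e) pre_digraph" and F :: "('w, 'f) pre_digraph" +
  fixes \<phi> :: "('v, 'e) gis_elem \<Rightarrow> ('w, 'f) gis_elem"
  assumes reg: "\<phi> \<in> reg_hom E F"
begin

lemma ext: "\<phi> \<in> ext_path_hom E F"
  using reg by (simp add: reg_hom_def)

lemmas hom_zero [simp] = ext_path_homD(1)[OF ext]
  and hom_closed [simp] = ext_path_homD(2)[OF ext]
  and hom_mult = ext_path_homD(3)[OF ext]
  and hom_star = ext_path_hom_star[OF E.wf_digraph ext]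
  and hom_idem = ext_path_hom_idem[OF E.wf_digraph ext]

lemma regularD:
  assumes "u \<in> reg_verts E" "idem \<tau> \<in> gis F" "gis_mult (idem \<tau>) (\<phi> (vertex_elem u)) = idem \<tau>"
  obtains e where "e \<in> out_arcs E u" "gis_mult (idem \<tau>) (\<phi> (idem (edge_path E e))) \<noteq> Zero"
  using assms reg reg_hom_iff[OF E.wf_digraph] by blast

lemma orthogonal_edges:
  assumes "e \<in> arcs E" "e' \<in> arcs E" "e \<noteq> e'"
  shows "gis_mult (\<phi> (idem (edge_path E e))) (\<phi> (idem (edge_path E e'))) = Zero"
proof -
  have "gis_mult (idem (edge_path E e)) (idem (edge_path E e')) = Zero"
    using assms(3) by (auto simp: idem_mult_idem edge_path_def path_prefix_def)
  then show ?thesis using assms by (simp flip: hom_mult del: gis_mult.simps)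
qed

text \<open>The idempotent of e is absorbed by that of its source u, hence its image by (\<alpha>,
  \<alpha>); nonzero idempotents absorbed by (\<alpha>, \<alpha>) belong to extensions of
  \<alpha>.\<close>

lemma edge_image:
  assumes "u \<in> verts E" "\<phi> (vertex_elem u) = idem \<alpha>" "e \<in> out_arcs E u"
    "\<phi> (idem (edge_path E e)) \<noteq> Zero"
  obtains \<gamma> where "\<phi> (idem (edge_path E e)) = idem (append_edges \<alpha> \<gamma>)"
proof -
  have e: "idem (edge_path E e) \<in> gis E" "tail E e = u" using assms(3) by simp_all
  obtain \<beta> where \<beta>: "\<phi> (idem (edge_path E e)) = idem \<beta>"
    using gis_idempotent[OF hom_idem[OF e(1)] assms(4)] .
  have "gis_mult (\<phi> (vertex_elem u)) (\<phi> (idem (edge_path E e))) = \<phi> (idem (edge_path E e))"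
    using e assms(1) by (simp add: vertex_elem_mult_edge flip: hom_mult del: E.gis_iff)
  then have "gis_mult (idem \<alpha>) (idem \<beta>) = idem \<beta>" by (simp only: assms(2) \<beta>)
  then have "path_prefix \<alpha> \<beta>" by (auto simp: idem_mult_idem split: if_splits)
  then show ?thesis using that \<beta> by (metis path_prefixE)
qed

text \<open>The cover attached to u when the image of u is (\<alpha>, \<alpha>); edges sent to
  \<open>Zero\<close> leave no trace in it.\<close>

definition images :: "'v \<Rightarrow> ('w, 'f) path \<Rightarrow> 'f list set" where
  "images u \<alpha> = {\<gamma>. \<exists>e\<in>out_arcs E u. \<phi> (idem (edge_path E e)) = idem (append_edges \<alpha> \<gamma>)}"

text \<open>Comparable images would have a nonzero product, which orthogonality allows only for one
  and the same edge.\<close>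

lemma images_antichain:
  assumes "\<gamma> \<in> images u \<alpha>" "\<gamma>' \<in> images u \<alpha>" "prefix \<gamma> \<gamma>'" shows "\<gamma> = \<gamma>'"
proof -
  obtain e e' where e: "e \<in> arcs E" "\<phi> (idem (edge_path E e)) = idem (append_edges \<alpha> \<gamma>)"
    and e': "e' \<in> arcs E" "\<phi> (idem (edge_path E e')) = idem (append_edges \<alpha> \<gamma>')"
    using assms by (auto simp: images_def)
  have "e = e'"
    using orthogonal_edges[OF e(1) e'(1)] assms(3) e(2) e'(2) by (auto simp: idem_mult_idem)
  then show ?thesis using e e' by simp
qed

text \<open>Regularity tested on (\<alpha>\<delta>, \<alpha>\<delta>) gives an edge whose image does
  not annihilate it, and two idempotents with nonzero product have comparable paths.\<close>

lemma images_cover: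
  assumes u: "u \<in> reg_verts E" and \<alpha>: "\<phi> (vertex_elem u) = idem \<alpha>"
  shows "F.covers \<alpha> (images u \<alpha>)"
  unfolding F.covers_def
proof (intro conjI ballI allI impI)
  note uv = E.reg_vertsD[OF u]
  have "images u \<alpha> \<subseteq> (\<lambda>e. THE \<gamma>. \<phi> (idem (edge_path E e)) = idem (append_edges \<alpha> \<gamma>)) ` out_arcs E u"
  proof
    fix \<gamma> assume "\<gamma> \<in> images u \<alpha>"
    then obtain e where e: "e \<in> out_arcs E u" "\<phi> (idem (edge_path E e)) = idem (append_edges \<alpha> \<gamma>)"
      unfolding images_def by blast
    then have "\<gamma> = (THE \<gamma>. \<phi> (idem (edge_path E e)) = idem (append_edges \<alpha> \<gamma>))" by simp
    with e(1) show "\<gamma> \<in> (\<lambda>e. THE \<gamma>. \<phi> (idem (edge_path E e)) = idem (append_edges \<alpha> \<gamma>)) ` out_arcs E u"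
      by (rule rev_image_eqI)
  qed
  then show "finite (images u \<alpha>)" using uv finite_subset by blast
  show "append_edges \<alpha> \<gamma> \<in> fin_paths F" if \<gamma>: "\<gamma> \<in> images u \<alpha>" for \<gamma>
  proof -
    obtain e where "e \<in> out_arcs E u" "\<phi> (idem (edge_path E e)) = idem (append_edges \<alpha> \<gamma>)"
      using \<gamma> unfolding images_def by blast
    then show ?thesis using hom_closed[of "idem (edge_path E e)"] by simp
  qed
  fix \<delta> assume \<delta>: "append_edges \<alpha> \<delta> \<in> fin_paths F"
  have "gis_mult (idem (append_edges \<alpha> \<delta>)) (\<phi> (vertex_elem u)) = idem (append_edges \<alpha> \<delta>)"
    unfolding \<alpha> idem_mult_idem using F.path_prefix_append_edges_self by auto
  then obtain e where e: "e \<in> out_arcs E u"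
    "gis_mult (idem (append_edges \<alpha> \<delta>)) (\<phi> (idem (edge_path E e))) \<noteq> Zero"
    using regularD[OF u] \<delta> by (metis F.gis_iff(2))
  then have "\<phi> (idem (edge_path E e)) \<noteq> Zero" by auto
  then obtain \<gamma> where \<gamma>: "\<phi> (idem (edge_path E e)) = idem (append_edges \<alpha> \<gamma>)"
    using edge_image[OF _ \<alpha> e(1)] uv by blast
  have "prefix \<gamma> \<delta> \<or> prefix \<delta> \<gamma>"
    using e(2) unfolding \<gamma> by (auto simp: idem_mult_idem split: if_splits)
  moreover have "\<gamma> \<in> images u \<alpha>" unfolding images_def using e(1) \<gamma> by blast
  ultimately show "\<exists>\<gamma>\<in>images u \<alpha>. prefix \<gamma> \<delta> \<or> prefix \<delta> \<gamma>" by blast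
qed

lemma vertex_image:
  assumes "u \<in> verts E" "\<phi> (vertex_elem u) \<noteq> Zero"
  obtains \<alpha> where "\<alpha> \<in> fin_paths F" "\<phi> (vertex_elem u) = idem \<alpha>"
proof -
  have u: "vertex_elem u \<in> gis E" using assms(1) by simp
  obtain \<alpha> where \<alpha>: "\<phi> (vertex_elem u) = idem \<alpha>"
    using gis_idempotent[OF _ assms(2)] hom_idem u by (metis vertex_elem_def)
  moreover have "\<alpha> \<in> fin_paths F" using hom_closed[OF u] \<alpha> by simp
  ultimately show ?thesis using that by blast
qed

text \<open>The image of the relation at u is the defect of the cover formed by the images of the
  edges at u, or 0 if u is sent to \<open>Zero\<close>; \<open>covers_defect\<close> puts it in the
  ideal.\<close>

lemma push_relation:
  assumes u: "u \<in> reg_verts E"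
  shows "push \<phi> (leavitt_relation E u) \<in> leavitt_ideal F"
proof -
  note uv = E.reg_vertsD[OF u]
  let ?g = "\<lambda>e. \<phi> (idem (edge_path E e))" and ?O = "out_arcs E u"
  have push: "push \<phi> (leavitt_relation E u) = defect (\<phi> (vertex_elem u)) ?g ?O"
    using uv by (simp add: leavitt_relation_eq push_defect)
  show ?thesis
  proof (cases "\<phi> (vertex_elem u) = Zero")
    case True
    have "?g e = Zero" if "e \<in> ?O" for e
    proof -
      have "?g e = gis_mult (?g e) (\<phi> (vertex_elem u))"
        using that uv by (simp add: vertex_elem_mult_edge flip: hom_mult del: E.gis_iff)
      then show ?thesis using True by simp
    qed
    then have "defect (\<phi> (vertex_elem u)) ?g ?O = zeroA (contracted_alg F)"
      using True by (simp add: defect_def contracted_alg_simps basis_elem_def fun_eq_iff)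
    then show ?thesis using F.leavitt.ideal_closed(2) push by simp
  next
    case False
    then obtain \<alpha> where \<alpha>: "\<alpha> \<in> fin_paths F" "\<phi> (vertex_elem u) = idem \<alpha>"
      using vertex_image uv by blast
    let ?O' = "{e \<in> ?O. ?g e \<noteq> Zero}" and ?\<Gamma> = "images u \<alpha>"
    let ?h = "\<lambda>\<gamma>. idem (append_edges \<alpha> \<gamma>)"
    \<comment> \<open>Two edges with the same nonzero image would make that image idempotent and of
      square \<open>Zero\<close>.\<close>
    have inj: "inj_on ?g ?O'"
    proof (rule inj_onI, rule ccontr)
      fix e e' assume e: "e \<in> ?O'" "e' \<in> ?O'" "?g e = ?g e'" "e \<noteq> e'"
      then have "gis_mult (?g e) (?g e) = Zero" using orthogonal_edges[of e e'] by simp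
      moreover have "gis_mult (?g e) (?g e) = ?g e" using e by (intro hom_idem) simp
      ultimately show False using e by simp
    qed
    have img: "?g ` ?O' = ?h ` ?\<Gamma>"
    proof (intro equalityI subsetI)
      fix t assume "t \<in> ?g ` ?O'"
      then obtain e where e: "e \<in> ?O" "?g e \<noteq> Zero" "t = ?g e" by blast
      obtain \<gamma> where "?g e = ?h \<gamma>" using edge_image[OF _ \<alpha>(2) e(1,2)] uv by blast
      moreover then have "\<gamma> \<in> ?\<Gamma>" using e(1) unfolding images_def by blast
      ultimately show "t \<in> ?h ` ?\<Gamma>" using e(3) by simp
    next
      fix t assume "t \<in> ?h ` ?\<Gamma>"
      then obtain \<gamma> e where "e \<in> ?O" "?g e = ?h \<gamma>" "t = ?h \<gamma>" by (auto simp: images_def)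
      then show "t \<in> ?g ` ?O'" by force
    qed
    \<comment> \<open>The sum over edges becomes a sum over the set of images: edges sent to
      \<open>Zero\<close> contribute 0, and the remaining ones have distinct images.\<close>
    have "(\<Sum>e\<in>?O. basis_elem (?g e) s) = (\<Sum>\<gamma>\<in>?\<Gamma>. basis_elem (?h \<gamma>) s)" for s
    proof -
      have "(\<Sum>e\<in>?O. basis_elem (?g e) s) = (\<Sum>e\<in>?O'. basis_elem (?g e) s)"
        using uv by (intro sum.mono_neutral_right) (auto simp: basis_elem_def)
      also have "\<dots> = (\<Sum>t\<in>?h ` ?\<Gamma>. basis_elem t s)"
        using inj by (simp add: sum.reindex flip: img)
      also have "\<dots> = (\<Sum>\<gamma>\<in>?\<Gamma>. basis_elem (?h \<gamma>) s)"
        by (subst sum.reindex) (auto intro: inj_onI)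
      finally show ?thesis .
    qed
    then have "defect (\<phi> (vertex_elem u)) ?g ?O = defect (idem \<alpha>) ?h ?\<Gamma>"
      using \<alpha> by (simp add: defect_def)
    then show ?thesis
      using F.covers_defect[OF images_cover[OF u \<alpha>(2)] \<alpha>(1)] images_antichain push by simp
  qed
qed

lemma push_star_hom: "restrict (push \<phi>) (carr (contracted_alg E)) \<in> star_hom (contracted_alg E) (contracted_alg F)"
proof (rule star_hom_restrictI[OF E.leavitt.star_algebra])
  show "push \<phi> f \<in> carr (contracted_alg F)" if "f \<in> carr (contracted_alg E)" for f
    using that ev_push_aux(1,3)[of f \<phi>] hom_closed by (fastforce simp: contracted_alg_simps(1))
  show "push \<phi> (addA (contracted_alg E) f g) = addA (contracted_alg F) (push \<phi> f) (push \<phi> g)"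
    if "f \<in> carr (contracted_alg E)" "g \<in> carr (contracted_alg E)" for f g
    using that by (auto simp: contracted_alg_simps push_def ev_add)
  show "push \<phi> (scaleA (contracted_alg E) c f) = scaleA (contracted_alg F) c (push \<phi> f)" for c f
    by (auto simp: contracted_alg_simps push_def ev_scale)
  show "push \<phi> (multA (contracted_alg E) f g) = multA (contracted_alg F) (push \<phi> f) (push \<phi> g)"
    if "f \<in> carr (contracted_alg E)" "g \<in> carr (contracted_alg E)" for f g
  proof
    fix r
    \<comment> \<open>Multiplicativity of \<phi> is known only on \<open>gis E\<close>; this
      suffices because the supports lie there.\<close>
    have fin: "finite (supp f)" "finite (supp g)" and sub: "supp f \<subseteq> gis E" "supp g \<subseteq> gis E"
      using that by (auto simp: contracted_alg_simps(1))
    have "ev (\<lambda>s. ev (\<lambda>t. of_bool (\<phi> (gis_mult s t) = r)) g) f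
      = ev (\<lambda>s. ev (\<lambda>t. of_bool (gis_mult (\<phi> s) (\<phi> t) = r)) g) f"
    proof (intro ev_cong)
      fix s t assume "s \<in> supp f" "t \<in> supp g"
      then have "s \<in> gis E" "t \<in> gis E" using sub by blast+
      then show "of_bool (\<phi> (gis_mult s t) = r) = of_bool (gis_mult (\<phi> s) (\<phi> t) = r)"
        by (simp add: hom_mult)
    qed
    then show "push \<phi> (multA (contracted_alg E) f g) r
      = multA (contracted_alg F) (push \<phi> f) (push \<phi> g) r"
      by (simp add: contracted_alg_simps(5) push_def[of \<phi> "conv f g"] conv_def[of "push \<phi> f"]
          ev_conv fin ev_push)
  qed
  show "push \<phi> (starA (contracted_alg E) f) = starA (contracted_alg F) (push \<phi> f)"
    if "f \<in> carr (contracted_alg E)" for f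
  proof
    fix r
    have sub: "supp f \<subseteq> gis E" using that by (auto simp: contracted_alg_simps(1))
    have "ev (\<lambda>s. cnj (of_bool (\<phi> (gis_star s) = r))) f = ev (\<lambda>s. of_bool (\<phi> s = gis_star r)) f"
    proof (rule ev_cong)
      fix s assume "s \<in> supp f"
      then have "\<phi> (gis_star s) = r \<longleftrightarrow> \<phi> s = gis_star r"
        using sub hom_star by (metis gis_star_star subsetD)
      then show "cnj (of_bool (\<phi> (gis_star s) = r)) = of_bool (\<phi> s = gis_star r)" by simp
    qed
    then show "push \<phi> (starA (contracted_alg E) f) r = starA (contracted_alg F) (push \<phi> f) r"
      by (simp add: contracted_alg_simps(6) push_def[of \<phi> "adj f"] adj_def[of "push \<phi> f"]
          push_def[of \<phi> f] ev_adj)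
  qed
qed

lemma push_ideal:
  assumes "x \<in> leavitt_ideal E" shows "push \<phi> x \<in> leavitt_ideal F"
proof -
  let ?h = "restrict (push \<phi>) (carr (contracted_alg E))"
  have "leavitt_ideal E \<subseteq> {x \<in> carr (contracted_alg E). ?h x \<in> leavitt_ideal F}"
    unfolding leavitt_ideal_def[of E]
    by (rule ideal_gen_least[OF two_sided_ideal_hom_vimage[OF E.leavitt.star_algebra
            F.leavitt.star_algebra push_star_hom F.leavitt.ideal]])
      (use E.leavitt_relation_carr push_relation in auto)
  with assms show ?thesis by auto
qed

text \<open>Existence: \<open>push \<phi>\<close> respects the ideals and descends to the quotients.
  Uniqueness: the classes of semigroup elements span.\<close>

lemma leavitt_map_unique_existence: "\<exists>!f. is_leavitt_map E F \<phi> f"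
proof -
  let ?h = "restrict (push \<phi>) (carr (contracted_alg E))"
  have "?h x \<in> leavitt_ideal F" if "x \<in> leavitt_ideal E" for x
    using push_ideal[OF that] E.leavitt.ideal_closed(1)[OF that] by simp
  then obtain f where f: "f \<in> star_hom (leavitt E) (leavitt F)"
    "\<And>x. x \<in> carr (contracted_alg E) \<Longrightarrow>
      f (coset (contracted_alg E) (leavitt_ideal E) x) = coset (contracted_alg F) (leavitt_ideal F) (?h x)"
    using quotient_hom[OF E.star_ideal_leavitt F.star_ideal_leavitt push_star_hom, folded leavitt_def]
    by blast
  then have "is_leavitt_map E F \<phi> f"
    by (simp add: is_leavitt_map_def leavitt_gen_def push_basis)
  moreover have "g = h" if g: "is_leavitt_map E F \<phi> g" and h: "is_leavitt_map E F \<phi> h" for g h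
  proof -
    have gh: "g \<in> star_hom (leavitt E) (leavitt F)" "h \<in> star_hom (leavitt E) (leavitt F)"
      using g h by (simp_all add: is_leavitt_map_def)
    interpret A: star_alg "leavitt E" using E.star_algebra_leavitt by unfold_locales
    have "g x = h x" if "x \<in> carr (leavitt E)" for x
      using that
    proof (induction rule: E.leavitt_induct)
      case zero
      then show ?case
        using gh[THEN star_hom_zero[OF E.star_algebra_leavitt F.star_algebra_leavitt]] by simp
    next
      case (add c t x)
      then show ?case
        using g h E.leavitt_gen_ops(1)[of t]
        by (simp add: star_homD[OF gh(1)] star_homD[OF gh(2)] is_leavitt_map_def)
    qed
    then show ?thesis using star_hom_eqI[OF gh] by blast
  qed
  ultimately show ?thesis by blast
qed

lemma leavitt_map: "is_leavitt_map E F \<phi> (leavitt_map E F \<phi>)"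
  unfolding leavitt_map_def by (rule theI'[OF leavitt_map_unique_existence])

text \<open>The universal property of \<open>graph_cstar E\<close> is applied with target
  \<open>graph_cstar F\<close> to the Leavitt map followed by the canonical map.\<close>

lemma cstar_map_unique_existence: "\<exists>!g. is_cstar_map E F \<phi> g"
proof -
  have C: "cstar_algebra (graph_cstar F)" "graph_cstar_incl F \<in> star_hom (leavitt F) (graph_cstar F)"
    using F.universal_enveloping_graph_cstar unfolding universal_enveloping_def by blast+
  let ?\<pi> = "compose (carr (leavitt E)) (graph_cstar_incl F) (leavitt_map E F \<phi>)"
  have "?\<pi> \<in> star_hom (leavitt E) (graph_cstar F)"
    using leavitt_map C(2) by (intro star_hom_compose E.star_algebra_leavitt) (auto simp: is_leavitt_map_def)
  then have "\<exists>!\<rho>. \<rho> \<in> star_hom (graph_cstar E) (graph_cstar F) \<and>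
      (\<forall>x\<in>carr (leavitt E). \<rho> (graph_cstar_incl E x) = ?\<pi> x)"
    using E.universal_enveloping_graph_cstar C(1) unfolding universal_enveloping_def by blast
  then show ?thesis by (simp add: is_cstar_map_def compose_def)
qed

lemma cstar_map: "is_cstar_map E F \<phi> (cstar_map E F \<phi>)"
  unfolding cstar_map_def by (rule theI'[OF cstar_map_unique_existence])

lemma leavitt_map_eqI: "is_leavitt_map E F \<phi> f \<Longrightarrow> leavitt_map E F \<phi> = f"
  using leavitt_map leavitt_map_unique_existence by blast

lemma cstar_map_eqI: "is_cstar_map E F \<phi> g \<Longrightarrow> cstar_map E F \<phi> = g"
  using cstar_map cstar_map_unique_existence by blast

text \<open>
  Regularity at \<open>u\<close> transfers along a path \<open>\<alpha>\<close> ending in \<open>u\<close> by conjugation with the image of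
  \<open>(\<alpha>, u)\<close>.
\<close>

lemma regular_at_path:
  assumes \<alpha>: "\<alpha> \<in> fin_paths E" "path_target E \<alpha> \<in> reg_verts E"
    and \<tau>: "idem \<tau> \<in> gis F" "gis_mult (idem \<tau>) (\<phi> (idem \<alpha>)) = idem \<tau>"
  obtains e where "e \<in> out_arcs E (path_target E \<alpha>)"
    "gis_mult (idem \<tau>) (\<phi> (idem (append_edges \<alpha> [e]))) \<noteq> Zero"
proof -
  let ?v = "path_target E \<alpha>" and ?m = gis_mult
  let ?\<nu> = "vertex_path ?v"
  have v: "?v \<in> verts E" using E.reg_vertsD[OF \<alpha>(2)] by simp
  define t a a' where "t = idem \<tau>" and "a = \<phi> (Pr \<alpha> ?\<nu>)" and "a' = \<phi> (Pr ?\<nu> \<alpha>)"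
  have g: "Pr \<alpha> ?\<nu> \<in> gis E" "Pr ?\<nu> \<alpha> \<in> gis E" "idem \<alpha> \<in> gis E" using \<alpha> v by simp_all
  have aa': "?m a a' = \<phi> (idem \<alpha>)" and a'a: "?m a' a = \<phi> (vertex_elem ?v)"
    using g by (simp_all add: a_def a'_def vertex_elem_def flip: hom_mult del: E.gis_iff)
  have tt: "?m t t = t" and t0: "t \<noteq> Zero" and taa': "?m t (?m a a') = t"
    using \<tau>(2) by (simp_all add: t_def aa')
  have aa't: "?m (?m a a') t = t"
    using idempotents_commute[OF tt, of "?m a a'"] taa' hom_idem[OF g(3)] aa' by simp
  \<comment> \<open>Since a a' = \<phi>(\<alpha>, \<alpha>) fixes t on both sides, a t' a' = t; so
    t' is a nonzero idempotent, and it lies below the image of the end vertex.\<close>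
  define t' where "t' = ?m a' (?m t a)"
  have "?m a (?m t' a') = ?m (?m (?m a a') t) (?m a a')" by (simp add: t'_def gis_mult_assoc)
  then have "?m a (?m t' a') = t" using aa't taa' by simp
  then have "t' \<noteq> Zero" using t0 by auto
  moreover have "?m t' t' = ?m a' (?m (?m (?m t (?m a a')) t) a)" by (simp add: t'_def gis_mult_assoc)
  then have "?m t' t' = t'" by (simp add: taa' tt t'_def)
  ultimately obtain \<tau>' where \<tau>': "t' = idem \<tau>'" using gis_idempotent by blast
  have "t' \<in> gis F" using \<tau>(1) g by (simp add: t'_def t_def a_def a'_def F.gis_mult_closed del: F.gis_iff)
  moreover have "?m t' (?m a' a) = ?m a' (?m (?m t (?m a a')) a)" by (simp add: t'_def gis_mult_assoc)
  then have "?m t' (\<phi> (vertex_elem ?v)) = t'" by (simp add: taa' t'_def flip: a'a)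
  ultimately obtain e where e: "e \<in> out_arcs E ?v" "?m t' (\<phi> (idem (edge_path E e))) \<noteq> Zero"
    using regularD[OF \<alpha>(2)] \<tau>' by metis
  define x where "x = \<phi> (idem (edge_path E e))"
  have eg: "idem (edge_path E e) \<in> gis E" "vertex_elem ?v \<in> gis E" "tail E e = ?v" using e(1) v by simp_all
  have "?m x (?m a' a) = x"
    using eg by (simp add: x_def a'a vertex_elem_mult_edge flip: hom_mult del: E.gis_iff)
  \<comment> \<open>Conjugating t (a x a') by a' and a returns t' x, so nonvanishing at the vertex
    carries back to \<alpha>.\<close>
  then have "?m a' (?m (?m t (?m a (?m x a'))) a) = ?m t' x" by (simp add: t'_def gis_mult_assoc)
  then have "?m t (?m a (?m x a')) \<noteq> Zero" using e(2) by (auto simp: x_def)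
  moreover have "?m a (?m x a') = \<phi> (?m (Pr \<alpha> ?\<nu>) (?m (idem (edge_path E e)) (Pr ?\<nu> \<alpha>)))"
    using g eg by (simp add: a_def a'_def x_def hom_mult E.gis_mult_closed del: E.gis_iff gis_mult.simps)
  moreover have "?m (Pr \<alpha> ?\<nu>) (?m (idem (edge_path E e)) (Pr ?\<nu> \<alpha>)) = idem (append_edges \<alpha> [e])"
    using eg(3) by (simp add: E.edge_path_append E.path_prefix_append_edges_self)
  ultimately show ?thesis using that e(1) by (simp add: t_def)
qed

text \<open>Regularity for a finite cover in place of the edges at a vertex: this is what a second
  homomorphism meets after a first one has turned edges into longer paths. The induction moves
  \<tau> down one edge at a time.\<close>

lemma covers_nonzero:
  assumes "E.covers \<alpha> \<Gamma>" "\<alpha> \<in> fin_paths E"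
    and "idem \<tau> \<in> gis F" "gis_mult (idem \<tau>) (\<phi> (idem \<alpha>)) = idem \<tau>"
  obtains \<gamma> where "\<gamma> \<in> \<Gamma>" "gis_mult (idem \<tau>) (\<phi> (idem (append_edges \<alpha> \<gamma>))) \<noteq> Zero"
proof -
  have "\<exists>\<gamma>\<in>\<Gamma>. gis_mult (idem \<tau>) (\<phi> (idem (append_edges \<alpha> \<gamma>))) \<noteq> Zero"
    using assms
  proof (induction arbitrary: \<tau> rule: E.covers_induct)
    case (Nil \<alpha> \<Gamma>)
    then show ?case by (intro bexI[of _ "[]"]) auto
  next
    case (step \<alpha> \<Gamma>)
    obtain e where e: "e \<in> out_arcs E (path_target E \<alpha>)"
      "gis_mult (idem \<tau>) (\<phi> (idem (append_edges \<alpha> [e]))) \<noteq> Zero"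
      using regular_at_path[OF step.hyps(2,4) step.prems] .
    let ?\<alpha>e = "append_edges \<alpha> [e]"
    have \<alpha>e: "idem ?\<alpha>e \<in> gis E" using E.append_edge_fin_paths(1)[OF step.hyps(2) e(1)] by simp
    \<comment> \<open>The new test element: nonzero by the choice of e, idempotent as a product of
      commuting idempotents, and below the image of \<alpha>e.\<close>
    define t where "t = gis_mult (idem \<tau>) (\<phi> (idem ?\<alpha>e))"
    have id: "gis_mult (\<phi> (idem ?\<alpha>e)) (\<phi> (idem ?\<alpha>e)) = \<phi> (idem ?\<alpha>e)" using \<alpha>e by (rule hom_idem)
    have "gis_mult (idem \<tau>) (\<phi> (idem ?\<alpha>e)) = gis_mult (\<phi> (idem ?\<alpha>e)) (idem \<tau>)"
      by (rule idempotents_commute[OF _ id]) simp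
    moreover have "gis_mult (idem \<tau>) (idem \<tau>) = idem \<tau>" by simp
    ultimately have "gis_mult t t = t" unfolding t_def by (metis id gis_mult_assoc)
    then obtain \<tau>' where \<tau>': "t = idem \<tau>'" using gis_idempotent e(2) t_def by blast
    have t: "t \<in> gis F" using step.prems(1) \<alpha>e by (simp add: t_def F.gis_mult_closed del: F.gis_iff E.gis_iff)
    have "gis_mult t (\<phi> (idem ?\<alpha>e)) = t" by (simp add: t_def gis_mult_assoc id del: gis_mult.simps)
    then obtain \<gamma> where \<gamma>: "e # \<gamma> \<in> \<Gamma>"
      "gis_mult t (\<phi> (idem (append_edges ?\<alpha>e \<gamma>))) \<noteq> Zero"
      using step.IH[OF e(1)] t \<tau>' by blast
    have "append_edges \<alpha> (e # \<gamma>) \<in> fin_paths E" using step.hyps(1) \<gamma>(1) by (simp add: E.covers_def)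
    then have "idem (append_edges \<alpha> (e # \<gamma>)) \<in> gis E" by simp
    moreover have "gis_mult (idem ?\<alpha>e) (idem (append_edges \<alpha> (e # \<gamma>))) = idem (append_edges \<alpha> (e # \<gamma>))"
      by (simp add: idem_mult_idem)
    \<comment> \<open>The image of \<alpha>e absorbs that of \<alpha>e\<gamma>, so a nonzero product
      with t is one with \<tau>.\<close>
    ultimately have "gis_mult (\<phi> (idem ?\<alpha>e)) (\<phi> (idem (append_edges \<alpha> (e # \<gamma>))))
        = \<phi> (idem (append_edges \<alpha> (e # \<gamma>)))"
      using \<alpha>e by (simp flip: hom_mult del: E.gis_iff)
    then have "gis_mult (idem \<tau>) (\<phi> (idem (append_edges \<alpha> (e # \<gamma>)))) \<noteq> Zero"
      using \<gamma>(2) by (simp add: t_def gis_mult_assoc del: gis_mult.simps)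
    then show ?case using \<gamma>(1) by blast
  qed
  then show ?thesis using that by blast
qed

end

section \<open>Composites and identities of regular homomorphisms\<close>

lemma ext_path_hom_compose:
  assumes "wf_digraph E" "\<phi> \<in> ext_path_hom E F" "\<psi> \<in> ext_path_hom F G"
  shows "compose (gis E) \<psi> \<phi> \<in> ext_path_hom E G"
proof -
  interpret wf_digraph E by (rule assms(1))
  show ?thesis
    using ext_path_homD[OF assms(2)] ext_path_homD[OF assms(3)]
    by (simp add: ext_path_hom_def compose_def)
qed

text \<open>The images under \<phi> of the edges at u cover \<alpha>, where (\<alpha>, \<alpha>) is
  the image of u; \<open>covers_nonzero\<close> for \<psi> selects one of them, and it comes from an
  edge at u.\<close>

lemma reg_hom_compose:
  assumes "wf_digraph E" "wf_digraph F" "wf_digraph G" "\<phi> \<in> reg_hom E F" "\<psi> \<in> reg_hom F G"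
  shows "compose (gis E) \<psi> \<phi> \<in> reg_hom E G"
proof -
  interpret EF: regular_hom E F \<phi>
    by (intro regular_hom.intro regular_hom_axioms.intro assms)
  interpret FG: regular_hom F G \<psi>
    by (intro regular_hom.intro regular_hom_axioms.intro assms)
  show ?thesis
    unfolding reg_hom_iff[OF assms(1)]
  proof (intro conjI ballI allI impI)
    show "compose (gis E) \<psi> \<phi> \<in> ext_path_hom E G"
      by (rule ext_path_hom_compose[OF assms(1) EF.ext FG.ext])
    fix u \<tau> assume u: "u \<in> reg_verts E" and \<tau>: "idem \<tau> \<in> gis G"
      and le: "gis_mult (idem \<tau>) (compose (gis E) \<psi> \<phi> (vertex_elem u)) = idem \<tau>"
    have uv: "u \<in> verts E" using EF.E.reg_vertsD[OF u] by simp
    then have le': "gis_mult (idem \<tau>) (\<psi> (\<phi> (vertex_elem u))) = idem \<tau>"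
      using le by (simp add: compose_def)
    then have "\<phi> (vertex_elem u) \<noteq> Zero" by auto
    then obtain \<alpha> where \<alpha>: "\<alpha> \<in> fin_paths F" "\<phi> (vertex_elem u) = idem \<alpha>"
      using EF.vertex_image[OF uv] by blast
    obtain \<gamma> where \<gamma>: "\<gamma> \<in> EF.images u \<alpha>"
      "gis_mult (idem \<tau>) (\<psi> (idem (append_edges \<alpha> \<gamma>))) \<noteq> Zero"
      using FG.covers_nonzero[OF EF.images_cover[OF u \<alpha>(2)] \<alpha>(1) \<tau>] le' \<alpha>(2) by auto
    then obtain e where "e \<in> out_arcs E u" "\<phi> (idem (edge_path E e)) = idem (append_edges \<alpha> \<gamma>)"
      by (auto simp: EF.images_def)
    then show "\<exists>e\<in>out_arcs E u.
        gis_mult (idem \<tau>) (compose (gis E) \<psi> \<phi> (idem (edge_path E e))) \<noteq> Zero"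
      using \<gamma>(2) by (intro bexI[of _ e]) (auto simp: compose_def)
  qed
qed

lemma reg_hom_id:
  assumes "wf_digraph E" shows "restrict id (gis E) \<in> reg_hom E E"
proof -
  interpret wf_digraph E by (rule assms)
  show ?thesis
    unfolding reg_hom_iff[OF assms]
  proof (intro conjI ballI allI impI)
    show "restrict id (gis E) \<in> ext_path_hom E E" by (simp add: ext_path_hom_def)
    fix u \<tau> assume u: "u \<in> reg_verts E" and \<tau>: "idem \<tau> \<in> gis E"
      and le: "gis_mult (idem \<tau>) (restrict id (gis E) (vertex_elem u)) = idem \<tau>"
    have "gis_mult (idem \<tau>) (idem (vertex_path u)) = idem \<tau>"
      using le reg_vertsD[OF u] by (simp add: vertex_elem_def del: gis_mult.simps)
    then have "path_prefix (vertex_path u) \<tau>" by (auto simp: idem_mult_idem split: if_splits)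
    then obtain p where p: "\<tau> = append_edges (vertex_path u) p" by (rule path_prefixE)
    \<comment> \<open>The edge is the first one of \<tau>; if \<tau> is the vertex u itself, any
      edge at u serves, and one exists because u is regular.\<close>
    obtain e where "e \<in> out_arcs E u" "prefix [e] p \<or> p = []"
    proof (cases p)
      case Nil
      moreover obtain e where "e \<in> out_arcs E u" using u unfolding reg_verts_def by blast
      ultimately show ?thesis using that by blast
    next
      case (Cons e q)
      then show ?thesis using append_edges_hd_out_arcs[of "vertex_path u" e q] \<tau> p that by simp
    qed
    moreover then have "gis_mult (idem \<tau>) (idem (edge_path E e)) \<noteq> Zero"
      using p by (auto simp: idem_mult_idem edge_path_append)
    moreover have "idem (edge_path E e) \<in> gis E" using calculation(1) by simp
    ultimately show "\<exists>e\<in>out_arcs E u.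
        gis_mult (idem \<tau>) (restrict id (gis E) (idem (edge_path E e))) \<noteq> Zero"
      by (intro bexI[of _ e]) (simp_all only: restrict_apply' id_apply not_False_eq_True)
  qed
qed

section \<open>Functoriality\<close>

lemma restrict_id_compose:
  assumes "f \<in> S \<rightarrow>\<^sub>E T"
  shows "compose S f (restrict id S) = f" "compose S (restrict id T) f = f"
  using PiE_mem[OF assms] PiE_arb[OF assms] by (auto simp: compose_def)

lemma is_category_REG: "is_category REG"
  unfolding is_category_def REG_def
proof (simp, intro conjI allI impI ballI)
  fix X Y :: "('a, 'b) pre_digraph" and f assume "wf_digraph X" "wf_digraph Y" "f \<in> reg_hom X Y"
  then have f: "f \<in> gis X \<rightarrow>\<^sub>E gis Y" by (simp add: reg_hom_def ext_path_hom_def)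
  show "compose (gis X) f (restrict id (gis X)) = f" "compose (gis X) (restrict id (gis Y)) f = f"
    using restrict_id_compose[OF f] by simp_all
next
  fix W X Y Z :: "('a, 'b) pre_digraph" and f g h
  assume "f \<in> reg_hom W X"
  then have "f \<in> gis W \<rightarrow> gis X" by (auto simp: reg_hom_def ext_path_hom_def)
  then show "compose (gis W) h (compose (gis W) g f) = compose (gis W) (compose (gis X) h g) f"
    by (rule compose_assoc)
qed (simp_all add: reg_hom_id reg_hom_compose)

lemma is_category_CSTAR_ALG: "is_category CSTAR_ALG"
  unfolding is_category_def CSTAR_ALG_def
proof (simp, intro conjI allI impI ballI)
  fix X Y :: "'a normed_star_alg" and f assume "f \<in> star_hom X Y"
  then have f: "f \<in> carr X \<rightarrow>\<^sub>E carr Y" by (simp add: star_hom_def)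
  show "compose (carr X) f (restrict id (carr X)) = f" "compose (carr X) (restrict id (carr Y)) f = f"
    using restrict_id_compose[OF f] by simp_all
next
  fix W X Y Z :: "'a normed_star_alg" and f g h
  assume "f \<in> star_hom W X"
  then have "f \<in> carr W \<rightarrow> carr X" by (auto simp: star_hom_def)
  then show "compose (carr W) h (compose (carr W) g f) = compose (carr W) (compose (carr X) h g) f"
    by (rule compose_assoc)
qed (auto simp: star_hom_id cstar_algebra_def intro: star_hom_compose)

lemma cstar_algebra_graph_cstar: "wf_digraph E \<Longrightarrow> cstar_algebra (graph_cstar E)"
  using wf_digraph.universal_enveloping_graph_cstar unfolding universal_enveloping_def by blast

lemma graph_cstar_incl_star_hom:
  "wf_digraph E \<Longrightarrow> graph_cstar_incl E \<in> star_hom (leavitt E) (graph_cstar E)"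
  using wf_digraph.universal_enveloping_graph_cstar unfolding universal_enveloping_def by blast

text \<open>Identity maps satisfy the characterizing properties on both levels, so uniqueness gives
  the claim; composites are treated in the same way.\<close>

lemma cstar_map_id:
  assumes E: "wf_digraph E"
  shows "cstar_map E E (restrict id (gis E)) = restrict id (carr (graph_cstar E))"
proof -
  interpret regular_hom E E "restrict id (gis E)"
    by (intro regular_hom.intro regular_hom_axioms.intro E reg_hom_id)
  have star: "star_algebra (leavitt E)" "star_algebra (graph_cstar E)"
    using E.star_algebra_leavitt cstar_algebra_graph_cstar[OF E] by (auto simp: cstar_algebra_def)
  have "is_leavitt_map E E (restrict id (gis E)) (restrict id (carr (leavitt E)))"
    using star_hom_id[OF star(1)] E.leavitt_gen_ops(1) by (simp add: is_leavitt_map_def)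
  from leavitt_map_eqI[OF this] show ?thesis
    using star_hom_id[OF star(2)] star_homD(1)[OF graph_cstar_incl_star_hom[OF E]]
    by (intro cstar_map_eqI) (simp add: is_cstar_map_def)
qed

lemma cstar_map_compose:
  assumes "wf_digraph E" "wf_digraph F" "wf_digraph G" "\<phi> \<in> reg_hom E F" "\<psi> \<in> reg_hom F G"
  shows "cstar_map E G (compose (gis E) \<psi> \<phi>)
    = compose (carr (graph_cstar E)) (cstar_map F G \<psi>) (cstar_map E F \<phi>)"
proof -
  interpret EF: regular_hom E F \<phi>
    by (intro regular_hom.intro regular_hom_axioms.intro assms)
  interpret FG: regular_hom F G \<psi>
    by (intro regular_hom.intro regular_hom_axioms.intro assms)
  interpret EG: regular_hom E G "compose (gis E) \<psi> \<phi>"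
    by (intro regular_hom.intro regular_hom_axioms.intro assms(1,3) reg_hom_compose[OF assms])
  let ?l = "compose (carr (leavitt E)) (leavitt_map F G \<psi>) (leavitt_map E F \<phi>)"
  note lE = EF.leavitt_map[unfolded is_leavitt_map_def]
    and lF = FG.leavitt_map[unfolded is_leavitt_map_def]
    and cE = EF.cstar_map[unfolded is_cstar_map_def]
    and cF = FG.cstar_map[unfolded is_cstar_map_def]
  have "?l \<in> star_hom (leavitt E) (leavitt G)"
    using lE lF by (intro star_hom_compose EF.E.star_algebra_leavitt) auto
  then have "is_leavitt_map E G (compose (gis E) \<psi> \<phi>) ?l"
    using lE lF EF.E.leavitt_gen_ops(1) EF.hom_closed
    by (simp add: is_leavitt_map_def compose_def)
  then have l: "leavitt_map E G (compose (gis E) \<psi> \<phi>) = ?l" by (rule EG.leavitt_map_eqI)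
  have "compose (carr (graph_cstar E)) (cstar_map F G \<psi>) (cstar_map E F \<phi>)
      \<in> star_hom (graph_cstar E) (graph_cstar G)"
    using cE cF cstar_algebra_graph_cstar[OF assms(1)]
    by (intro star_hom_compose) (auto simp: cstar_algebra_def)
  then show ?thesis
    using cE cF l star_homD(1)[OF graph_cstar_incl_star_hom[OF assms(1)]]
      star_homD(1)[OF lE[THEN conjunct1]]
    by (intro EG.cstar_map_eqI) (simp add: is_cstar_map_def compose_def)
qed

text \<open>\<open>REG\<close> fixes the types of vertices and edges. The clauses after the first
  tie the objects to their universal property, show that the induced maps are determined by their
  descriptions, and give composition for graphs over different types.\<close>

theorem corollary4p10:
  shows
    "is_functor (REG :: (('v, 'e) pre_digraph, ('v, 'e) gis_elem \<Rightarrow> ('v, 'e) gis_elem) category)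
       CSTAR_ALG graph_cstar cstar_map
     \<and> (\<forall>E :: ('v1, 'e1) pre_digraph. wf_digraph E \<longrightarrow>
          star_algebra (leavitt E) \<and>
          universal_enveloping TYPE('b) (leavitt E) (graph_cstar E) (graph_cstar_incl E))
     \<and> (\<forall>(E :: ('v1, 'e1) pre_digraph) (F :: ('v2, 'e2) pre_digraph).
          wf_digraph E \<and> wf_digraph F \<longrightarrow>
          (\<forall>\<phi>\<in>reg_hom E F. (\<exists>!f. is_leavitt_map E F \<phi> f) \<and> (\<exists>!g. is_cstar_map E F \<phi> g)))
     \<and> (\<forall>(E :: ('v1, 'e1) pre_digraph) (F :: ('v2, 'e2) pre_digraph) (G :: ('v3, 'e3) pre_digraph).
          wf_digraph E \<and> wf_digraph F \<and> wf_digraph G \<longrightarrow>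
          (\<forall>\<phi>\<in>reg_hom E F. \<forall>\<psi>\<in>reg_hom F G.
             compose (gis E) \<psi> \<phi> \<in> reg_hom E G \<and>
             cstar_map E G (compose (gis E) \<psi> \<phi>)
               = compose (carr (graph_cstar E)) (cstar_map F G \<psi>) (cstar_map E F \<phi>)))"
proof (intro conjI allI impI ballI; (elim conjE)?)
  have "cstar_map X Y f \<in> star_hom (graph_cstar X) (graph_cstar Y)"
    if "wf_digraph X" "wf_digraph Y" "f \<in> reg_hom X Y"
    for X Y :: "('v, 'e) pre_digraph" and f
    using regular_hom.cstar_map[OF regular_hom.intro[OF that(1,2) regular_hom_axioms.intro[OF that(3)]]]
    by (simp add: is_cstar_map_def)
  then show "is_functor (REG :: (('v, 'e) pre_digraph, ('v, 'e) gis_elem \<Rightarrow> ('v, 'e) gis_elem) category)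
       CSTAR_ALG graph_cstar cstar_map"
    unfolding is_functor_def
    by (simp add: is_category_REG is_category_CSTAR_ALG)
      (simp add: REG_def CSTAR_ALG_def cstar_algebra_graph_cstar cstar_map_id cstar_map_compose)
next
  fix E :: "('v1, 'e1) pre_digraph" assume "wf_digraph E"
  then show "star_algebra (leavitt E)"
    "universal_enveloping TYPE('b) (leavitt E) (graph_cstar E) (graph_cstar_incl E)"
    by (rule wf_digraph.star_algebra_leavitt wf_digraph.universal_enveloping_graph_cstar)+
next
  fix E :: "('v1, 'e1) pre_digraph" and F :: "('v2, 'e2) pre_digraph" and \<phi>
  assume "wf_digraph E" "wf_digraph F" "\<phi> \<in> reg_hom E F"
  then interpret regular_hom E F \<phi> by (intro regular_hom.intro regular_hom_axioms.intro)
  show "\<exists>!f. is_leavitt_map E F \<phi> f" "\<exists>!g. is_cstar_map E F \<phi> g"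
    by (rule leavitt_map_unique_existence cstar_map_unique_existence)+
qed (simp_all add: reg_hom_compose cstar_map_compose)

end
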